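(* Let $d=1$. For all $\alpha\in\mathbb R$ and $p\in(1,\infty)$ the local time $L_T^\alpha$ of the Brownian motion $W$ at level $\alpha$ up to time $T$ satisfies $$L_T^\alpha\in\mathbb B_p^{\Phi_4}\setminus\left[\bigcup_{r\in[2,4)}\mathbb B_p^{\Phi_r}\right].$$
   Context: Fix $T>0$. Let $W,W'$ be standard one-dimensional Brownian motions on $[0,T]$ with continuous paths starting at $0$ on complete probability spaces $(\Omega,\mathcal F,\mathbb P)$, $(\Omega',\mathcal F',\mathbb P')$, where $\mathcal F,\mathcal F'$ are the completions of $\sigma(W)$, $\sigma(W')$; on $\overline\Omega=\Omega\times\Omega'$ use the (completed) product measure and extend random variables canonically. For $0\le a<b\le T$ let $W^{(a,b]}_t=W_t$ for $t\le a$, $W_a+W'_t-W'_a$ for $a\le t\le b$, and $W_a+(W'_b-W'_a)+(W_t-W_b)$ for $b\le t\le T$. If $\xi=F(W)$ a.s. with $F$ measurable on $C([0,T])$, set $\xi^{(a,b]}:=F(W^{(a,b]})$. For $r\in[2,\infty)$ and $p\in(0,\infty)$, $\mathbb B_p^{\Phi_r}$ is the space of all $\xi\in L_p(\Omega,\mathcal F,\mathbb P)$ with $$\sup_{0\le a<b\le T}\frac{\|\xi-\xi^{(a,b]}\|_p}{(b-a)^{1/r}}<\infty.$$ The local time is $L_t^\alpha=\lim_{\varepsilon\downarrow0}\frac1{2\varepsilon}\int_0^t\chi_{(\alpha-\varepsilon,\alpha+\varepsilon)}(W_s)ds$ a.s. *)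

theory Defs
  imports "HOL-Probability.Probability"
begin

definition brownian_motion :: "real \<Rightarrow> 'a measure \<Rightarrow> (real \<Rightarrow> 'a \<Rightarrow> real) \<Rightarrow> bool" where
  "brownian_motion T M W \<longleftrightarrow>
     prob_space M \<and>
     (\<forall>t\<in>{0..T}. W t \<in> borel_measurable M) \<and>
     (\<forall>\<omega>\<in>space M. W 0 \<omega> = 0 \<and> continuous_on {0..T} (\<lambda>t. W t \<omega>)) \<and>
     (\<forall>s t. 0 \<le> s \<and> s < t \<and> t \<le> T \<longrightarrow>
        distributed M lborel (\<lambda>\<omega>. W t \<omega> - W s \<omega>) (\<lambda>x. ennreal (normal_density 0 (sqrt (t - s)) x))) \<and>
     (\<forall>n (t :: nat \<Rightarrow> real). strict_mono_on {..n} t \<and> t ` {..n} \<subseteq> {0..T} \<longrightarrow>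
        prob_space.indep_vars M (\<lambda>_. borel) (\<lambda>i \<omega>. W (t (Suc i)) \<omega> - W (t i) \<omega>) {..<n})"

definition generated_sigma :: "real \<Rightarrow> 'a measure \<Rightarrow> (real \<Rightarrow> 'a \<Rightarrow> real) \<Rightarrow> 'a measure" where
  "generated_sigma T M W =
     sigma (space M) {W t -` A \<inter> space M | t A. t \<in> {0..T} \<and> A \<in> sets borel}"

text \<open>A Brownian motion on a complete probability space whose \<open>\<sigma>\<close>-algebra is the completion of
  the one generated by the Brownian motion.\<close>

definition wiener_setting :: "real \<Rightarrow> 'a measure \<Rightarrow> (real \<Rightarrow> 'a \<Rightarrow> real) \<Rightarrow> bool" where
  "wiener_setting T M W \<longleftrightarrow>
     brownian_motion T M W \<and> M = completion (restr_to_subalg M (generated_sigma T M W))"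

text \<open>The space \<open>C([0,T])\<close>; its elements are represented by functions that are \<open>undefined\<close>
  outside of \<open>[0,T]\<close>. The coordinate \<open>\<sigma>\<close>-algebra used here is the Borel \<open>\<sigma>\<close>-algebra of the
  supremum norm. Only the underlying measurable space matters.\<close>

definition path_space :: "real \<Rightarrow> (real \<Rightarrow> real) measure" where
  "path_space T =
     restrict_space (\<Pi>\<^sub>M t\<in>{0..T}. borel) {x. continuous_on {0..T} x}"

definition sample_path :: "real \<Rightarrow> (real \<Rightarrow> 'a \<Rightarrow> real) \<Rightarrow> 'a \<Rightarrow> real \<Rightarrow> real" where
  "sample_path T X \<omega> = (\<lambda>t\<in>{0..T}. X t \<omega>)"

text \<open>The process \<open>W\<^bsup>(a,b]\<^esup>\<close>.\<close>

definition decoupled_process ::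
  "(real \<Rightarrow> 'a \<Rightarrow> real) \<Rightarrow> (real \<Rightarrow> 'b \<Rightarrow> real) \<Rightarrow> real \<Rightarrow> real \<Rightarrow> real \<Rightarrow> 'a \<times> 'b \<Rightarrow> real" where
  "decoupled_process W W' a b t = (\<lambda>(\<omega>, \<omega>').
     if t \<le> a then W t \<omega>
     else if t \<le> b then W a \<omega> + W' t \<omega>' - W' a \<omega>'
     else W a \<omega> + (W' b \<omega>' - W' a \<omega>') + (W t \<omega> - W b \<omega>))"

definition Lp_norm :: "'a measure \<Rightarrow> real \<Rightarrow> ('a \<Rightarrow> real) \<Rightarrow> ennreal" where
  "Lp_norm M p f =
     (let I = \<integral>\<^sup>+ x. ennreal (\<bar>f x\<bar> powr p) \<partial>M
      in if I = \<infinity> then \<infinity> else ennreal (enn2real I powr (1 / p)))"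

definition Lp_space :: "'a measure \<Rightarrow> real \<Rightarrow> ('a \<Rightarrow> real) set" where
  "Lp_space M p = {f \<in> borel_measurable M. Lp_norm M p f < \<infinity>}"

text \<open>The functional \<open>F\<close> with \<open>\<xi> = F(W)\<close> is unique up to null sets of the law of \<open>W\<close>, which is also
  the law of every \<open>W\<^bsup>(a,b]\<^esup>\<close>; so \<open>\<xi>\<^bsup>(a,b]\<^esup> = F(W\<^bsup>(a,b]\<^esup>)\<close> is almost surely independent of the
  choice of \<open>F\<close>, and the existential quantifier over \<open>F\<close> just selects a representation.\<close>

definition besov_space ::
  "real \<Rightarrow> 'a measure \<Rightarrow> (real \<Rightarrow> 'a \<Rightarrow> real) \<Rightarrow> 'b measure \<Rightarrow> (real \<Rightarrow> 'b \<Rightarrow> real) \<Rightarrow>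
   real \<Rightarrow> real \<Rightarrow> ('a \<Rightarrow> real) set" where
  "besov_space T M W M' W' r p =
     {\<xi> \<in> Lp_space M p.
        \<exists>F \<in> borel_measurable (path_space T).
          (AE \<omega> in M. \<xi> \<omega> = F (sample_path T W \<omega>)) \<and>
          (SUP (a, b) \<in> {(a, b). 0 \<le> a \<and> a < b \<and> b \<le> T}.
             Lp_norm (completion (M \<Otimes>\<^sub>M M')) p
               (\<lambda>(\<omega>, \<omega>'). \<xi> \<omega> - F (sample_path T (decoupled_process W W' a b) (\<omega>, \<omega>')))
             / ennreal ((b - a) powr (1 / r))) < \<infinity>}"

text \<open>\<open>L\<close> is (a version of) the local time at level \<open>\<alpha>\<close> up to time \<open>t\<close>.\<close>

definition is_local_time ::
  "'a measure \<Rightarrow> (real \<Rightarrow> 'a \<Rightarrow> real) \<Rightarrow> real \<Rightarrow> real \<Rightarrow> ('a \<Rightarrow> real) \<Rightarrow> bool" where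
  "is_local_time M W \<alpha> t L \<longleftrightarrow>
     (AE \<omega> in M.
       ((\<lambda>\<epsilon>. 1 / (2 * \<epsilon>) * (LBINT s:{0..t}. indicator {\<alpha> - \<epsilon><..<\<alpha> + \<epsilon>} (W s \<omega>)))
          \<longlongrightarrow> L \<omega>) (at_right 0))"

end

theory Submission
  imports Defs
begin

text \<open>Everything is transported to the Wiener measure on path space, which is invariant under
  \<open>(W, W') \<mapsto> W\<^bsup>(a,b]\<^esup>\<close>; taking \<open>b = T\<close>, this invariance also is the Markov property at
  time \<open>a\<close>. On \<open>(a,b]\<close> the local times of \<open>W\<close> and \<open>W\<^bsup>(a,b]\<^esup>\<close> are of order \<open>(b - a)\<^bsup>1/2\<^esup>\<close>.
  After \<open>b\<close> the two paths differ by a constant of order \<open>d = (b - a)\<^bsup>1/2\<^esup>\<close>, so there the local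
  times are those of one path at two levels of distance \<open>d\<close>, and these differ by \<open>d\<^bsup>1/2\<^esup>\<close>. The
  moments of the difference satisfy a recursion \<open>u\<^bsub>m+1\<^esub> = (m + 1) K (g u\<^bsub>m\<^esub>)\<close> with the heat potential
  \<open>K\<close> and a dipole \<open>g = f - f(\<cdot> + d)\<close>; two steps of it gain a factor \<open>d\<close>. Since \<open>K g\<close>
  has the sign of \<open>g\<close> near its poles and size \<open>d\<close> there, \<open>u\<^bsub>2\<^esub>\<close> is also bounded below by a multiple of \<open>d\<close>. Fatou's lemma
  transfers the bounds from occupation times of small intervals to the local time.\<close>

subsection \<open>Gaussian increments determine the law\<close>

text \<open>An estimate that is to survive the limit of shrinking intervals may use a density
  \<open>f\<close> only through its mass, since its height \<open>1 / (2 * \<epsilon>)\<close>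
  explodes. Bounds such as \<open>B\<close> therefore secure integrability and stay out of the final
  constants; integrating the heat kernel over time before space is what achieves this. For the upper
  bound, cancellation in the dipole is used at every second step only: \<open>K (g u)\<close> is
  Lipschitz in the starting point because the kernel integrated over time is, and the next potential
  turns this into a factor \<open>d\<close>. Hence even moments are estimated, and real exponents
  are reached by interpolation. A second moment of order \<open>(b - a)\<close> to the power 1/2
  means a norm of order \<open>(b - a)\<close> to the power 1/4, which singles out
  \<open>r = 4\<close>. The part over \<open>(a,b]\<close> has second moment of order
  \<open>b - a\<close>, small enough to be subtracted on short intervals; intervals
  \<open>(0,b]\<close> with \<open>b\<close> tending to 0 then exclude every smaller
  \<open>r\<close>. Fatou's lemma bounds integrals of nonnegative functions from above only, so the
  lower bound is first rewritten as such an upper bound, for a quartic polynomial.\<close>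

definition gaussian :: "real \<Rightarrow> real measure" where
  "gaussian v = density lborel (\<lambda>x. ennreal (normal_density 0 (sqrt v) x))"

lemma sets_gaussian [measurable_cong, simp]: "sets (gaussian v) = sets borel"
  and space_gaussian [simp]: "space (gaussian v) = UNIV"
  by (simp_all add: gaussian_def)

lemma prob_space_gaussian: "0 < v \<Longrightarrow> prob_space (gaussian v)"
  unfolding gaussian_def by (rule prob_space_normal_density) simp

text \<open>Testing only partitions that contain \<open>K\<close> suffices to determine the law, and with
  \<open>K = {a, b}\<close> every tested increment of the decoupled path is one of \<open>W\<close> or one of \<open>W'\<close>.\<close>

definition gaussian_increments_wrt ::
  "real set \<Rightarrow> real \<Rightarrow> 'c measure \<Rightarrow> ('c \<Rightarrow> real \<Rightarrow> real) \<Rightarrow> bool" where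
  "gaussian_increments_wrt K T N X \<longleftrightarrow>
     (\<forall>n t A. strict_mono_on {..n} t \<and> t ` {..n} \<subseteq> {0..T} \<and> K \<subseteq> t ` {..n} \<and> (\<forall>i. A i \<in> sets borel) \<longrightarrow>
        emeasure N {x \<in> space N. \<forall>i<n. X x (t (Suc i)) - X x (t i) \<in> A i} =
          (\<Prod>i<n. emeasure (gaussian (t (Suc i) - t i)) (A i)))"

lemma gaussian_increments_wrtD:
  assumes "gaussian_increments_wrt K T N X" "strict_mono_on {..n} t" "t ` {..n} \<subseteq> {0..T}"
    "K \<subseteq> t ` {..n}" "\<And>i. A i \<in> sets borel"
  shows "emeasure N {x \<in> space N. \<forall>i<n. X x (t (Suc i)) - X x (t i) \<in> A i} =
          (\<Prod>i<n. emeasure (gaussian (t (Suc i) - t i)) (A i))"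
  using assms unfolding gaussian_increments_wrt_def by blast

lemma gaussian_increments_wrt_mono:
  "gaussian_increments_wrt K T N X \<Longrightarrow> K \<subseteq> K' \<Longrightarrow> gaussian_increments_wrt K' T N X"
  unfolding gaussian_increments_wrt_def by (meson subset_trans)

lemma strict_mono_on_Suc_less:
  assumes "strict_mono_on {..n} t" "i < n"
  shows "t i < t (Suc i)"
  using assms by (auto simp: strict_mono_on_def)

lemma distr_increments_eq_PiM:
  fixes t :: "nat \<Rightarrow> real"
  assumes inc: "gaussian_increments_wrt K T N X"
    and X: "X \<in> measurable N (\<Pi>\<^sub>M t\<in>{0..T}. borel)"
    and t: "strict_mono_on {..n} t" "t ` {..n} \<subseteq> {0..T}" "K \<subseteq> t ` {..n}"
  shows "distr N (\<Pi>\<^sub>M i\<in>{..<n}. borel) (\<lambda>x. \<lambda>i\<in>{..<n}. X x (t (Suc i)) - X x (t i)) =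
    (\<Pi>\<^sub>M i\<in>{..<n}. gaussian (t (Suc i) - t i))"
proof -
  \<comment> \<open>Indices from \<open>n\<close> on carry no increment. The default
    \<open>gaussian 1\<close> makes every factor a probability space, as
    \<open>product_prob_space\<close> demands.\<close>
  define G where "G i = (if i < n then gaussian (t (Suc i) - t i) else gaussian 1)" for i
  have pG: "prob_space (G i)" for i
    using strict_mono_on_Suc_less[OF t(1)] by (auto simp: G_def intro!: prob_space_gaussian)
  interpret product_prob_space G "{..<n}"
    using pG by (simp add: product_prob_space_def product_prob_space_axioms_def product_sigma_finite_def prob_space_imp_sigma_finite)
  have setsG [measurable_cong]: "sets (G i) = sets borel" for i by (simp add: G_def)
  have tin: "i \<le> n \<Longrightarrow> t i \<in> {0..T}" for i using t(2) by auto
  have m1: "(\<lambda>x. X x s) \<in> borel_measurable N" if "s \<in> {0..T}" for s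
    using measurable_component_singleton[OF that, of "\<lambda>_. borel"] X by (rule measurable_compose_rev)
  have m: "(\<lambda>x. X x (t (Suc i)) - X x (t i)) \<in> borel_measurable N" if "i < n" for i
    using that by (intro borel_measurable_diff m1 tin) auto
  let ?Y = "\<lambda>x. \<lambda>i\<in>{..<n}. X x (t (Suc i)) - X x (t i)"
  have mY: "?Y \<in> measurable N (\<Pi>\<^sub>M i\<in>{..<n}. borel)"
    by (rule measurable_restrict) (auto intro: m)
  have "distr N (\<Pi>\<^sub>M i\<in>{..<n}. borel) ?Y = PiM {..<n} G"
  proof (rule PiM_eqI)
    show "sets (distr N (\<Pi>\<^sub>M i\<in>{..<n}. borel) ?Y) = sets (PiM {..<n} G)"
      by (simp add: sets_PiM_cong[OF refl setsG])
    fix A assume A: "\<And>i. i \<in> {..<n} \<Longrightarrow> A i \<in> sets (G i)"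
    \<comment> \<open>The increment condition asks for a Borel set at every index, whereas
      \<open>A\<close> is only controlled below \<open>n\<close>.\<close>
    define A' where "A' i = (if i < n then A i else UNIV)" for i
    have A': "A' i \<in> sets borel" for i using A[of i] by (auto simp: A'_def setsG)
    have "Pi\<^sub>E {..<n} A \<in> sets (\<Pi>\<^sub>M i\<in>{..<n}. borel)"
      using A by (intro sets_PiM_I_finite) (auto simp: setsG)
    then have "emeasure (distr N (\<Pi>\<^sub>M i\<in>{..<n}. borel) ?Y) (Pi\<^sub>E {..<n} A) =
      emeasure N (?Y -` Pi\<^sub>E {..<n} A \<inter> space N)"
      by (rule emeasure_distr[OF mY])
    also have "?Y -` Pi\<^sub>E {..<n} A \<inter> space N =
        {x \<in> space N. \<forall>i<n. X x (t (Suc i)) - X x (t i) \<in> A' i}"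
    proof (rule set_eqI)
      fix x
      have "?Y x \<in> Pi\<^sub>E {..<n} A \<longleftrightarrow> (\<forall>i<n. X x (t (Suc i)) - X x (t i) \<in> A i)"
        by (simp only: PiE_iff restrict_extensional simp_thms) auto
      also have "\<dots> \<longleftrightarrow> (\<forall>i<n. X x (t (Suc i)) - X x (t i) \<in> A' i)"
        by (simp only: A'_def if_True cong: imp_cong)
      finally show "x \<in> ?Y -` Pi\<^sub>E {..<n} A \<inter> space N \<longleftrightarrow>
          x \<in> {x \<in> space N. \<forall>i<n. X x (t (Suc i)) - X x (t i) \<in> A' i}"
        by blast
    qed
    also have "emeasure N \<dots> = (\<Prod>i<n. emeasure (gaussian (t (Suc i) - t i)) (A' i))"
      by (rule gaussian_increments_wrtD[OF inc t A'])
    also have "\<dots> = (\<Prod>i<n. emeasure (G i) (A i))"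
      by (rule prod.cong) (auto simp: G_def A'_def)
    finally show "emeasure (distr N (\<Pi>\<^sub>M i\<in>{..<n}. borel) ?Y) (Pi\<^sub>E {..<n} A) =
        (\<Prod>i\<in>{..<n}. emeasure (G i) (A i))" .
  qed simp
  also have "\<dots> = (\<Pi>\<^sub>M i\<in>{..<n}. gaussian (t (Suc i) - t i))"
    by (rule PiM_cong) (auto simp: G_def)
  finally show ?thesis .
qed

text \<open>Since the process starts at 0, its value at \<open>t k\<close> is the sum of the first
  \<open>k\<close> increments. The right-hand side mentions neither \<open>N\<close> nor
  \<open>X\<close>, so two processes with the same increments can be compared through it.\<close>

lemma emeasure_cylinder_eq:
  fixes t :: "nat \<Rightarrow> real"
  assumes inc: "gaussian_increments_wrt K T N X"
    and X: "X \<in> measurable N (\<Pi>\<^sub>M t\<in>{0..T}. borel)"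
    and X0: "AE x in N. X x 0 = 0"
    and t: "strict_mono_on {..n} t" "t ` {..n} \<subseteq> {0..T}" "K \<subseteq> t ` {..n}" "t 0 = 0"
    and A: "\<And>i. i \<le> n \<Longrightarrow> A i \<in> sets borel"
  shows "emeasure N {x \<in> space N. \<forall>k\<le>n. X x (t k) \<in> A k} =
    emeasure (\<Pi>\<^sub>M i\<in>{..<n}. gaussian (t (Suc i) - t i))
      {y \<in> space (\<Pi>\<^sub>M i\<in>{..<n}. gaussian (t (Suc i) - t i)). \<forall>k\<le>n. (\<Sum>i<k. y i) \<in> A k}"
    (is "_ = emeasure ?P ?B")
proof -
  have tin: "i \<le> n \<Longrightarrow> t i \<in> {0..T}" for i using t(2) by auto
  have m1: "(\<lambda>x. X x s) \<in> borel_measurable N" if "s \<in> {0..T}" for s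
    using measurable_component_singleton[OF that, of "\<lambda>_. borel"] X by (rule measurable_compose_rev)
  have m: "(\<lambda>x. X x (t (Suc i)) - X x (t i)) \<in> borel_measurable N" if "i < n" for i
    using that by (intro borel_measurable_diff m1 tin) auto
  let ?Y = "\<lambda>x. \<lambda>i\<in>{..<n}. X x (t (Suc i)) - X x (t i)"
  have mY: "?Y \<in> measurable N (\<Pi>\<^sub>M i\<in>{..<n}. borel)"
    by (rule measurable_restrict) (auto intro: m)
  have D: "distr N (\<Pi>\<^sub>M i\<in>{..<n}. borel) ?Y = ?P"
    by (rule distr_increments_eq_PiM[OF inc X t(1-3)])
  have sp: "space ?P = {..<n} \<rightarrow>\<^sub>E UNIV" by (simp add: space_PiM)
  have setsP: "sets ?P = sets (\<Pi>\<^sub>M i\<in>{..<n}. borel)" by (rule sets_PiM_cong) auto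
  have B: "?B \<in> sets (\<Pi>\<^sub>M i\<in>{..<n}. borel)"
  proof -
    have *: "(\<lambda>y. \<Sum>i<k. y i) \<in> borel_measurable (\<Pi>\<^sub>M i\<in>{..<n}. (borel::real measure))" if "k \<le> n" for k
      by (rule borel_measurable_sum, rule measurable_component_singleton) (use that in auto)
    have "?B = {y \<in> space (\<Pi>\<^sub>M i\<in>{..<n}. borel). \<forall>k\<in>{..n}. (\<Sum>i<k. y i) \<in> A k}"
      by (auto simp: space_PiM)
    also have "\<dots> \<in> sets (\<Pi>\<^sub>M i\<in>{..<n}. borel)"
    proof (rule sets.sets_Collect_finite_All')
      fix k assume k: "k \<in> {..n}"
      show "{y \<in> space (\<Pi>\<^sub>M i\<in>{..<n}. borel). (\<Sum>i<k. y i) \<in> A k} \<in> sets (\<Pi>\<^sub>M i\<in>{..<n}. borel)"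
        using k A[of k] * by (intro measurable_sets_Collect[OF *]) auto
    qed auto
    finally show ?thesis .
  qed
  have *: "(\<Sum>i<k. X x (t (Suc i)) - X x (t i)) = X x (t k) - X x 0" for x k
    using sum_lessThan_telescope[of "\<lambda>i. X x (t i)" k] t(4) by simp
  have "emeasure N {x \<in> space N. \<forall>k\<le>n. X x (t k) \<in> A k} = emeasure N (?Y -` ?B \<inter> space N)"
  proof (rule emeasure_eq_AE)
    show "AE x in N. (x \<in> {x \<in> space N. \<forall>k\<le>n. X x (t k) \<in> A k}) = (x \<in> ?Y -` ?B \<inter> space N)"
      using X0
    proof eventually_elim
      case (elim x)
      have "(\<Sum>i<k. ?Y x i) = X x (t k)" if "k \<le> n" for k
        using that *[of x k] elim by (auto intro!: sum.cong)
      then have "(\<forall>k\<le>n. X x (t k) \<in> A k) \<longleftrightarrow> (\<forall>k\<le>n. (\<Sum>i<k. ?Y x i) \<in> A k)" by auto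
      moreover have "?Y x \<in> space ?P" unfolding sp by auto
      ultimately show ?case by auto
    qed
    have "{x \<in> space N. \<forall>k\<in>{..n}. X x (t k) \<in> A k} \<in> sets N"
    proof (rule sets.sets_Collect_finite_All')
      fix k assume k: "k \<in> {..n}"
      show "{x \<in> space N. X x (t k) \<in> A k} \<in> sets N"
        using k A[of k] tin[of k] by (intro measurable_sets_Collect[OF m1]) auto
    qed auto
    then show "{x \<in> space N. \<forall>k\<le>n. X x (t k) \<in> A k} \<in> sets N"
      unfolding Ball_def atMost_iff .
    show "?Y -` ?B \<inter> space N \<in> sets N"
      by (rule measurable_sets[OF mY B])
  qed
  also have "\<dots> = emeasure (distr N (\<Pi>\<^sub>M i\<in>{..<n}. borel) ?Y) ?B"
    by (rule emeasure_distr[OF mY B, symmetric])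
  finally show ?thesis unfolding D .
qed

lemma finite_real_set_enumeration:
  fixes S :: "real set"
  assumes "finite S" "0 \<in> S" "S \<subseteq> {0..}"
  obtains n t where "strict_mono_on {..n} t" "t ` {..n} = S" "t (0::nat) = 0"
proof
  define n where "n = card S - 1"
  let ?xs = "sorted_list_of_set S"
  have "card S > 0" using assms by (auto simp: card_gt_0_iff)
  then have len: "length ?xs = Suc n" by (simp add: n_def)
  show "strict_mono_on {..n} (\<lambda>i. ?xs ! i)"
    using len strict_sorted_list_of_set[of S]
    by (auto simp: strict_mono_on_def sorted_wrt_iff_nth_less)
  show im: "(\<lambda>i. ?xs ! i) ` {..n} = S"
  proof -
    have "S = set ?xs" using assms by simp
    also have "\<dots> = (\<lambda>i. ?xs ! i) ` {..n}"
      using len by (auto simp: set_conv_nth less_Suc_eq_le)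
    finally show ?thesis by simp
  qed
  show "?xs ! 0 = 0"
  proof -
    obtain i where i: "i \<le> n" "?xs ! i = 0" using im assms(2) by (metis (no_types, lifting) atMost_iff imageE)
    have "?xs ! 0 \<le> ?xs ! i"
      using i len by (intro sorted_nth_mono) auto
    moreover have "?xs ! 0 \<in> S" using im by auto
    ultimately show ?thesis using i assms(3) by force
  qed
qed

text \<open>The times of a cylinder set are enlarged by 0, from which values are recovered as sums
  of increments, and by \<open>K\<close>, so that the hypothesis applies to the partition. At the
  added times the condition is \<open>UNIV\<close>, so the event does not change.\<close>

lemma gaussian_increments_distr_unique:
  assumes "finite K" "K \<subseteq> {0..T}" "0 \<le> T" "prob_space N" "prob_space N'"
    and inc: "gaussian_increments_wrt K T N X" "gaussian_increments_wrt K T N' X'"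
    and X: "X \<in> measurable N (\<Pi>\<^sub>M t\<in>{0..T}. borel)" "X' \<in> measurable N' (\<Pi>\<^sub>M t\<in>{0..T}. borel)"
    and X0: "AE x in N. X x 0 = 0" "AE x in N'. X' x 0 = 0"
  shows "distr N (\<Pi>\<^sub>M t\<in>{0..T}. borel) X = distr N' (\<Pi>\<^sub>M t\<in>{0..T}. borel) X'"
proof (rule measure_eqI_PiM_infinite)
  interpret N: prob_space N by fact
  show "finite_measure (distr N (\<Pi>\<^sub>M t\<in>{0..T}. borel) X)"
    using N.prob_space_distr[OF X(1)] by (simp add: prob_space_def)
  fix A J assume J: "finite J" "J \<subseteq> {0..T}" and A: "\<And>i. i \<in> J \<Longrightarrow> A i \<in> sets (borel :: real measure)"
  have "finite (insert 0 (J \<union> K))" "0 \<in> insert 0 (J \<union> K)" "insert 0 (J \<union> K) \<subseteq> {0..}"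
    using assms J by auto
  then obtain n and t :: "nat \<Rightarrow> real"
    where t: "strict_mono_on {..n} t" "t ` {..n} = insert 0 (J \<union> K)" "t 0 = 0"
    by (rule finite_real_set_enumeration)
  define A' where "A' i = (if t i \<in> J then A (t i) else UNIV)" for i
  have A': "A' i \<in> sets borel" for i using A by (auto simp: A'_def)
  let ?E = "prod_emb {0..T} (\<lambda>_. borel) J (Pi\<^sub>E J A)"
  have E: "?E \<in> sets (\<Pi>\<^sub>M t\<in>{0..T}. borel)"
    using J A by (intro sets_PiM_I) auto
  have *: "emeasure (distr N (\<Pi>\<^sub>M t\<in>{0..T}. borel) X) ?E =
     emeasure (\<Pi>\<^sub>M i\<in>{..<n}. gaussian (t (Suc i) - t i))
      {y \<in> space (\<Pi>\<^sub>M i\<in>{..<n}. gaussian (t (Suc i) - t i)). \<forall>k\<le>n. (\<Sum>i<k. y i) \<in> A' k}"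
    if inc: "gaussian_increments_wrt K T N X" and X: "X \<in> measurable N (\<Pi>\<^sub>M t\<in>{0..T}. borel)"
     and X0: "AE x in N. X x 0 = 0" for N :: "'z measure" and X
  proof -
    have "emeasure (distr N (\<Pi>\<^sub>M t\<in>{0..T}. borel) X) ?E = emeasure N (X -` ?E \<inter> space N)"
      by (rule emeasure_distr[OF X E])
    also have "X -` ?E \<inter> space N = {x \<in> space N. \<forall>k\<le>n. X x (t k) \<in> A' k}"
    proof -
      have "X x \<in> ?E \<longleftrightarrow> (\<forall>k\<le>n. X x (t k) \<in> A' k)" if x: "x \<in> space N" for x
      proof -
        have "X x \<in> {0..T} \<rightarrow>\<^sub>E UNIV" using measurable_space[OF X x] by (simp add: space_PiM)
        then have "X x \<in> ?E \<longleftrightarrow> (\<forall>j\<in>J. X x j \<in> A j)"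
          by (auto simp: prod_emb_def PiE_iff)
        also have "\<dots> \<longleftrightarrow> (\<forall>k\<le>n. X x (t k) \<in> A' k)"
        proof -
          have "\<forall>j\<in>J. \<exists>k\<le>n. t k = j" using t(2) by (metis UnI1 atMost_iff image_iff insertCI)
          then show ?thesis unfolding A'_def by (metis UNIV_I)
        qed
        finally show ?thesis .
      qed
      then show ?thesis by auto
    qed
    moreover have "t ` {..n} \<subseteq> {0..T}" "K \<subseteq> t ` {..n}" using t(2) assms J by auto
    ultimately show ?thesis
      using emeasure_cylinder_eq[OF inc X X0 t(1) _ _ t(3), of A'] A' by simp
  qed
  show "emeasure (distr N (\<Pi>\<^sub>M t\<in>{0..T}. borel) X) ?E = emeasure (distr N' (\<Pi>\<^sub>M t\<in>{0..T}. borel) X') ?E"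
    using *[OF inc(1) X(1) X0(1)] *[OF inc(2) X(2) X0(2)] by simp
qed (auto)

subsection \<open>Wiener measure on path space\<close>

lemma grid_bounds: "t ` {..n} \<subseteq> {0..T} \<Longrightarrow> i \<le> n \<Longrightarrow> 0 \<le> t i \<and> t i \<le> T"
  for t :: "nat \<Rightarrow> real"
  by auto

lemma space_path_space: "space (path_space T) = {x \<in> {0..T} \<rightarrow>\<^sub>E UNIV. continuous_on {0..T} x}"
  by (auto simp: path_space_def space_restrict_space space_PiM)

lemma measurable_path_space_PiM: "(\<lambda>x. x) \<in> measurable (path_space T) (\<Pi>\<^sub>M t\<in>{0..T}. borel)"
  unfolding path_space_def by (rule measurable_restrict_space1) simp

lemma measurable_path_eval: "t \<in> {0..T} \<Longrightarrow> (\<lambda>w. w t) \<in> borel_measurable (path_space T)"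
  using measurable_compose[OF measurable_path_space_PiM measurable_component_singleton] .

lemma measurable_path_spaceI:
  assumes "\<And>t. t \<in> {0..T} \<Longrightarrow> (\<lambda>x. X x t) \<in> borel_measurable N"
    and "\<And>x t. x \<in> space N \<Longrightarrow> t \<notin> {0..T} \<Longrightarrow> X x t = undefined"
    and "\<And>x. x \<in> space N \<Longrightarrow> continuous_on {0..T} (X x)"
  shows "X \<in> measurable N (path_space T)"
  unfolding path_space_def
proof (rule measurable_restrict_space2)
  show "X \<in> space N \<rightarrow> {x. continuous_on {0..T} x}" using assms(3) by auto
  have "(\<lambda>x. \<lambda>t\<in>{0..T}. X x t) \<in> measurable N (\<Pi>\<^sub>M t\<in>{0..T}. borel)"
    by (rule measurable_restrict) (rule assms(1))
  moreover have "(\<lambda>t\<in>{0..T}. X x t) = X x" if "x \<in> space N" for x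
    using assms(2)[OF that] by (auto simp: restrict_def)
  ultimately show "X \<in> measurable N (\<Pi>\<^sub>M t\<in>{0..T}. borel)"
    by (simp cong: measurable_cong)
qed

lemma sets_path_increments:
  fixes t :: "nat \<Rightarrow> real"
  assumes t: "t ` {..n} \<subseteq> {0..T}" and B: "\<And>i. B i \<in> sets borel"
  shows "{w \<in> space (path_space T). \<forall>i<n. w (t (Suc i)) - w (t i) \<in> B i} \<in> sets (path_space T)"
proof -
  have *: "{w \<in> space (path_space T). w (t (Suc i)) - w (t i) \<in> B i} \<in> sets (path_space T)" if "i < n" for i
  proof -
    have "(\<lambda>w. w (t (Suc i)) - w (t i)) \<in> borel_measurable (path_space T)"
      using grid_bounds[OF t, of i] grid_bounds[OF t, of "Suc i"] that
      by (intro borel_measurable_diff measurable_path_eval) auto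
    from measurable_sets[OF this B[of i]] show ?thesis
      by (simp only: vimage_def Int_def mem_Collect_eq conj_commute)
  qed
  have "{w \<in> space (path_space T). \<forall>i\<in>{..<n}. w (t (Suc i)) - w (t i) \<in> B i} \<in> sets (path_space T)"
    using * by (intro sets.sets_Collect_finite_All) (simp_all only: lessThan_iff finite_lessThan)
  then show ?thesis unfolding Ball_def lessThan_iff .
qed

text \<open>A measurable set of paths is the trace of a set of the product
  \<open>\<sigma>\<close>-algebra, so the image under the inclusion determines the measure although
  the set of continuous functions need not be measurable in the product.\<close>

lemma path_space_measure_eqI:
  assumes "sets \<mu> = sets (path_space T)" "sets \<nu> = sets (path_space T)"
    and "distr \<mu> (\<Pi>\<^sub>M t\<in>{0..T}. borel) (\<lambda>x. x) = distr \<nu> (\<Pi>\<^sub>M t\<in>{0..T}. borel) (\<lambda>x. x)"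
  shows "\<mu> = \<nu>"
proof (rule measure_eqI)
  show "sets \<mu> = sets \<nu>" using assms by simp
  fix B assume "B \<in> sets \<mu>"
  then obtain A where A: "A \<in> sets (\<Pi>\<^sub>M t\<in>{0..T}. (borel :: real measure))"
    and B: "B = A \<inter> {x. continuous_on {0..T} x}"
    using assms(1) by (auto simp: path_space_def sets_restrict_space)
  have *: "emeasure \<mu> B = emeasure (distr \<mu> (\<Pi>\<^sub>M t\<in>{0..T}. borel) (\<lambda>x. x)) A"
    if "sets \<mu> = sets (path_space T)" for \<mu> :: "(real \<Rightarrow> real) measure"
  proof -
    have m: "(\<lambda>x. x) \<in> measurable \<mu> (\<Pi>\<^sub>M t\<in>{0..T}. borel)"
      using measurable_path_space_PiM measurable_cong_sets[OF that refl] by blast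
    have "B = (\<lambda>x. x) -` A \<inter> space \<mu>"
      using B sets.sets_into_space[OF A] sets_eq_imp_space_eq[OF that]
      by (auto simp: space_path_space space_PiM)
    then show ?thesis using emeasure_distr[OF m A] by simp
  qed
  show "emeasure \<mu> B = emeasure \<nu> B" using *[OF assms(1)] *[OF assms(2)] assms(3) by simp
qed

section \<open>Splicing two paths\<close>

lemma decoupled_process_eq:
  assumes "a \<le> b"
  shows "decoupled_process W W' a b t (\<omega>, \<omega>') =
    W (min t a) \<omega> + (W' (max a (min t b)) \<omega>' - W' a \<omega>') + (W (max t b) \<omega> - W b \<omega>)"
  using assms by (auto simp: decoupled_process_def min_def max_def)

lemma continuous_on_decoupled_process:
  assumes "0 \<le> a" "a \<le> b" "b \<le> T"
    and "continuous_on {0..T} (\<lambda>t. W t \<omega>)" "continuous_on {0..T} (\<lambda>t. W' t \<omega>')"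
  shows "continuous_on {0..T} (\<lambda>t. decoupled_process W W' a b t (\<omega>, \<omega>'))"
  unfolding decoupled_process_eq[OF assms(2)]
  by (intro continuous_intros continuous_on_compose2[OF assms(4)] continuous_on_compose2[OF assms(5)])
    (use assms(1-3) in auto)

definition path_splice :: "real \<Rightarrow> real \<Rightarrow> real \<Rightarrow> (real \<Rightarrow> real) \<times> (real \<Rightarrow> real) \<Rightarrow> real \<Rightarrow> real" where
  "path_splice T a b = sample_path T (decoupled_process (\<lambda>t w. w t) (\<lambda>t w. w t) a b)"

lemma splice_apply:
  assumes "0 \<le> a" "a \<le> b" "b \<le> T" "t \<in> {0..T}"
  shows "path_splice T a b (w, w') t =
    w (min t a) + (w' (max a (min t b)) - w' a) + (w (max t b) - w b)"
  using assms by (simp add: path_splice_def sample_path_def decoupled_process_eq)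

lemma sample_path_decoupled_process:
  assumes "0 \<le> a" "a \<le> b" "b \<le> T"
  shows "sample_path T (decoupled_process W W' a b) (\<omega>, \<omega>') =
    path_splice T a b (sample_path T W \<omega>, sample_path T W' \<omega>')"
  using assms by (auto simp: path_splice_def sample_path_def decoupled_process_eq fun_eq_iff)

lemma splice_increment:
  assumes "0 \<le> a" "a \<le> b" "b \<le> T" "0 \<le> u" "u \<le> v" "v \<le> T"
  shows "v \<le> a \<or> b \<le> u \<Longrightarrow> path_splice T a b (w, w') v - path_splice T a b (w, w') u = w v - w u"
    and "a \<le> u \<Longrightarrow> v \<le> b \<Longrightarrow> path_splice T a b (w, w') v - path_splice T a b (w, w') u = w' v - w' u"
  using assms by (auto simp: splice_apply min_absorb1 min_absorb2 max_absorb1 max_absorb2)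

lemma measurable_splice:
  assumes "0 \<le> a" "a \<le> b" "b \<le> T"
  shows "path_splice T a b \<in> measurable (path_space T \<Otimes>\<^sub>M path_space T) (path_space T)"
proof (rule measurable_path_spaceI)
  fix t assume t: "t \<in> {0..T}"
  note m = measurable_compose[OF measurable_fst measurable_path_eval]
    measurable_compose[OF measurable_snd measurable_path_eval]
  have "(\<lambda>x. fst x (min t a) + (snd x (max a (min t b)) - snd x a) + (fst x (max t b) - fst x b))
      \<in> borel_measurable (path_space T \<Otimes>\<^sub>M path_space T)"
    using assms t by (intro borel_measurable_add borel_measurable_diff m) auto
  also have "(\<lambda>x. fst x (min t a) + (snd x (max a (min t b)) - snd x a) + (fst x (max t b) - fst x b))
      = (\<lambda>x. path_splice T a b x t)"
    using splice_apply[OF assms t] by (auto simp: fun_eq_iff)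
  finally show "(\<lambda>x. path_splice T a b x t) \<in> borel_measurable (path_space T \<Otimes>\<^sub>M path_space T)" .
next
  fix x t assume "t \<notin> {0..T}"
  then show "path_splice T a b x t = undefined" by (auto simp: path_splice_def sample_path_def)
next
  fix x assume x: "x \<in> space (path_space T \<Otimes>\<^sub>M path_space T)"
  obtain w w' where [simp]: "x = (w, w')" by (cases x)
  have "continuous_on {0..T} (\<lambda>t. decoupled_process (\<lambda>t w. w t) (\<lambda>t w. w t) a b t (w, w'))"
    using x assms by (intro continuous_on_decoupled_process) (auto simp: space_pair_measure space_path_space)
  then show "continuous_on {0..T} (path_splice T a b x)"
    by (rule continuous_on_eq) (simp add: path_splice_def sample_path_def)
qed

text \<open>On a partition through \<open>a\<close> and \<open>b\<close> every increment of the
  spliced path lies inside \<open>(a,b]\<close> and belongs to the second path, or outside and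
  belongs to the first. The event is thus a rectangle. Each side is evaluated on the whole partition
  with \<open>UNIV\<close> at the increments of the other path, and those factors equal 1.\<close>

lemma gaussian_increments_splice:
  assumes ab: "0 \<le> a" "a \<le> b" "b \<le> T" and p: "prob_space \<mu>"
    and s: "sets \<mu> = sets (path_space T)"
    and inc: "gaussian_increments_wrt {} T \<mu> (\<lambda>x. x)"
  shows "gaussian_increments_wrt {a, b} T (\<mu> \<Otimes>\<^sub>M \<mu>) (path_splice T a b)"
  unfolding gaussian_increments_wrt_def
proof (intro allI impI, elim conjE)
  interpret prob_space \<mu> by fact
  fix n and t :: "nat \<Rightarrow> real" and A :: "nat \<Rightarrow> real set"
  assume t: "strict_mono_on {..n} t" "t ` {..n} \<subseteq> {0..T}" "{a, b} \<subseteq> t ` {..n}"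
    and A: "\<forall>i. A i \<in> sets borel"
  have [measurable_cong]: "sets \<mu> = sets (path_space T)" by fact
  obtain ia ib where ia: "ia \<le> n" "t ia = a" and ib: "ib \<le> n" "t ib = b" using t(3) by auto
  have tle: "t i \<le> t j \<longleftrightarrow> i \<le> j" if "i \<le> n" "j \<le> n" for i j
    using strict_mono_on_less_eq[OF t(1)] that by auto
  define I where "I i \<longleftrightarrow> ia \<le> i \<and> Suc i \<le> ib" for i
  define B where "B i = (if I i then UNIV else A i)" for i
  define C where "C i = (if I i then A i else UNIV)" for i
  have BC: "B i \<in> sets borel" "C i \<in> sets borel" for i using A by (auto simp: B_def C_def)
  let ?S = "\<lambda>B. {w \<in> space \<mu>. \<forall>i<n. w (t (Suc i)) - w (t i) \<in> B i}"
  have sp: "space \<mu> = space (path_space T)" by (rule sets_eq_imp_space_eq[OF s])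
  have S: "?S B \<in> sets \<mu>" if "\<And>i. B i \<in> sets borel" for B
    unfolding sp s by (rule sets_path_increments[OF t(2) that])
  have step: "path_splice T a b (w, w') (t (Suc i)) - path_splice T a b (w, w') (t i) =
     (if I i then w' (t (Suc i)) - w' (t i) else w (t (Suc i)) - w (t i))" if i: "i < n" for i w w'
  proof -
    have r: "0 \<le> t i" "t i \<le> t (Suc i)" "t (Suc i) \<le> T"
      using grid_bounds[OF t(2), of i] grid_bounds[OF t(2), of "Suc i"] i tle[of i "Suc i"] by auto
    show ?thesis
    proof (cases "I i")
      case True
      then have "a \<le> t i" "t (Suc i) \<le> b" using ia ib tle i by (auto simp: I_def)
      then show ?thesis using True splice_increment(2)[OF ab r] by simp
    next
      case False
      then have "Suc i \<le> ia \<or> ib \<le> i" by (auto simp: I_def)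
      then have "t (Suc i) \<le> a \<or> b \<le> t i" using ia ib tle i by auto
      then show ?thesis using False splice_increment(1)[OF ab r] by simp
    qed
  qed
  have "{x \<in> space (\<mu> \<Otimes>\<^sub>M \<mu>). \<forall>i<n. path_splice T a b x (t (Suc i)) - path_splice T a b x (t i) \<in> A i} = ?S B \<times> ?S C"
  proof (rule set_eqI)
    fix x :: "(real \<Rightarrow> real) \<times> (real \<Rightarrow> real)"
    obtain w w' where x: "x = (w, w')" by (cases x)
    have "(\<forall>i<n. path_splice T a b x (t (Suc i)) - path_splice T a b x (t i) \<in> A i) \<longleftrightarrow>
      (\<forall>i<n. w (t (Suc i)) - w (t i) \<in> B i) \<and> (\<forall>i<n. w' (t (Suc i)) - w' (t i) \<in> C i)"
      using step[of _ w w'] unfolding x B_def C_def by (metis UNIV_I)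
    then show "x \<in> {x \<in> space (\<mu> \<Otimes>\<^sub>M \<mu>). \<forall>i<n. path_splice T a b x (t (Suc i)) - path_splice T a b x (t i) \<in> A i}
       \<longleftrightarrow> x \<in> ?S B \<times> ?S C"
      unfolding x by (auto simp: space_pair_measure)
  qed
  then have "emeasure (\<mu> \<Otimes>\<^sub>M \<mu>) {x \<in> space (\<mu> \<Otimes>\<^sub>M \<mu>). \<forall>i<n. path_splice T a b x (t (Suc i)) - path_splice T a b x (t i) \<in> A i}
     = emeasure \<mu> (?S B) * emeasure \<mu> (?S C)"
    using emeasure_pair_measure_Times[OF S[OF BC(1)] S[OF BC(2)]] by simp
  also have "\<dots> = (\<Prod>i<n. emeasure (gaussian (t (Suc i) - t i)) (B i)) *
      (\<Prod>i<n. emeasure (gaussian (t (Suc i) - t i)) (C i))"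
    using gaussian_increments_wrtD[OF inc t(1,2)] BC by simp
  also have "\<dots> = (\<Prod>i<n. emeasure (gaussian (t (Suc i) - t i)) (B i) * emeasure (gaussian (t (Suc i) - t i)) (C i))"
    by (rule prod.distrib[symmetric])
  also have "\<dots> = (\<Prod>i<n. emeasure (gaussian (t (Suc i) - t i)) (A i))"
  proof (rule prod.cong[OF refl])
    fix i assume i: "i \<in> {..<n}"
    interpret G: prob_space "gaussian (t (Suc i) - t i)"
      using i strict_mono_on_Suc_less[OF t(1)] by (intro prob_space_gaussian) auto
    have "emeasure (gaussian (t (Suc i) - t i)) UNIV = 1" using G.emeasure_space_1 by simp
    then show "emeasure (gaussian (t (Suc i) - t i)) (B i) * emeasure (gaussian (t (Suc i) - t i)) (C i) =
      emeasure (gaussian (t (Suc i) - t i)) (A i)" by (simp add: B_def C_def)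
  qed
  finally show "emeasure (\<mu> \<Otimes>\<^sub>M \<mu>) {x \<in> space (\<mu> \<Otimes>\<^sub>M \<mu>). \<forall>i<n. path_splice T a b x (t (Suc i)) - path_splice T a b x (t i) \<in> A i}
     = (\<Prod>i<n. emeasure (gaussian (t (Suc i) - t i)) (A i))" .
qed

text \<open>The interface through which everything below sees Brownian motion: the law of a single
  increment, and \<open>distr_splice\<close>, which carries all independence. The start at 0 holds
  almost everywhere because \<open>path_space\<close> admits paths with any initial value.\<close>

locale wiener_measure = prob_space \<mu> for \<mu> :: "(real \<Rightarrow> real) measure" +
  fixes T :: real
  assumes T_pos: "0 < T"
    and sets_wiener [measurable_cong]: "sets \<mu> = sets (path_space T)"
    and distr_increment: "\<And>s t. 0 \<le> s \<Longrightarrow> s < t \<Longrightarrow> t \<le> T \<Longrightarrow> distr \<mu> borel (\<lambda>w. w t - w s) = gaussian (t - s)"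
    and AE_start: "AE w in \<mu>. w 0 = 0"
    and distr_splice: "\<And>a b. 0 \<le> a \<Longrightarrow> a \<le> b \<Longrightarrow> b \<le> T \<Longrightarrow>
      distr (\<mu> \<Otimes>\<^sub>M \<mu>) (path_space T) (path_splice T a b) = \<mu>"

section \<open>From a Brownian motion to its law on path space\<close>

lemma measurable_sample_path:
  assumes "brownian_motion T M W"
  shows "sample_path T W \<in> measurable M (path_space T)"
proof (rule measurable_path_spaceI)
  fix t assume "t \<in> {0..T}"
  then show "(\<lambda>x. sample_path T W x t) \<in> borel_measurable M"
    using assms by (auto simp: brownian_motion_def sample_path_def)
next
  fix x assume "x \<in> space M"
  then have "continuous_on {0..T} (\<lambda>t. W t x)" using assms by (simp add: brownian_motion_def)
  then show "continuous_on {0..T} (sample_path T W x)"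
    by (rule continuous_on_eq) (simp add: sample_path_def)
qed (auto simp: sample_path_def)

lemma gaussian_increments_brownian_motion:
  assumes "brownian_motion T M W"
  shows "gaussian_increments_wrt {} T M (sample_path T W)"
  unfolding gaussian_increments_wrt_def
proof (intro allI impI, elim conjE)
  interpret prob_space M using assms by (simp add: brownian_motion_def)
  fix n and t :: "nat \<Rightarrow> real" and A :: "nat \<Rightarrow> real set"
  assume t: "strict_mono_on {..n} t" "t ` {..n} \<subseteq> {0..T}" and A: "\<forall>i. A i \<in> sets borel"
  let ?Y = "\<lambda>i \<omega>. W (t (Suc i)) \<omega> - W (t i) \<omega>"
  have ind: "indep_vars (\<lambda>_. borel) ?Y {..<n}"
    using assms t unfolding brownian_motion_def by blast
  have tin: "0 \<le> t i" "t i < t (Suc i)" "t (Suc i) \<le> T" if "i < n" for i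
    using grid_bounds[OF t(2), of i] grid_bounds[OF t(2), of "Suc i"] that strict_mono_on_Suc_less[OF t(1)] by auto
  have eq: "{\<omega> \<in> space M. \<forall>i<n. sample_path T W \<omega> (t (Suc i)) - sample_path T W \<omega> (t i) \<in> A i}
      = {\<omega> \<in> space M. \<forall>i<n. ?Y i \<omega> \<in> A i}"
  proof -
    have "sample_path T W \<omega> (t (Suc i)) - sample_path T W \<omega> (t i) = ?Y i \<omega>" if "i < n" for i \<omega>
      using tin[OF that] by (simp add: sample_path_def)
    then show ?thesis by (simp cong: conj_cong imp_cong)
  qed
  have g: "prob (?Y i -` A i \<inter> space M) = measure (gaussian (t (Suc i) - t i)) (A i)" if i: "i < n" for i
  proof -
    have "distributed M lborel (?Y i) (\<lambda>x. ennreal (normal_density 0 (sqrt (t (Suc i) - t i)) x))"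
      using assms tin[OF i] unfolding brownian_motion_def by blast
    then have "distr M lborel (?Y i) = gaussian (t (Suc i) - t i)" "?Y i \<in> measurable M lborel"
      unfolding distributed_def gaussian_def by auto
    then show ?thesis using A measure_distr[of "?Y i" M lborel "A i"] by simp
  qed
  show "emeasure M {\<omega> \<in> space M. \<forall>i<n. sample_path T W \<omega> (t (Suc i)) - sample_path T W \<omega> (t i) \<in> A i} =
     (\<Prod>i<n. emeasure (gaussian (t (Suc i) - t i)) (A i))"
  \<comment> \<open>An empty intersection is \<open>UNIV\<close> rather than the sample space, and
    \<open>indep_varsD_finite\<close> asks for a nonempty index set.\<close>
  proof (cases "n = 0")
    case True
    then show ?thesis by (simp add: emeasure_space_1)
  next
    case False
    have "emeasure M {\<omega> \<in> space M. \<forall>i<n. ?Y i \<omega> \<in> A i} = prob (\<Inter>i\<in>{..<n}. ?Y i -` A i \<inter> space M)"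
    proof -
      have "{\<omega> \<in> space M. \<forall>i<n. ?Y i \<omega> \<in> A i} = (\<Inter>i\<in>{..<n}. ?Y i -` A i \<inter> space M)"
        using False by auto
      then show ?thesis by (simp add: emeasure_eq_measure)
    qed
    also have "\<dots> = ennreal (\<Prod>i<n. prob (?Y i -` A i \<inter> space M))"
      using False A by (subst indep_varsD_finite[OF ind]) auto
    also have "\<dots> = (\<Prod>i<n. ennreal (measure (gaussian (t (Suc i) - t i)) (A i)))"
      using g by (simp add: prod_ennreal)
    also have "\<dots> = (\<Prod>i<n. emeasure (gaussian (t (Suc i) - t i)) (A i))"
    proof (rule prod.cong[OF refl])
      fix i assume i: "i \<in> {..<n}"
      interpret G: prob_space "gaussian (t (Suc i) - t i)"
        using i tin by (intro prob_space_gaussian) auto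
      show "ennreal (measure (gaussian (t (Suc i) - t i)) (A i)) = emeasure (gaussian (t (Suc i) - t i)) (A i)"
        by (simp add: G.emeasure_eq_measure)
    qed
    finally show ?thesis unfolding eq .
  qed
qed

lemma AE_sample_path_0: "brownian_motion T M W \<Longrightarrow> 0 \<le> T \<Longrightarrow> AE \<omega> in M. sample_path T W \<omega> 0 = 0"
  by (auto simp: brownian_motion_def sample_path_def)

lemma measurable_sample_path_PiM:
  "brownian_motion T M W \<Longrightarrow> sample_path T W \<in> measurable M (\<Pi>\<^sub>M t\<in>{0..T}. borel)"
  by (rule measurable_compose[OF measurable_sample_path measurable_path_space_PiM])

text \<open>Identifies the laws of \<open>W\<close> and \<open>W'\<close>, so that the pair of
  sample paths has a law of the form \<open>\<mu> \<Otimes>\<^sub>M \<mu>\<close> with a single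
  \<open>\<mu>\<close>.\<close>

lemma brownian_motion_law_unique:
  assumes W: "brownian_motion T M W" and W': "brownian_motion T M' W'" and T: "0 \<le> T"
  shows "distr M (path_space T) (sample_path T W) = distr M' (path_space T) (sample_path T W')"
proof (rule path_space_measure_eqI)
  have "distr M (\<Pi>\<^sub>M t\<in>{0..T}. borel) (sample_path T W) = distr M' (\<Pi>\<^sub>M t\<in>{0..T}. borel) (sample_path T W')"
    using W W' T
    by (intro gaussian_increments_distr_unique[of "{}"] gaussian_increments_brownian_motion
        measurable_sample_path_PiM AE_sample_path_0) (auto simp: brownian_motion_def)
  then show "distr (distr M (path_space T) (sample_path T W)) (\<Pi>\<^sub>M t\<in>{0..T}. borel) (\<lambda>x. x) =
      distr (distr M' (path_space T) (sample_path T W')) (\<Pi>\<^sub>M t\<in>{0..T}. borel) (\<lambda>x. x)"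
    by (simp add: distr_distr[OF measurable_path_space_PiM measurable_sample_path] W W' comp_def)
qed simp_all

lemma wiener_measure_brownian_motion:
  assumes W: "brownian_motion T M W" and T: "0 < T"
  shows "wiener_measure (distr M (path_space T) (sample_path T W)) T"
proof -
  let ?\<mu> = "distr M (path_space T) (sample_path T W)"
  interpret M: prob_space M using W by (simp add: brownian_motion_def)
  have mW: "sample_path T W \<in> measurable M (path_space T)" by (rule measurable_sample_path[OF W])
  interpret \<mu>: prob_space ?\<mu> by (rule M.prob_space_distr[OF mW])
  interpret \<mu>\<mu>: pair_prob_space ?\<mu> ?\<mu> ..
  have s [measurable_cong]: "sets ?\<mu> = sets (path_space T)" by simp
  have inc: "gaussian_increments_wrt {} T ?\<mu> (\<lambda>x. x)"
    unfolding gaussian_increments_wrt_def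
  proof (intro allI impI, elim conjE)
    fix n and t :: "nat \<Rightarrow> real" and A :: "nat \<Rightarrow> real set"
    assume t: "strict_mono_on {..n} t" "t ` {..n} \<subseteq> {0..T}" and A: "\<forall>i. A i \<in> sets borel"
    let ?E = "{w \<in> space (path_space T). \<forall>i<n. w (t (Suc i)) - w (t i) \<in> A i}"
    have E: "?E \<in> sets (path_space T)"
      using A by (intro sets_path_increments[OF t(2)]) auto
    have "emeasure ?\<mu> ?E = emeasure M (sample_path T W -` ?E \<inter> space M)"
      by (rule emeasure_distr[OF mW E])
    also have "sample_path T W -` ?E \<inter> space M =
      {\<omega> \<in> space M. \<forall>i<n. sample_path T W \<omega> (t (Suc i)) - sample_path T W \<omega> (t i) \<in> A i}"
      using measurable_space[OF mW] by auto
    finally show "emeasure ?\<mu> {x \<in> space ?\<mu>. \<forall>i<n. x (t (Suc i)) - x (t i) \<in> A i} =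
         (\<Prod>i<n. emeasure (gaussian (t (Suc i) - t i)) (A i))"
      using gaussian_increments_wrtD[OF gaussian_increments_brownian_motion[OF W] t] A
      by (simp add: space_distr)
  qed
  have start: "AE w in ?\<mu>. w 0 = 0"
    using AE_sample_path_0[OF W] T mW measurable_path_eval[of 0 T]
    by (subst AE_distr_iff) auto
  have spl: "distr (?\<mu> \<Otimes>\<^sub>M ?\<mu>) (path_space T) (path_splice T a b) = ?\<mu>" if ab: "0 \<le> a" "a \<le> b" "b \<le> T" for a b
  proof (rule path_space_measure_eqI[where T=T])
    have ms: "path_splice T a b \<in> measurable (?\<mu> \<Otimes>\<^sub>M ?\<mu>) (path_space T)"
      using measurable_splice[OF ab] by measurable
    have m0: "(\<lambda>x. x) \<in> measurable ?\<mu> (\<Pi>\<^sub>M t\<in>{0..T}. borel)"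
      using measurable_path_space_PiM by simp
    have "AE x in ?\<mu> \<Otimes>\<^sub>M ?\<mu>. path_splice T a b x 0 = 0"
    proof -
      have "AE x in ?\<mu> \<Otimes>\<^sub>M ?\<mu>. fst x 0 = 0"
        using start by (intro AE_distrD[OF measurable_fst, of "\<lambda>w. w 0 = 0" ?\<mu> ?\<mu>]) (simp only: \<mu>.distr_pair_fst)
      then show ?thesis
      proof eventually_elim
        case (elim x)
        then show ?case using splice_apply[OF ab, of 0 "fst x" "snd x"] ab T by (simp add: min_def max_def)
      qed
    qed
    \<comment> \<open>Uniqueness is applied with \<open>K = {a, b}\<close>: this is what is known of
      the spliced path, and for \<open>?\<mu>\<close> itself it follows from the case of the empty
      set.\<close>
    then have "distr (?\<mu> \<Otimes>\<^sub>M ?\<mu>) (\<Pi>\<^sub>M t\<in>{0..T}. borel) (path_splice T a b) = distr ?\<mu> (\<Pi>\<^sub>M t\<in>{0..T}. borel) (\<lambda>x. x)"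
      using ab T start
      by (intro gaussian_increments_distr_unique[of "{a, b}"] gaussian_increments_splice
          gaussian_increments_wrt_mono[OF inc] measurable_compose[OF ms measurable_path_space_PiM] m0
          inc \<mu>.prob_space_axioms \<mu>\<mu>.prob_space_axioms) auto
    then show "distr (distr (?\<mu> \<Otimes>\<^sub>M ?\<mu>) (path_space T) (path_splice T a b)) (\<Pi>\<^sub>M t\<in>{0..T}. borel) (\<lambda>x. x) =
        distr ?\<mu> (\<Pi>\<^sub>M t\<in>{0..T}. borel) (\<lambda>x. x)"
      by (simp add: distr_distr[OF measurable_path_space_PiM ms] comp_def)
  qed simp_all
  show ?thesis
  proof
    show "distr ?\<mu> borel (\<lambda>w. w t - w s) = gaussian (t - s)" if st: "0 \<le> s" "s < t" "t \<le> T" for s t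
    proof -
      have "distributed M lborel (\<lambda>\<omega>. W t \<omega> - W s \<omega>) (\<lambda>x. ennreal (normal_density 0 (sqrt (t - s)) x))"
        using W st unfolding brownian_motion_def by blast
      then have "distr M lborel (\<lambda>\<omega>. W t \<omega> - W s \<omega>) = gaussian (t - s)"
        unfolding distributed_def gaussian_def by auto
      moreover have "distr ?\<mu> borel (\<lambda>w. w t - w s) = distr M lborel (\<lambda>\<omega>. W t \<omega> - W s \<omega>)"
        using st by (subst distr_distr[OF _ mW])
         (auto intro!: distr_cong borel_measurable_diff measurable_path_eval simp: sample_path_def comp_def)
      ultimately show ?thesis by simp
    qed
  qed (fact T s start spl)+
qed

subsection \<open>The heat kernel\<close>

text \<open>Derivative and integrand are only required inside the interval, because integrands such
  as \<open>1 / (2 * sqrt (r - s))\<close> blow up at an end point while their antiderivatives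
  remain continuous there.\<close>

lemma nn_integral_FTC_open:
  fixes F f :: "real \<Rightarrow> real"
  assumes "a < b"
    and F: "\<And>x. a < x \<Longrightarrow> x < b \<Longrightarrow> (F has_real_derivative f x) (at x)"
    and f: "\<And>x. a < x \<Longrightarrow> x < b \<Longrightarrow> isCont f x" "\<And>x. a < x \<Longrightarrow> x < b \<Longrightarrow> 0 \<le> f x"
    and c: "continuous_on {a..b} F"
  shows "(\<integral>\<^sup>+x. ennreal (f x) * indicator {a<..<b} x \<partial>lborel) = ennreal (F b - F a)"
proof -
  have A: "((F \<circ> real_of_ereal) \<longlongrightarrow> F a) (at_right (ereal a))"
    using c assms(1) by (auto simp: ereal_tendsto_simps continuous_on_Icc_at_rightD)
  have B: "((F \<circ> real_of_ereal) \<longlongrightarrow> F b) (at_left (ereal b))"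
    using c assms(1) by (auto simp: ereal_tendsto_simps continuous_on_Icc_at_leftD)
  note I = interval_integral_FTC_nonneg[of "ereal a" "ereal b" F f, OF _ _ _ _ A B]
  have i: "set_integrable lborel (einterval (ereal a) (ereal b)) f"
    and eq: "(LBINT x=a..b. f x) = F b - F a"
    by (rule I(1), use assms in auto) (rule I(2), use assms in auto)
  have e: "einterval (ereal a) (ereal b) = {a<..<b}" by (auto simp: einterval_def)
  have "(\<integral>\<^sup>+x. ennreal (f x) * indicator {a<..<b} x \<partial>lborel) =
     (\<integral>\<^sup>+x. ennreal (indicator {a<..<b} x * f x) \<partial>lborel)"
    by (intro nn_integral_cong) (auto simp: indicator_def)
  also have "\<dots> = ennreal (LINT x|lborel. indicator {a<..<b} x * f x)"
    using i f unfolding e set_integrable_def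
    by (intro nn_integral_eq_integral) (auto simp: indicator_def)
  also have "(LINT x|lborel. indicator {a<..<b} x * f x) = (LBINT x=a..b. f x)"
    using assms(1) by (simp add: interval_lebesgue_integral_def e set_lebesgue_integral_def)
  finally show ?thesis using eq by simp
qed

definition heat :: "real \<Rightarrow> real \<Rightarrow> real" where
  "heat u x = normal_density 0 (sqrt u) x"

lemma heat_eq: "0 \<le> u \<Longrightarrow> heat u x = exp (- x\<^sup>2 / (2 * u)) / sqrt (2 * pi * u)"
  by (simp add: heat_def normal_density_def)

lemma heat_nonneg [simp]: "0 \<le> heat u x"
  by (simp add: heat_def)

lemma heat_minus [simp]: "heat u (- x) = heat u x"
  by (simp add: heat_def normal_density_def)

lemma heat_abs [simp]: "heat u \<bar>x\<bar> = heat u x"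
  by (simp add: heat_def normal_density_def)

lemma heat_minus_commute: "heat u (x - y) = heat u (y - x)"
  using heat_minus[of u "x - y"] by simp

lemma borel_measurable_heat [measurable (raw)]:
  assumes "f \<in> borel_measurable M" "g \<in> borel_measurable M"
  shows "(\<lambda>x. heat (f x) (g x)) \<in> borel_measurable M"
  unfolding heat_def normal_density_def using assms by measurable

lemma heat_antimono: "\<bar>x\<bar> \<le> \<bar>y\<bar> \<Longrightarrow> 0 < u \<Longrightarrow> heat u y \<le> heat u x"
  by (simp add: heat_eq divide_right_mono divide_simps abs_le_square_iff)

text \<open>The inequality behind it is \<open>4 \<le> 2 * pi\<close>. The factor 2 is kept because
  \<open>sqrt\<close> is then exactly the antiderivative in the bound on the kernel integrated over
  time.\<close>

lemma heat_le:
  assumes "0 < u"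
  shows "heat u x \<le> 1 / (2 * sqrt u)"
proof -
  have "heat u x \<le> 1 / sqrt (2 * pi * u)"
    using assms by (simp add: heat_eq divide_right_mono)
  also have "\<dots> \<le> 1 / (2 * sqrt u)"
  proof -
    have "2 * sqrt u = sqrt (4 * u)" by (simp add: real_sqrt_mult)
    also have "\<dots> \<le> sqrt (2 * pi * u)" using assms pi_gt3 by simp
    finally show ?thesis using assms by (intro divide_left_mono) auto
  qed
  finally show ?thesis .
qed

lemma nn_integral_heat_space:
  assumes "0 < u"
  shows "(\<integral>\<^sup>+y. ennreal (heat u (y - x)) \<partial>lborel) = 1"
proof -
  have "(\<integral>\<^sup>+y. ennreal (heat u (y - x)) \<partial>lborel) = (\<integral>\<^sup>+y. ennreal (normal_density x (sqrt u) y) \<partial>lborel)"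
    by (simp add: heat_def normal_density_def)
  also have "\<dots> = emeasure (density lborel (normal_density x (sqrt u))) UNIV"
    by (simp add: emeasure_density)
  also have "\<dots> = 1"
    using prob_space.emeasure_space_1[OF prob_space_normal_density[of "sqrt u" x]] assms by simp
  finally show ?thesis .
qed

lemma nn_integral_heat_time_le:
  assumes "s \<le> e"
  shows "(\<integral>\<^sup>+r. ennreal (heat (r - s) x) * indicator {s<..<e} r \<partial>lborel) \<le> ennreal (sqrt (e - s))"
proof (cases "s < e")
  case True
  have "(\<integral>\<^sup>+r. ennreal (heat (r - s) x) * indicator {s<..<e} r \<partial>lborel) \<le>
     (\<integral>\<^sup>+r. ennreal (1 / (2 * sqrt (r - s))) * indicator {s<..<e} r \<partial>lborel)"
    by (intro nn_integral_mono) (auto simp: indicator_def heat_le)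
  also have "\<dots> = ennreal (sqrt (e - s) - sqrt (s - s))"
    by (rule nn_integral_FTC_open[OF True])
      (auto intro!: derivative_eq_intros continuous_intros simp: divide_simps)
  finally show ?thesis by simp
qed (use assms in auto)

text \<open>Fundamental theorem in the space variable. The integrand \<open>z / u * heat u z\<close>
  is also the density at time \<open>u\<close> of the first passage of Brownian motion through level
  \<open>z\<close>, so its integral over \<open>u\<close> is bounded uniformly in
  \<open>z\<close>.\<close>

lemma heat_diff_eq:
  assumes "0 < u" "0 \<le> x" "x \<le> y"
  shows "ennreal (heat u x - heat u y) = (\<integral>\<^sup>+z. ennreal (z / u * heat u z) * indicator {x<..<y} z \<partial>lborel)"
proof (cases "x < y")
  case True
  have "(\<integral>\<^sup>+z. ennreal (z / u * heat u z) * indicator {x<..<y} z \<partial>lborel) = ennreal (- heat u y - - heat u x)"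
  proof (rule nn_integral_FTC_open[OF True])
    fix z :: real
    have "((\<lambda>z. - (exp (- z\<^sup>2 / (2 * u)) / sqrt (2 * pi * u))) has_real_derivative
        z / u * (exp (- z\<^sup>2 / (2 * u)) / sqrt (2 * pi * u))) (at z)"
      using assms by (auto intro!: derivative_eq_intros simp: divide_simps)
    then show "((\<lambda>z. - heat u z) has_real_derivative z / u * heat u z) (at z)"
      using assms by (simp add: heat_eq)
    have c: "continuous_on UNIV (heat u)"
      unfolding heat_def normal_density_def using assms by (intro continuous_intros) auto
    then have "isCont (heat u) z" by (simp add: continuous_on_eq_continuous_at)
    then show "isCont (\<lambda>z. z / u * heat u z) z"
      using assms by (intro continuous_intros) auto
    show "continuous_on {x..y} (\<lambda>z. - heat u z)"
      by (intro continuous_intros continuous_on_subset[OF c]) auto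
  qed (use assms in auto)
  then show ?thesis by simp
qed (use assms in auto)

text \<open>The bound \<open>exp (- v) \<le> 1 / (1 + v)\<close> replaces the first passage density by a function with
  an elementary antiderivative.\<close>

lemma nn_integral_hitting_density_le:
  assumes "0 < z" "0 < h"
  shows "(\<integral>\<^sup>+u. ennreal (z / u * heat u z) * indicator {0<..<h} u \<partial>lborel) \<le> 2"
proof -
  define c where "c = 1 / sqrt (2 * pi)"
  have c: "0 < c" by (simp add: c_def)
  have le: "z / u * heat u z \<le> c * (2 * z / (sqrt u * (2 * u + z\<^sup>2)))" if u: "0 < u" for u
  proof -
    have "exp (- z\<^sup>2 / (2 * u)) \<le> 1 / (1 + z\<^sup>2 / (2 * u))"
      using exp_ge_add_one_self[of "z\<^sup>2 / (2 * u)"] u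
      by (simp add: exp_minus inverse_eq_divide del: exp_ge_add_one_self) (intro divide_left_mono, auto intro!: add_pos_nonneg mult_pos_pos)
    also have "\<dots> = 2 * u / (2 * u + z\<^sup>2)" using u by (simp add: field_simps)
    finally have "exp (- z\<^sup>2 / (2 * u)) / sqrt (2 * pi * u) \<le> (2 * u / (2 * u + z\<^sup>2)) / sqrt (2 * pi * u)"
      using u by (intro divide_right_mono) auto
    then have "z / u * heat u z \<le> z / u * ((2 * u / (2 * u + z\<^sup>2)) / sqrt (2 * pi * u))"
      using u assms by (simp only: heat_eq less_imp_le) (intro mult_left_mono, auto)
    also have "\<dots> = c * (2 * z / (sqrt u * (2 * u + z\<^sup>2)))"
      using u by (simp add: c_def real_sqrt_mult mult_ac)
    finally show ?thesis .
  qed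
  \<comment> \<open>The substitution \<open>sqrt (2 * u) = z * tan \<theta>\<close> produces this
    antiderivative. Its total increase is at most \<open>c * sqrt 2 * pi = sqrt pi\<close>, for
    every \<open>z\<close> and \<open>h\<close>.\<close>
  let ?F = "\<lambda>u. c * (2 * sqrt 2 * arctan (sqrt (2 * u) / z))"
  have "(\<integral>\<^sup>+u. ennreal (z / u * heat u z) * indicator {0<..<h} u \<partial>lborel) \<le>
    (\<integral>\<^sup>+u. ennreal (c * (2 * z / (sqrt u * (2 * u + z\<^sup>2)))) * indicator {0<..<h} u \<partial>lborel)"
    by (intro nn_integral_mono) (auto simp: indicator_def simp del: times_divide_eq_left times_divide_eq_right intro!: ennreal_leI le)
  also have "\<dots> = ennreal (?F h - ?F 0)"
  proof (rule nn_integral_FTC_open[OF assms(2)])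
    fix u :: real assume u: "0 < u" "u < h"
    have pos: "0 < 2 * u + z\<^sup>2" using u assms by (intro add_pos_pos) auto
    have sq: "(sqrt (2 * u) / z)\<^sup>2 = 2 * u / z\<^sup>2" using u by (simp add: power_divide)
    have "(?F has_real_derivative c * (2 * sqrt 2 * (inverse (1 + (sqrt (2 * u) / z)\<^sup>2) *
       (inverse (sqrt (2 * u)) / 2 * 2 / z)))) (at u)"
      using u assms by (auto intro!: derivative_eq_intros)
    also have "c * (2 * sqrt 2 * (inverse (1 + (sqrt (2 * u) / z)\<^sup>2) * (inverse (sqrt (2 * u)) / 2 * 2 / z)))
      = c * (2 * z / (sqrt u * (2 * u + z\<^sup>2)))"
      unfolding sq using u assms pos by (simp add: real_sqrt_mult divide_simps power2_eq_square)
    finally show "(?F has_real_derivative c * (2 * z / (sqrt u * (2 * u + z\<^sup>2)))) (at u)" .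
    show "isCont (\<lambda>u. c * (2 * z / (sqrt u * (2 * u + z\<^sup>2)))) u"
      using u pos by (intro continuous_intros) auto
    show "0 \<le> c * (2 * z / (sqrt u * (2 * u + z\<^sup>2)))" using c u assms by auto
  next
    show "continuous_on {0..h} ?F" using assms by (intro continuous_intros) auto
  qed
  also have "\<dots> \<le> ennreal 2"
  proof (rule ennreal_leI)
    have "?F h - ?F 0 \<le> c * (2 * sqrt 2 * (pi / 2))"
      using c arctan_ubound[of "sqrt (2 * h) / z"] by (intro diff_le_eq[THEN iffD2]) (simp add: mult_left_mono less_imp_le)
    also have "\<dots> = sqrt pi"
      by (simp add: c_def real_sqrt_mult divide_simps)
    also have "\<dots> \<le> 2" using pi_less_4 by (simp add: real_le_lsqrt)
    finally show "?F h - ?F 0 \<le> 2" .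
  qed
  finally show ?thesis by simp
qed

lemma nn_integral_translate:
  fixes f :: "real \<Rightarrow> ennreal"
  assumes [measurable]: "f \<in> borel_measurable borel"
  shows "(\<integral>\<^sup>+r. f (r - s) \<partial>lborel) = (\<integral>\<^sup>+r. f r \<partial>lborel)"
  using nn_integral_real_affine[of f 1 "-s"] by simp

text \<open>The difference of kernels is an integral over levels between the two distances; after
  exchanging the integrals each level costs at most 2 by
  \<open>nn_integral_hitting_density_le\<close>. The kernel is even and decreasing in the distance,
  which reduces everything to ordered nonnegative arguments. The bound does not depend on the
  horizon \<open>e\<close>.\<close>

lemma nn_integral_heat_time_diff_le:
  "(\<integral>\<^sup>+r. ennreal \<bar>heat (r - s) x - heat (r - s) y\<bar> * indicator {s<..<e} r \<partial>lborel)
    \<le> ennreal (2 * \<bar>x - y\<bar>)"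
proof -
  have *: "(\<integral>\<^sup>+u. ennreal \<bar>heat u x - heat u y\<bar> * indicator {0<..<h} u \<partial>lborel) \<le> ennreal (2 * (y - x))"
    if xy: "0 \<le> x" "x \<le> y" and h: "0 < h" for x y h
  proof -
    have "(\<integral>\<^sup>+u. ennreal \<bar>heat u x - heat u y\<bar> * indicator {0<..<h} u \<partial>lborel) =
      (\<integral>\<^sup>+u. (\<integral>\<^sup>+z. ennreal (z / u * heat u z) * indicator {x<..<y} z * indicator {0<..<h} u \<partial>lborel) \<partial>lborel)"
    proof (rule nn_integral_cong)
      fix u
      show "ennreal \<bar>heat u x - heat u y\<bar> * indicator {0<..<h} u =
        (\<integral>\<^sup>+z. ennreal (z / u * heat u z) * indicator {x<..<y} z * indicator {0<..<h} u \<partial>lborel)"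
      proof (cases "u \<in> {0<..<h}")
        case True
        then have "\<bar>heat u x - heat u y\<bar> = heat u x - heat u y" using heat_antimono[of x y u] xy by auto
        then show ?thesis using heat_diff_eq[of u x y] xy True by simp
      qed simp
    qed
    also have "\<dots> = (\<integral>\<^sup>+z. (\<integral>\<^sup>+u. ennreal (z / u * heat u z) * indicator {x<..<y} z * indicator {0<..<h} u \<partial>lborel) \<partial>lborel)"
      by (rule lborel_pair.Fubini') measurable
    also have "\<dots> \<le> (\<integral>\<^sup>+z. 2 * indicator {x<..<y} z \<partial>lborel)"
    proof (rule nn_integral_mono)
      fix z
      show "(\<integral>\<^sup>+u. ennreal (z / u * heat u z) * indicator {x<..<y} z * indicator {0<..<h} u \<partial>lborel) \<le> 2 * indicator {x<..<y} z"
      proof (cases "z \<in> {x<..<y}")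
        case True
        then show ?thesis using nn_integral_hitting_density_le[of z h] xy h by simp
      qed simp
    qed
    also have "\<dots> = ennreal (2 * (y - x))"
      using xy by (subst ennreal_mult) (auto simp: nn_integral_cmult)
    finally show ?thesis .
  qed
  show ?thesis
  proof (cases "s < e")
    case True
    have "(\<integral>\<^sup>+r. ennreal \<bar>heat (r - s) x - heat (r - s) y\<bar> * indicator {s<..<e} r \<partial>lborel) =
      (\<integral>\<^sup>+r. ennreal \<bar>heat (r - s) x - heat (r - s) y\<bar> * indicator {0<..<e - s} (r - s) \<partial>lborel)"
      by (intro nn_integral_cong) (auto simp: indicator_def)
    also have "\<dots> = (\<integral>\<^sup>+u. ennreal \<bar>heat u x - heat u y\<bar> * indicator {0<..<e - s} u \<partial>lborel)"
      by (rule nn_integral_translate) measurable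
    also have "\<dots> = (\<integral>\<^sup>+u. ennreal \<bar>heat u \<bar>x\<bar> - heat u \<bar>y\<bar>\<bar> * indicator {0<..<e - s} u \<partial>lborel)"
      by simp
    also have "\<dots> \<le> ennreal (2 * \<bar>\<bar>x\<bar> - \<bar>y\<bar>\<bar>)"
    proof (cases "\<bar>x\<bar> \<le> \<bar>y\<bar>")
      case le: True
      then show ?thesis using *[of "\<bar>x\<bar>" "\<bar>y\<bar>" "e - s"] True by (simp del: heat_abs)
    next
      case False
      then show ?thesis using *[of "\<bar>y\<bar>" "\<bar>x\<bar>" "e - s"] True
        by (simp add: abs_minus_commute del: heat_abs)
    qed
    also have "\<dots> \<le> ennreal (2 * \<bar>x - y\<bar>)" by (intro ennreal_leI mult_left_mono abs_triangle_ineq3) simp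
    finally show ?thesis .
  qed simp
qed

text \<open>At times of order \<open>d\<^sup>2\<close> the kernels at the two distances differ by a
  fixed fraction of their size \<open>1 / d\<close>. With \<open>v = d\<^sup>2 / u\<close> in
  \<open>[1/2, 1]\<close> the exponentials differ by at least \<open>1 / 16\<close> and the
  normalisation is at most \<open>8 * d\<close>; hence 128. The distances \<open>d / 4\<close> and
  \<open>3 * d / 4\<close> are those met near a pole of the dipole.\<close>

lemma heat_diff_ge:
  assumes d: "0 < d" and u: "d\<^sup>2 \<le> u" "u \<le> 2 * d\<^sup>2"
  shows "1 / (128 * d) \<le> heat u (d / 4) - heat u (3 * d / 4)"
proof -
  have u0: "0 < u" using d u(1) by (smt (verit) zero_less_power)
  define v where "v = d\<^sup>2 / u"
  have v: "1 / 2 \<le> v" "v \<le> 1" using u u0 by (auto simp: v_def field_simps)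
  have e1: "exp (- (d / 4)\<^sup>2 / (2 * u)) = exp (- v / 32)"
    using u0 by (simp add: v_def power_divide)
  have e2: "exp (- (3 * d / 4)\<^sup>2 / (2 * u)) = exp (- (9 * v / 32))"
    using u0 by (simp add: v_def power_divide power_mult_distrib)
  have "exp (- v / 32) = exp (- (9 * v / 32)) * exp (v / 4)"
    by (simp add: exp_add[symmetric])
  also have "\<dots> \<ge> exp (- (9 * v / 32)) * (1 + v / 4)"
    by (intro mult_left_mono) auto
  finally have 1: "exp (- v / 32) - exp (- (9 * v / 32)) \<ge> exp (- (9 * v / 32)) * (v / 4)"
    by (simp add: algebra_simps)
  have "1 / 2 \<le> 1 + - (9 * v / 32)" using v by simp
  also have "\<dots> \<le> exp (- (9 * v / 32))" by (rule exp_ge_add_one_self)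
  finally have "exp (- (9 * v / 32)) * (v / 4) \<ge> 1 / 2 * (1 / 8)"
    using v by (intro mult_mono) auto
  with 1 have 2: "exp (- v / 32) - exp (- (9 * v / 32)) \<ge> 1 / 16" by simp
  have 4: "0 \<le> exp (- v / 32) - exp (- (9 * v / 32))" using 2 by linarith
  have 3: "sqrt (2 * pi * u) \<le> 8 * d"
  proof (rule real_le_lsqrt)
    have "2 * pi * u \<le> 2 * 4 * (2 * d\<^sup>2)"
      using u u0 pi_less_4 by (intro mult_mono) auto
    also have "\<dots> \<le> (8 * d)\<^sup>2" by (simp add: power_mult_distrib)
    finally show "2 * pi * u \<le> (8 * d)\<^sup>2" .
  qed (use d u0 in auto)
  have "1 / (128 * d) = (1 / 16) / (8 * d)" by simp
  also have "\<dots> \<le> (exp (- v / 32) - exp (- (9 * v / 32))) / sqrt (2 * pi * u)"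
    using u0 by (intro frac_le 2 3 4) auto
  also have "\<dots> = heat u (d / 4) - heat u (3 * d / 4)"
    unfolding e1[symmetric] e2[symmetric] using u0 by (simp add: heat_eq diff_divide_distrib)
  finally show ?thesis .
qed

subsection \<open>Powers of integrals\<close>

lemma borel_measurable_indicator_Ioo [measurable (raw)]:
  fixes f g h :: "'a \<Rightarrow> real"
  assumes [measurable]: "f \<in> borel_measurable M" "g \<in> borel_measurable M" "h \<in> borel_measurable M"
  shows "(\<lambda>x. indicator {f x<..<g x} (h x) :: 'b :: {second_countable_topology, real_normed_vector, real_normed_algebra_1}) \<in> borel_measurable M"
proof -
  have "(\<lambda>x. indicator {f x<..<g x} (h x) :: 'b) = (\<lambda>x. if f x < h x \<and> h x < g x then 1 else 0)"
    by (auto simp: indicator_def)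
  then show ?thesis by simp
qed

lemma borel_measurable_indicator_Ioo_ennreal [measurable (raw)]:
  fixes f g h :: "'a \<Rightarrow> real"
  assumes [measurable]: "f \<in> borel_measurable M" "g \<in> borel_measurable M" "h \<in> borel_measurable M"
  shows "(\<lambda>x. indicator {f x<..<g x} (h x) :: ennreal) \<in> borel_measurable M"
proof -
  have "(\<lambda>x. indicator {f x<..<g x} (h x) :: ennreal) = (\<lambda>x. if f x < h x \<and> h x < g x then 1 else 0)"
    by (auto simp: indicator_def)
  then show ?thesis by simp
qed

lemma integrable_indicator_Ioo_bounded:
  fixes h :: "real \<Rightarrow> real"
  assumes "h \<in> borel_measurable borel" "\<And>r. s < r \<Longrightarrow> r < e \<Longrightarrow> \<bar>h r\<bar> \<le> C"
  shows "integrable lborel (\<lambda>r. indicator {s<..<e} r * h r)"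
proof -
  have "integrable lborel (\<lambda>r. indicator {s<..<e} r * C)"
    by (intro integrable_mult_left integrable_real_indicator) (cases "s \<le> e"; simp)+
  then show ?thesis
  proof (rule Bochner_Integration.integrable_bound)
    show "(\<lambda>r. indicator {s<..<e} r * h r) \<in> borel_measurable lborel" using assms(1) by measurable
    show "AE r in lborel. norm (indicator {s<..<e} r * h r) \<le> norm (indicator {s<..<e} r * C)"
      using assms(2) by (auto simp: indicator_def abs_mult intro!: AE_I2 order_trans[OF assms(2)])
  qed
qed

text \<open>Integration by parts for absolutely continuous functions, in terms of their densities.\<close>

lemma integral_Ioo_product:
  fixes a b :: "real \<Rightarrow> real"
  assumes a: "integrable lborel (\<lambda>r. indicator {s<..<e} r * a r)"
    and b: "integrable lborel (\<lambda>r. indicator {s<..<e} r * b r)"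
  defines "A \<equiv> \<lambda>r. LINT u|lborel. indicator {r<..<e} u * a u"
    and "B \<equiv> \<lambda>r. LINT u|lborel. indicator {r<..<e} u * b u"
  shows "A s * B s = (LINT r|lborel. indicator {s<..<e} r * (a r * B r)) +
     (LINT r|lborel. indicator {s<..<e} r * (b r * A r))"
    and "integrable lborel (\<lambda>r. indicator {s<..<e} r * (a r * B r))"
    and "integrable lborel (\<lambda>r. indicator {s<..<e} r * (b r * A r))"
proof -
  \<comment> \<open>Stated for arbitrary densities, since it is applied once to \<open>a\<close>,
    \<open>b\<close> and once with the roles exchanged. It expresses one triangle of the square as
    an iterated integral.\<close>
  have *: "integrable lborel (\<lambda>r. indicator {s<..<e} r * (a r * (LINT u|lborel. indicator {r<..<e} u * b u))) \<and>
     (LINT r|lborel. indicator {s<..<e} r * (a r * (LINT u|lborel. indicator {r<..<e} u * b u)))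
      = (LINT r|lborel. LINT q|lborel. (indicator {s<..<e} r * a r) * (indicator {s<..<e} q * b q) * indicator {r<..} q) \<and>
      integrable (lborel \<Otimes>\<^sub>M lborel) (\<lambda>(r, q). (indicator {s<..<e} r * a r) * (indicator {s<..<e} q * b q) * indicator {r<..} q) \<and>
      integrable (lborel \<Otimes>\<^sub>M lborel) (\<lambda>(r, q). (indicator {s<..<e} r * a r) * (indicator {s<..<e} q * b q))"
    if a: "integrable lborel (\<lambda>r. indicator {s<..<e} r * a r)"
    and b: "integrable lborel (\<lambda>r. indicator {s<..<e} r * b r)" for a b :: "real \<Rightarrow> real"
  proof -
    define \<alpha> where "\<alpha> r = indicator {s<..<e} r * a r" for r
    define \<beta> where "\<beta> r = indicator {s<..<e} r * b r" for r
    have [measurable]: "\<alpha> \<in> borel_measurable borel" "\<beta> \<in> borel_measurable borel"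
      using a b by (auto simp: \<alpha>_def[abs_def] \<beta>_def[abs_def] dest!: borel_measurable_integrable)
    have I: "integrable lborel \<alpha>" "integrable lborel \<beta>"
      using a b by (auto simp: \<alpha>_def[abs_def] \<beta>_def[abs_def])
    have i1: "integrable (lborel \<Otimes>\<^sub>M lborel) (\<lambda>(r, q). \<alpha> r * \<beta> q)"
    proof (rule lborel_pair.Fubini_integrable)
      show "(\<lambda>(r, q). \<alpha> r * \<beta> q) \<in> borel_measurable (lborel \<Otimes>\<^sub>M lborel)" by measurable
      show "integrable lborel (\<lambda>x. LINT y|lborel. norm (case (x, y) of (r, q) \<Rightarrow> \<alpha> r * \<beta> q))"
        using I(1) by (simp add: abs_mult)
    qed (use I in auto)
    have i2: "integrable (lborel \<Otimes>\<^sub>M lborel) (\<lambda>(r, q). \<alpha> r * \<beta> q * indicator {r<..} q)"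
    proof (rule Bochner_Integration.integrable_bound[OF i1])
      have "(\<lambda>(r, q). \<alpha> r * \<beta> q * indicator {r<..} q :: real) = (\<lambda>(r, q). \<alpha> r * \<beta> q * (if r < q then 1 else 0))"
        by (auto simp: fun_eq_iff)
      then show "(\<lambda>(r, q). \<alpha> r * \<beta> q * indicator {r<..} q) \<in> borel_measurable (lborel \<Otimes>\<^sub>M lborel)" by simp
    qed (auto simp: indicator_def)
    have eq: "indicator {s<..<e} r * (a r * (LINT u|lborel. indicator {r<..<e} u * b u)) =
        (LINT q|lborel. \<alpha> r * \<beta> q * indicator {r<..} q)" for r
    proof (cases "r \<in> {s<..<e}")
      case True
      then have "(LINT u|lborel. indicator {r<..<e} u * b u) = (LINT q|lborel. \<beta> q * indicator {r<..} q)"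
        by (intro Bochner_Integration.integral_cong) (auto simp: \<beta>_def indicator_def)
      then show ?thesis using True by (simp add: \<alpha>_def mult.assoc)
    qed (simp add: \<alpha>_def)
    show ?thesis
      using lborel_pair.integrable_fst[OF i2] i1 i2
      unfolding eq \<alpha>_def[symmetric] \<beta>_def[symmetric] by simp
  qed
  let ?\<alpha> = "\<lambda>r. indicator {s<..<e} r * a r"
  let ?\<beta> = "\<lambda>r. indicator {s<..<e} r * b r"
  note ab = *[OF a b] and ba = *[OF b a]
  show "integrable lborel (\<lambda>r. indicator {s<..<e} r * (a r * B r))"
    "integrable lborel (\<lambda>r. indicator {s<..<e} r * (b r * A r))"
    using ab ba unfolding A_def B_def by auto
  have "A s * B s = (LINT r|lborel. LINT q|lborel. ?\<alpha> r * ?\<beta> q)"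
    by (simp add: A_def B_def)
  also have "\<dots> = (LINT p|(lborel \<Otimes>\<^sub>M lborel). (case p of (r, q) \<Rightarrow> ?\<alpha> r * ?\<beta> q))"
    using ab by (intro lborel_pair.integral_fst) auto
  \<comment> \<open>The square is split into the triangles \<open>r < q\<close> and
    \<open>q < r\<close>; the diagonal is a null set.\<close>
  also have "\<dots> = (LINT p|(lborel \<Otimes>\<^sub>M lborel). (case p of (r, q) \<Rightarrow> ?\<alpha> r * ?\<beta> q * indicator {r<..} q)
      + (case p of (r, q) \<Rightarrow> ?\<beta> q * ?\<alpha> r * indicator {q<..} r))"
  proof (rule integral_cong_AE)
    have "AE p in lborel \<Otimes>\<^sub>M lborel. fst p \<noteq> (snd p :: real)"
    proof (rule lborel_pair.AE_pair_measure)
      show "{x \<in> space (lborel \<Otimes>\<^sub>M lborel). fst x \<noteq> (snd x :: real)} \<in> sets (lborel \<Otimes>\<^sub>M lborel)"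
        by measurable
      show "AE x in lborel. AE y in lborel. fst (x, y) \<noteq> (snd (x, y) :: real)"
        by (auto intro!: AE_I2 eventually_mono[OF AE_lborel_singleton])
    qed
    then show "AE p in lborel \<Otimes>\<^sub>M lborel. (case p of (r, q) \<Rightarrow> ?\<alpha> r * ?\<beta> q) =
       (case p of (r, q) \<Rightarrow> ?\<alpha> r * ?\<beta> q * indicator {r<..} q) + (case p of (r, q) \<Rightarrow> ?\<beta> q * ?\<alpha> r * indicator {q<..} r)"
      by eventually_elim (auto simp: indicator_def)
    show "(\<lambda>p. case p of (r, q) \<Rightarrow> ?\<alpha> r * ?\<beta> q) \<in> borel_measurable (lborel \<Otimes>\<^sub>M lborel)"
      using ab by (auto dest: borel_measurable_integrable)
    show "(\<lambda>p. (case p of (r, q) \<Rightarrow> ?\<alpha> r * ?\<beta> q * indicator {r<..} q) + (case p of (r, q) \<Rightarrow> ?\<beta> q * ?\<alpha> r * indicator {q<..} r))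
       \<in> borel_measurable (lborel \<Otimes>\<^sub>M lborel)"
      using ab ba lborel_pair.integrable_product_swap[of "\<lambda>(q, r). ?\<beta> q * ?\<alpha> r * indicator {q<..} r"]
      by (intro borel_measurable_add) (auto dest: borel_measurable_integrable)
  qed
  also have "\<dots> = (LINT p|(lborel \<Otimes>\<^sub>M lborel). (case p of (r, q) \<Rightarrow> ?\<alpha> r * ?\<beta> q * indicator {r<..} q)) +
      (LINT p|(lborel \<Otimes>\<^sub>M lborel). (case p of (r, q) \<Rightarrow> ?\<beta> q * ?\<alpha> r * indicator {q<..} r))"
    using ab ba lborel_pair.integrable_product_swap[of "\<lambda>(q, r). ?\<beta> q * ?\<alpha> r * indicator {q<..} r"]
    by (intro Bochner_Integration.integral_add) auto
  also have "(LINT p|(lborel \<Otimes>\<^sub>M lborel). (case p of (r, q) \<Rightarrow> ?\<beta> q * ?\<alpha> r * indicator {q<..} r)) =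
     (LINT p|(lborel \<Otimes>\<^sub>M lborel). (case p of (q, r) \<Rightarrow> ?\<beta> q * ?\<alpha> r * indicator {q<..} r))"
    using ba lborel_pair.integral_product_swap[of "\<lambda>(q, r). ?\<beta> q * ?\<alpha> r * indicator {q<..} r"]
    by (auto dest: borel_measurable_integrable)
  also have "(LINT p|(lborel \<Otimes>\<^sub>M lborel). (case p of (q, r) \<Rightarrow> ?\<beta> q * ?\<alpha> r * indicator {q<..} r)) =
      (LINT r|lborel. indicator {s<..<e} r * (b r * A r))"
    using ba lborel_pair.integral_fst[of "\<lambda>q r. ?\<beta> q * ?\<alpha> r * indicator {q<..} r"] by (simp add: A_def)
  also have "(LINT p|(lborel \<Otimes>\<^sub>M lborel). (case p of (r, q) \<Rightarrow> ?\<alpha> r * ?\<beta> q * indicator {r<..} q)) =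
      (LINT r|lborel. indicator {s<..<e} r * (a r * B r))"
    using ab lborel_pair.integral_fst[of "\<lambda>q r. ?\<alpha> q * ?\<beta> r * indicator {q<..} r"] by (simp add: B_def)
  finally show "A s * B s = (LINT r|lborel. indicator {s<..<e} r * (a r * B r)) +
     (LINT r|lborel. indicator {s<..<e} r * (b r * A r))" .
qed

text \<open>As \<open>\<Phi>\<close> has density \<open>- \<phi>\<close>, this is the chain rule for
  \<open>\<Phi> ^ Suc m\<close> without differentiability of \<open>\<Phi>\<close>. The induction
  step applies the product formula to \<open>\<phi>\<close> and to
  \<open>(m + 1) * \<phi> * \<Phi> ^ m\<close>, whose integral up to \<open>e\<close> is
  \<open>\<Phi> ^ Suc m\<close> by hypothesis. Averaged over paths, it becomes the moment
  recursion.\<close>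

lemma integral_Ioo_power:
  fixes \<phi> :: "real \<Rightarrow> real"
  assumes \<phi>: "integrable lborel (\<lambda>r. indicator {s<..<e} r * \<phi> r)"
  defines "\<Phi> \<equiv> \<lambda>r. LINT u|lborel. indicator {r<..<e} u * \<phi> u"
  shows "integrable lborel (\<lambda>r. indicator {s<..<e} r * (\<phi> r * \<Phi> r ^ m)) \<and>
    \<Phi> s ^ Suc m = real (Suc m) * (LINT r|lborel. indicator {s<..<e} r * (\<phi> r * \<Phi> r ^ m))"
  using \<phi>
proof (induction m arbitrary: s)
  case 0
  then show ?case by (simp add: \<Phi>_def)
next
  case (Suc m)
  let ?a = "\<lambda>r. real (Suc m) * (\<phi> r * \<Phi> r ^ m)"
  have a: "integrable lborel (\<lambda>r. indicator {s<..<e} r * ?a r)"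
    using Suc.IH[OF Suc.prems] by (auto simp: mult.left_commute[of _ "real _"] simp del: of_nat_Suc)
  \<comment> \<open>The induction hypothesis is needed at every later left end \<open>r\<close>,
    which is why \<open>s\<close> is generalised in the induction.\<close>
  have A: "(LINT u|lborel. indicator {r<..<e} u * ?a u) = \<Phi> r ^ Suc m" if "s \<le> r" for r
  proof -
    have "integrable lborel (\<lambda>u. indicator {r<..<e} u * (indicator {s<..<e} u * \<phi> u))"
      using integrable_mult_indicator[OF _ Suc.prems, of "{r<..<e}"] by simp
    also have "(\<lambda>u. indicator {r<..<e} u * (indicator {s<..<e} u * \<phi> u)) = (\<lambda>u. indicator {r<..<e} u * \<phi> u)"
      using that by (auto simp: indicator_def)
    finally show ?thesis
      using Suc.IH[of r] by (simp add: mult.left_commute[of _ "real _"] del: of_nat_Suc power_Suc)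
  qed
  have eqA: "indicator {s<..<e} r * (\<phi> r * (LINT u|lborel. indicator {r<..<e} u * ?a u)) =
      indicator {s<..<e} r * (\<phi> r * \<Phi> r ^ Suc m)" for r
    using A[of r] by (cases "r \<in> {s<..<e}") (simp_all del: power_Suc of_nat_Suc)
  note P = integral_Ioo_product[OF a Suc.prems]
  have i: "integrable lborel (\<lambda>r. indicator {s<..<e} r * (\<phi> r * \<Phi> r ^ Suc m))"
    using P(3) unfolding eqA .
  have "\<Phi> s ^ Suc (Suc m) = \<Phi> s ^ Suc m * \<Phi> s" by simp
  also have "\<dots> = (LINT r|lborel. indicator {s<..<e} r * (?a r * \<Phi> r)) +
     (LINT r|lborel. indicator {s<..<e} r * (\<phi> r * \<Phi> r ^ Suc m))"
  proof -
    have "(LINT u|lborel. indicator {r<..<e} u * \<phi> u) = \<Phi> r" for r by (simp add: \<Phi>_def)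
    then show ?thesis using P(1) A[of s] unfolding eqA by (simp only: order_refl simp_thms)
  qed
  also have "(LINT r|lborel. indicator {s<..<e} r * (?a r * \<Phi> r)) =
     real (Suc m) * (LINT r|lborel. indicator {s<..<e} r * (\<phi> r * \<Phi> r ^ Suc m))"
    by (subst integral_mult_right_zero[symmetric]) (auto intro!: Bochner_Integration.integral_cong simp: mult_ac)
  finally show ?case using i by (simp add: algebra_simps)
qed

subsection \<open>Heat potentials\<close>

text \<open>The expected value of the integral of \<open>h\<close> along Brownian motion started
  from \<open>x\<close> at time \<open>s\<close> and run until \<open>e\<close>. It is one integral
  over the plane, so that either order of integration is at hand: space first for integrability,
  time first for the bounds.\<close>

definition heat_potential :: "real \<Rightarrow> real \<Rightarrow> (real \<Rightarrow> real \<Rightarrow> real) \<Rightarrow> real \<Rightarrow> real" where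
  "heat_potential s e h x =
     (LINT (r, y)|lborel. indicator {s<..<e} r * heat (r - s) (y - x) * h r y)"

lemma nn_integral_lborel_pair:
  fixes f :: "real \<Rightarrow> real \<Rightarrow> ennreal"
  assumes "(\<lambda>(r, y). f r y) \<in> borel_measurable borel"
  shows "(\<integral>\<^sup>+(r, y). f r y \<partial>lborel) = (\<integral>\<^sup>+r. \<integral>\<^sup>+y. f r y \<partial>lborel \<partial>lborel)"
    and "(\<integral>\<^sup>+(r, y). f r y \<partial>lborel) = (\<integral>\<^sup>+y. \<integral>\<^sup>+r. f r y \<partial>lborel \<partial>lborel)"
proof -
  have m: "(\<lambda>(r, y). f r y) \<in> borel_measurable (lborel \<Otimes>\<^sub>M lborel)"
    using assms by (simp add: lborel_prod)
  show "(\<integral>\<^sup>+(r, y). f r y \<partial>lborel) = (\<integral>\<^sup>+r. \<integral>\<^sup>+y. f r y \<partial>lborel \<partial>lborel)"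
    using lborel.nn_integral_fst[OF m] by (simp add: lborel_prod)
  then show "(\<integral>\<^sup>+(r, y). f r y \<partial>lborel) = (\<integral>\<^sup>+y. \<integral>\<^sup>+r. f r y \<partial>lborel \<partial>lborel)"
    using lborel_pair.Fubini'[OF m] by simp
qed

lemma measurable_borel_pair_iff:
  "f \<in> borel_measurable (borel \<Otimes>\<^sub>M borel) \<longleftrightarrow> f \<in> borel_measurable (borel :: (real \<times> real) measure)"
  by (simp add: borel_prod)

text \<open>Holds for every \<open>f\<close> because the integral of a non-integrable function is 0
  by convention, which spares integrability proofs in pure upper bounds.\<close>

lemma ennreal_abs_integral_le:
  fixes f :: "'a \<Rightarrow> real"
  shows "ennreal \<bar>integral\<^sup>L M f\<bar> \<le> (\<integral>\<^sup>+x. ennreal \<bar>f x\<bar> \<partial>M)"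
proof (cases "integrable M f")
  case True
  then show ?thesis using integral_norm_bound_ennreal[OF True] by simp
qed (simp add: not_integrable_integral_eq)

lemma integrable_heat_potential:
  assumes h: "(\<lambda>(r, y). h r y) \<in> borel_measurable (borel \<Otimes>\<^sub>M borel)"
    and b: "\<And>r y. s < r \<Longrightarrow> r < e \<Longrightarrow> \<bar>h r y\<bar> \<le> C"
  shows "integrable lborel (\<lambda>(r, y). indicator {s<..<e} r * heat (r - s) (y - x) * h r y)"
proof (cases "s < e")
  case True
  let ?f = "\<lambda>r y. indicator {s<..<e} r * heat (r - s) (y - x) * h r y"
  have C: "0 \<le> C" using b[of "(s + e) / 2" 0] True by auto
  have [measurable]: "(\<lambda>(r, y). h r y) \<in> borel_measurable (borel \<Otimes>\<^sub>M borel)" by fact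
  have m: "(\<lambda>(r, y). ?f r y) \<in> borel_measurable (borel \<Otimes>\<^sub>M borel)" by measurable
  show ?thesis
  proof (rule integrableI_bounded)
    show "(\<lambda>(r, y). ?f r y) \<in> borel_measurable lborel"
      using m by (simp add: measurable_borel_pair_iff)
    have "(\<lambda>(r, y). ennreal \<bar>?f r y\<bar>) \<in> borel_measurable (borel \<Otimes>\<^sub>M borel)" by measurable
    then have "(\<integral>\<^sup>+p. ennreal (norm (case p of (r, y) \<Rightarrow> ?f r y)) \<partial>lborel) = (\<integral>\<^sup>+r. \<integral>\<^sup>+y. ennreal \<bar>?f r y\<bar> \<partial>lborel \<partial>lborel)"
      using nn_integral_lborel_pair(1)[of "\<lambda>r y. ennreal \<bar>?f r y\<bar>"]
      by (simp add: measurable_borel_pair_iff split_beta')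
    also have "\<dots> \<le> (\<integral>\<^sup>+r. ennreal C * indicator {s<..<e} r \<partial>lborel)"
    proof (rule nn_integral_mono)
      fix r
      show "(\<integral>\<^sup>+y. ennreal \<bar>?f r y\<bar> \<partial>lborel) \<le> ennreal C * indicator {s<..<e} r"
      proof (cases "r \<in> {s<..<e}")
        case r: True
        have "(\<integral>\<^sup>+y. ennreal \<bar>?f r y\<bar> \<partial>lborel) \<le> (\<integral>\<^sup>+y. ennreal C * ennreal (heat (r - s) (y - x)) \<partial>lborel)"
          using r b C by (intro nn_integral_mono)
            (auto simp: abs_mult ennreal_mult[symmetric] mult.commute intro!: ennreal_leI mult_right_mono)
        also have "\<dots> = ennreal C"
          using r by (simp add: nn_integral_cmult nn_integral_heat_space)
        finally show ?thesis using r by simp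
      qed simp
    qed
    also have "\<dots> = ennreal C * ennreal (e - s)"
      using True by (simp add: nn_integral_cmult)
    also have "\<dots> < \<infinity>" by (simp add: ennreal_mult_less_top)
    finally show "(\<integral>\<^sup>+p. ennreal (norm (case p of (r, y) \<Rightarrow> ?f r y)) \<partial>lborel) < \<infinity>" .
  qed
qed (simp add: split_beta')

text \<open>Time is integrated first: at each \<open>y\<close> the weight \<open>k\<close>
  contributes at most \<open>c\<close>, and only the mass of \<open>f\<close> remains for the space
  integral. This is the source of bounds that do not see the height of \<open>f\<close>. The weight
  is the heat kernel or a difference of two heat kernels.\<close>

lemma nn_integral_heat_weight_le:
  fixes k h :: "real \<Rightarrow> real \<Rightarrow> real" and f :: "real \<Rightarrow> real"
  assumes k: "(\<lambda>(r, y). k r y) \<in> borel_measurable (borel \<Otimes>\<^sub>M borel)"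
    and f [measurable]: "f \<in> borel_measurable borel"
    and le: "\<And>y. (\<integral>\<^sup>+r. ennreal \<bar>k r y\<bar> * indicator {s<..<e} r \<partial>lborel) \<le> c"
    and h: "\<And>r y. s < r \<Longrightarrow> r < e \<Longrightarrow> \<bar>h r y\<bar> \<le> f y * C" and "0 \<le> C" "\<And>y. 0 \<le> f y"
    and F: "(\<integral>\<^sup>+y. ennreal (f y) \<partial>lborel) \<le> F"
  shows "(\<integral>\<^sup>+(r, y). ennreal \<bar>indicator {s<..<e} r * k r y * h r y\<bar> \<partial>lborel) \<le> c * (ennreal C * F)"
proof -
  have [measurable]: "(\<lambda>(r, y). k r y) \<in> borel_measurable (borel \<Otimes>\<^sub>M borel)" by fact
  let ?g = "\<lambda>r y. ennreal \<bar>k r y\<bar> * indicator {s<..<e} r * ennreal (f y * C)"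
  have m: "(\<lambda>(r, y). ?g r y) \<in> borel_measurable (borel \<Otimes>\<^sub>M borel)" by measurable
  have "(\<integral>\<^sup>+(r, y). ennreal \<bar>indicator {s<..<e} r * k r y * h r y\<bar> \<partial>lborel) \<le> (\<integral>\<^sup>+(r, y). ?g r y \<partial>lborel)"
    using h by (intro nn_integral_mono)
     (auto simp: indicator_def abs_mult ennreal_mult[symmetric] assms intro!: ennreal_leI mult_left_mono)
  also have "\<dots> = (\<integral>\<^sup>+y. \<integral>\<^sup>+r. ?g r y \<partial>lborel \<partial>lborel)"
    by (rule nn_integral_lborel_pair(2)) (use m in \<open>simp add: measurable_borel_pair_iff\<close>)
  also have "\<dots> = (\<integral>\<^sup>+y. (\<integral>\<^sup>+r. ennreal \<bar>k r y\<bar> * indicator {s<..<e} r \<partial>lborel) * ennreal (f y * C) \<partial>lborel)"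
    by (intro nn_integral_cong nn_integral_multc) measurable
  also have "\<dots> \<le> (\<integral>\<^sup>+y. c * (ennreal C * ennreal (f y)) \<partial>lborel)"
    using le assms by (intro nn_integral_mono mult_mono) (auto simp: ennreal_mult mult.commute)
  also have "\<dots> = c * (ennreal C * (\<integral>\<^sup>+y. ennreal (f y) \<partial>lborel))"
    by (simp add: nn_integral_cmult)
  also have "\<dots> \<le> c * (ennreal C * F)"
    using F by (intro mult_left_mono) auto
  finally show ?thesis .
qed

lemma abs_heat_potential_le:
  assumes "f \<in> borel_measurable borel" "s \<le> e" "0 \<le> C" "0 \<le> F" "\<And>y. 0 \<le> f y"
    and h: "\<And>r y. s < r \<Longrightarrow> r < e \<Longrightarrow> \<bar>h r y\<bar> \<le> f y * C"
    and F: "(\<integral>\<^sup>+y. ennreal (f y) \<partial>lborel) \<le> ennreal F"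
  shows "\<bar>heat_potential s e h x\<bar> \<le> sqrt (e - s) * (C * F)"
proof -
  have "ennreal \<bar>heat_potential s e h x\<bar> \<le> (\<integral>\<^sup>+(r, y). ennreal \<bar>indicator {s<..<e} r * heat (r - s) (y - x) * h r y\<bar> \<partial>lborel)"
    unfolding heat_potential_def by (rule order_trans[OF ennreal_abs_integral_le]) (simp add: split_beta')
  also have "\<dots> \<le> ennreal (sqrt (e - s)) * (ennreal C * ennreal F)"
    by (rule nn_integral_heat_weight_le[where f=f])
      (use assms nn_integral_heat_time_le[OF assms(2)] in \<open>auto simp: heat_minus_commute\<close>)
  also have "\<dots> = ennreal (sqrt (e - s) * (C * F))"
    using assms by (simp add: ennreal_mult)
  finally show ?thesis using assms by simp
qed

text \<open>The weight is now a difference of kernels with time integral at most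
  \<open>2 * \<bar>x - x'\<bar>\<close>. The uniform bound \<open>D\<close> allows the two
  potentials to be subtracted under the integral; the Lipschitz constant involves only
  \<open>C * F\<close>.\<close>

lemma abs_heat_potential_diff_le:
  assumes m: "(\<lambda>(r, y). h r y) \<in> borel_measurable (borel \<Otimes>\<^sub>M borel)"
    and b: "\<And>r y. s < r \<Longrightarrow> r < e \<Longrightarrow> \<bar>h r y\<bar> \<le> D"
    and f: "f \<in> borel_measurable borel" "0 \<le> C" "0 \<le> F" "\<And>y. 0 \<le> f y"
    and h: "\<And>r y. s < r \<Longrightarrow> r < e \<Longrightarrow> \<bar>h r y\<bar> \<le> f y * C"
    and F: "(\<integral>\<^sup>+y. ennreal (f y) \<partial>lborel) \<le> ennreal F"
  shows "\<bar>heat_potential s e h x - heat_potential s e h x'\<bar> \<le> 2 * \<bar>x - x'\<bar> * (C * F)"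
proof -
  have "heat_potential s e h x - heat_potential s e h x' =
    (LINT (r, y)|lborel. indicator {s<..<e} r * (heat (r - s) (y - x) - heat (r - s) (y - x')) * h r y)"
    unfolding heat_potential_def
    by (subst Bochner_Integration.integral_diff[symmetric, OF integrable_heat_potential[OF m b] integrable_heat_potential[OF m b]])
      (auto intro!: Bochner_Integration.integral_cong simp: algebra_simps)
  then have "ennreal \<bar>heat_potential s e h x - heat_potential s e h x'\<bar> \<le>
     (\<integral>\<^sup>+(r, y). ennreal \<bar>indicator {s<..<e} r * (heat (r - s) (y - x) - heat (r - s) (y - x')) * h r y\<bar> \<partial>lborel)"
    by (simp only:) (rule order_trans[OF ennreal_abs_integral_le], simp add: split_beta')
  also have "\<dots> \<le> ennreal (2 * \<bar>x - x'\<bar>) * (ennreal C * ennreal F)"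
  proof (rule nn_integral_heat_weight_le[where f=f])
    fix y
    show "(\<integral>\<^sup>+r. ennreal \<bar>heat (r - s) (y - x) - heat (r - s) (y - x')\<bar> * indicator {s<..<e} r \<partial>lborel) \<le> ennreal (2 * \<bar>x - x'\<bar>)"
      using nn_integral_heat_time_diff_le[of s "y - x" "y - x'" e] by (simp add: abs_minus_commute)
  qed (use assms in auto)
  also have "\<dots> = ennreal (2 * \<bar>x - x'\<bar> * (C * F))"
    using assms by (simp add: ennreal_mult)
  finally show ?thesis using assms by simp
qed

lemma integral_lborel_shift_snd:
  fixes f :: "real \<times> real \<Rightarrow> real"
  assumes [measurable]: "f \<in> borel_measurable borel"
  shows "(LINT p|lborel. f p) = (LINT p|lborel. f (fst p, snd p - d))"
proof -
  have "(LINT p|lborel. f p) = (LINT p|distr lborel borel ((+) (0, - d)). f p)"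
    by (simp add: lborel_distr_plus)
  also have "\<dots> = (LINT p|lborel. f ((0, - d) + p))"
    by (rule integral_distr) auto
  also have "\<dots> = (LINT p|lborel. f (fst p, snd p - d))"
    by (intro Bochner_Integration.integral_cong refl arg_cong[where f=f]) (auto simp: prod_eq_iff)
  finally show ?thesis .
qed

text \<open>After a translation of the second half, the potential of \<open>(f - f (\<cdot> + d)) v\<close> only involves
  increments of the heat kernel and of \<open>v\<close> over the distance \<open>d\<close>.\<close>

lemma abs_heat_potential_dipole_le:
  assumes v: "(\<lambda>(r, y). v r y) \<in> borel_measurable (borel \<Otimes>\<^sub>M borel)"
    and f: "f \<in> borel_measurable borel" "\<And>y. 0 \<le> f y" "\<And>y. f y \<le> B"
    and F: "(\<integral>\<^sup>+y. ennreal (f y) \<partial>lborel) \<le> 1"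
    and V: "\<And>r y. s < r \<Longrightarrow> r < e \<Longrightarrow> \<bar>v r y\<bar> \<le> V" "0 \<le> V"
    and \<Lambda>: "\<And>r y y'. s < r \<Longrightarrow> r < e \<Longrightarrow> \<bar>v r y - v r y'\<bar> \<le> \<Lambda> * \<bar>y - y'\<bar>" "0 \<le> \<Lambda>"
    and "s \<le> e"
  shows "\<bar>heat_potential s e (\<lambda>r y. (f y - f (y + d)) * v r y) x\<bar> \<le> 2 * \<bar>d\<bar> * V + sqrt (e - s) * (\<Lambda> * \<bar>d\<bar>)"
proof -
  have [measurable]: "(\<lambda>(r, y). v r y) \<in> borel_measurable (borel \<Otimes>\<^sub>M borel)" "f \<in> borel_measurable borel" by fact+
  have B: "0 \<le> B" using f(2)[of 0] f(3)[of 0] by simp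
  let ?i = "\<lambda>r. indicator {s<..<e} r :: real"
  have m1: "(\<lambda>(r, y). f y * v r y) \<in> borel_measurable (borel \<Otimes>\<^sub>M borel)" by measurable
  have m2: "(\<lambda>(r, y). f (y + d) * v r y) \<in> borel_measurable (borel \<Otimes>\<^sub>M borel)" by measurable
  have m3: "(\<lambda>(r, y). f y * v r (y - d)) \<in> borel_measurable (borel \<Otimes>\<^sub>M borel)" by measurable
  have b: "\<bar>f z * v r y\<bar> \<le> B * V" if "s < r" "r < e" for r y z
    using f V that B by (auto simp: abs_mult intro!: mult_mono)
  note i1 = integrable_heat_potential[OF m1 b] and i2 = integrable_heat_potential[OF m2 b]
    and i3 = integrable_heat_potential[OF m3 b]
  have "heat_potential s e (\<lambda>r y. (f y - f (y + d)) * v r y) x =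
     heat_potential s e (\<lambda>r y. f y * v r y) x - heat_potential s e (\<lambda>r y. f (y + d) * v r y) x"
    unfolding heat_potential_def
    by (subst Bochner_Integration.integral_diff[symmetric, OF i1 i2])
      (auto intro!: Bochner_Integration.integral_cong simp: algebra_simps)
  also have "heat_potential s e (\<lambda>r y. f (y + d) * v r y) x =
      heat_potential s e (\<lambda>r y. f y * v r (y - d)) (x + d)"
  proof -
    have "(\<lambda>(r, y). ?i r * heat (r - s) (y - x) * (f (y + d) * v r y)) \<in> borel_measurable (borel \<Otimes>\<^sub>M borel)"
      by measurable
    then show ?thesis unfolding heat_potential_def
      by (subst integral_lborel_shift_snd[where d=d])
        (auto simp: measurable_borel_pair_iff split_beta' algebra_simps)
  qed
  \<comment> \<open>The comparison is made at the common start \<open>x\<close> and the start is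
    moved afterwards. The former costs an increment of \<open>v\<close>, the latter an increment of
    the heat kernel.\<close>
  also have "heat_potential s e (\<lambda>r y. f y * v r (y - d)) (x + d) =
     heat_potential s e (\<lambda>r y. f y * v r (y - d)) x -
      (heat_potential s e (\<lambda>r y. f y * v r (y - d)) x - heat_potential s e (\<lambda>r y. f y * v r (y - d)) (x + d))"
    by simp
  also have "heat_potential s e (\<lambda>r y. f y * v r y) x - \<dots> =
     heat_potential s e (\<lambda>r y. f y * (v r y - v r (y - d))) x +
      (heat_potential s e (\<lambda>r y. f y * v r (y - d)) x - heat_potential s e (\<lambda>r y. f y * v r (y - d)) (x + d))"
  proof -
    have "heat_potential s e (\<lambda>r y. f y * (v r y - v r (y - d))) x =
      heat_potential s e (\<lambda>r y. f y * v r y) x - heat_potential s e (\<lambda>r y. f y * v r (y - d)) x"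
      unfolding heat_potential_def
      by (subst Bochner_Integration.integral_diff[symmetric, OF i1 i3])
        (auto intro!: Bochner_Integration.integral_cong simp: algebra_simps)
    then show ?thesis by simp
  qed
  also have "\<bar>\<dots>\<bar> \<le> sqrt (e - s) * ((\<Lambda> * \<bar>d\<bar>) * 1) + 2 * \<bar>x - (x + d)\<bar> * (V * 1)"
  proof (rule order_trans[OF abs_triangle_ineq], rule add_mono)
    show "\<bar>heat_potential s e (\<lambda>r y. f y * (v r y - v r (y - d))) x\<bar> \<le> sqrt (e - s) * ((\<Lambda> * \<bar>d\<bar>) * 1)"
    proof (rule abs_heat_potential_le[where f=f])
      fix r y assume "s < r" "r < e"
      then show "\<bar>f y * (v r y - v r (y - d))\<bar> \<le> f y * (\<Lambda> * \<bar>d\<bar>)"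
        using \<Lambda>(1)[of r y "y - d"] f by (auto simp: abs_mult intro!: mult_left_mono)
    qed (use assms in auto)
    show "\<bar>heat_potential s e (\<lambda>r y. f y * v r (y - d)) x - heat_potential s e (\<lambda>r y. f y * v r (y - d)) (x + d)\<bar>
       \<le> 2 * \<bar>x - (x + d)\<bar> * (V * 1)"
    proof (rule abs_heat_potential_diff_le[where f=f, OF m3 b])
      fix r y assume "s < r" "r < e"
      then show "\<bar>f y * v r (y - d)\<bar> \<le> f y * V"
        using V f by (auto simp: abs_mult intro!: mult_left_mono)
    qed (use assms in auto)
  qed
  also have "\<dots> = 2 * \<bar>d\<bar> * V + sqrt (e - s) * (\<Lambda> * \<bar>d\<bar>)" by simp
  finally show ?thesis .
qed

subsection \<open>Moments of occupation times\<close>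

context wiener_measure
begin

sublocale pair: pair_prob_space \<mu> \<mu> ..

text \<open>The time is clipped to \<open>[0,T]\<close>, which makes the evaluation jointly measurable and continuous
  in time on the whole real line.\<close>

definition path_at :: "real \<Rightarrow> (real \<Rightarrow> real) \<Rightarrow> real" where
  "path_at u w = w (max 0 (min T u))"

lemma path_at_eq [simp]: "0 \<le> u \<Longrightarrow> u \<le> T \<Longrightarrow> path_at u w = w u"
  by (simp add: path_at_def)

lemma space_wiener: "space \<mu> = space (path_space T)"
  by (rule sets_eq_imp_space_eq[OF sets_wiener])

lemma continuous_on_path_at:
  assumes "w \<in> space \<mu>"
  shows "continuous_on A (\<lambda>u. path_at u w)"
proof -
  have "continuous_on {0..T} w" using assms by (simp add: space_wiener space_path_space)
  then show ?thesis unfolding path_at_def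
    by (rule continuous_on_compose2) (use T_pos in \<open>auto intro!: continuous_intros\<close>)
qed

lemma measurable_eval: "t \<in> {0..T} \<Longrightarrow> (\<lambda>w. w t) \<in> borel_measurable \<mu>"
  using measurable_path_eval[of t T] by measurable

text \<open>Rounding the time down to a multiple of \<open>1 / (n + 1)\<close> gives maps with
  countably many time values, which are measurable; continuity of the paths gives convergence to the
  evaluation.\<close>

lemma measurable_path_at_pair: "(\<lambda>p. path_at (fst p) (snd p)) \<in> borel_measurable (borel \<Otimes>\<^sub>M \<mu>)"
proof (rule borel_measurable_LIMSEQ_real)
  fix n :: nat
  show "(\<lambda>p. path_at (real_of_int \<lfloor>real (Suc n) * fst p\<rfloor> / real (Suc n)) (snd p)) \<in> borel_measurable (borel \<Otimes>\<^sub>M \<mu>)"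
  proof (rule measurable_compose_countable[where g="\<lambda>p. \<lfloor>real (Suc n) * fst p\<rfloor>"])
    show "(\<lambda>p. path_at (real_of_int i / real (Suc n)) (snd p)) \<in> borel_measurable (borel \<Otimes>\<^sub>M \<mu>)" for i
      unfolding path_at_def
      by (rule measurable_compose[OF measurable_snd measurable_eval]) (use T_pos in auto)
  qed measurable
next
  fix p :: "real \<times> (real \<Rightarrow> real)"
  assume "p \<in> space (borel \<Otimes>\<^sub>M \<mu>)"
  then have w: "snd p \<in> space \<mu>" by (auto simp: space_pair_measure)
  have "(\<lambda>n. real_of_int \<lfloor>real (Suc n) * fst p\<rfloor> / real (Suc n)) \<longlonglongrightarrow> fst p"
  proof (rule real_tendsto_sandwich)
    have "(\<lambda>n. fst p - 1 / real (Suc n)) \<longlonglongrightarrow> fst p - 0"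
      by (intro tendsto_intros LIMSEQ_Suc lim_1_over_n)
    then show "(\<lambda>n. fst p - 1 / real (Suc n)) \<longlonglongrightarrow> fst p" by simp
    show "\<forall>\<^sub>F n in sequentially. fst p - 1 / real (Suc n) \<le> real_of_int \<lfloor>real (Suc n) * fst p\<rfloor> / real (Suc n)"
    proof (rule always_eventually, rule allI)
      fix n
      have "real (Suc n) * fst p - 1 \<le> real_of_int \<lfloor>real (Suc n) * fst p\<rfloor>" by linarith
      then have "(real (Suc n) * fst p - 1) / real (Suc n) \<le> real_of_int \<lfloor>real (Suc n) * fst p\<rfloor> / real (Suc n)"
        by (intro divide_right_mono) auto
      then show "fst p - 1 / real (Suc n) \<le> real_of_int \<lfloor>real (Suc n) * fst p\<rfloor> / real (Suc n)"
        by (simp add: diff_divide_distrib del: of_nat_Suc)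
    qed
    show "\<forall>\<^sub>F n in sequentially. real_of_int \<lfloor>real (Suc n) * fst p\<rfloor> / real (Suc n) \<le> fst p"
    proof (rule always_eventually, rule allI)
      fix n
      have "real_of_int \<lfloor>real (Suc n) * fst p\<rfloor> / real (Suc n) \<le> (real (Suc n) * fst p) / real (Suc n)"
        by (intro divide_right_mono of_int_floor_le) auto
      then show "real_of_int \<lfloor>real (Suc n) * fst p\<rfloor> / real (Suc n) \<le> fst p" by (simp del: of_nat_Suc)
    qed
  qed auto
  then show "(\<lambda>n. path_at (real_of_int \<lfloor>real (Suc n) * fst p\<rfloor> / real (Suc n)) (snd p)) \<longlonglongrightarrow> path_at (fst p) (snd p)"
    by (rule continuous_on_tendsto_compose[OF continuous_on_path_at[OF w, of UNIV]]) auto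
qed

lemma measurable_path_at [measurable (raw)]:
  assumes "f \<in> borel_measurable N" "g \<in> measurable N \<mu>"
  shows "(\<lambda>x. path_at (f x) (g x)) \<in> borel_measurable N"
  using measurable_compose[OF measurable_Pair[OF assms] measurable_path_at_pair] by simp

text \<open>The path is restarted from \<open>x\<close> at time \<open>s\<close>, so only its
  increments after \<open>s\<close> enter and the starting point becomes a free variable, as the
  recursion in \<open>x\<close> requires.\<close>

definition occ :: "(real \<Rightarrow> real) \<Rightarrow> real \<Rightarrow> real \<Rightarrow> real \<Rightarrow> (real \<Rightarrow> real) \<Rightarrow> real" where
  "occ g s e x w = (LINT u|lborel. indicator {s<..<e} u * g (x + path_at u w - path_at s w))"

lemma measurable_occ [measurable (raw)]:
  assumes [measurable]: "g \<in> borel_measurable borel" "a \<in> borel_measurable N" "b \<in> borel_measurable N"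
    "c \<in> borel_measurable N" "d \<in> measurable N \<mu>"
  shows "(\<lambda>z. occ g (a z) (b z) (c z) (d z)) \<in> borel_measurable N"
  unfolding occ_def by measurable

lemma abs_occ_le:
  assumes B: "\<And>y. \<bar>g y\<bar> \<le> B" and "s \<le> e"
  shows "\<bar>occ g s e x w\<bar> \<le> B * (e - s)"
proof -
  have B0: "0 \<le> B" using B[of 0] by simp
  have "ennreal \<bar>occ g s e x w\<bar> \<le> (\<integral>\<^sup>+u. ennreal \<bar>indicator {s<..<e} u * g (x + path_at u w - path_at s w)\<bar> \<partial>lborel)"
    unfolding occ_def by (rule ennreal_abs_integral_le)
  also have "\<dots> \<le> (\<integral>\<^sup>+u. ennreal B * indicator {s<..<e} u \<partial>lborel)"
    using B by (intro nn_integral_mono) (auto simp: indicator_def intro!: ennreal_leI)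
  also have "\<dots> = ennreal (B * (e - s))"
    using assms B0 by (simp add: nn_integral_cmult ennreal_mult)
  finally show ?thesis using assms B0 by simp
qed

definition occ_moment :: "(real \<Rightarrow> real) \<Rightarrow> nat \<Rightarrow> real \<Rightarrow> real \<Rightarrow> real \<Rightarrow> real" where
  "occ_moment g m s e x = (LINT w|\<mu>. occ g s e x w ^ m)"

lemma measurable_occ_moment [measurable (raw)]:
  assumes [measurable]: "g \<in> borel_measurable borel" "a \<in> borel_measurable N" "b \<in> borel_measurable N"
    "c \<in> borel_measurable N"
  shows "(\<lambda>z. occ_moment g m (a z) (b z) (c z)) \<in> borel_measurable N"
  unfolding occ_moment_def by measurable

lemma abs_occ_moment_le:
  assumes [measurable]: "g \<in> borel_measurable borel" and B: "\<And>y. \<bar>g y\<bar> \<le> B" and "s \<le> e"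
  shows "\<bar>occ_moment g m s e x\<bar> \<le> (B * (e - s)) ^ m"
proof -
  have "ennreal \<bar>occ_moment g m s e x\<bar> \<le> (\<integral>\<^sup>+w. ennreal \<bar>occ g s e x w ^ m\<bar> \<partial>\<mu>)"
    unfolding occ_moment_def by (rule ennreal_abs_integral_le)
  also have "\<dots> \<le> (\<integral>\<^sup>+w. ennreal ((B * (e - s)) ^ m) \<partial>\<mu>)"
    using abs_occ_le[OF B assms(3)] by (intro nn_integral_mono ennreal_leI) (auto simp: power_abs intro!: power_mono)
  also have "\<dots> = ennreal ((B * (e - s)) ^ m)" by (simp add: emeasure_space_1)
  finally show ?thesis using assms(3) B[of 0] by simp
qed

lemma integral_splice:
  fixes f :: "(real \<Rightarrow> real) \<Rightarrow> real"
  assumes "f \<in> borel_measurable \<mu>" "0 \<le> a" "a \<le> b" "b \<le> T"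
  shows "(LINT w|\<mu>. f w) = (LINT p|(\<mu> \<Otimes>\<^sub>M \<mu>). f (path_splice T a b p))"
proof -
  have m: "path_splice T a b \<in> measurable (\<mu> \<Otimes>\<^sub>M \<mu>) (path_space T)"
    using measurable_splice[OF assms(2-4)] by measurable
  have "f \<in> borel_measurable (path_space T)" using assms(1) by measurable
  then show ?thesis
    using integral_distr[OF m, of f] distr_splice[OF assms(2-4)] by simp
qed

lemma nn_integral_splice:
  assumes "f \<in> borel_measurable \<mu>" "0 \<le> a" "a \<le> b" "b \<le> T"
  shows "(\<integral>\<^sup>+w. f w \<partial>\<mu>) = (\<integral>\<^sup>+p. f (path_splice T a b p) \<partial>(\<mu> \<Otimes>\<^sub>M \<mu>))"
proof -
  have m: "path_splice T a b \<in> measurable (\<mu> \<Otimes>\<^sub>M \<mu>) (path_space T)"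
    using measurable_splice[OF assms(2-4)] by measurable
  have "f \<in> borel_measurable (path_space T)" using assms(1) by measurable
  then show ?thesis
    using nn_integral_distr[OF m, of f] distr_splice[OF assms(2-4)] by simp
qed

lemma path_at_splice:
  assumes "0 \<le> a" "a \<le> b" "b \<le> T"
  shows "u \<le> a \<Longrightarrow> path_at u (path_splice T a b (w, w')) = path_at u w"
    and "a \<le> u \<Longrightarrow> u \<le> b \<Longrightarrow> path_at u (path_splice T a b (w, w')) = w a + (path_at u w' - w' a)"
    and "b \<le> u \<Longrightarrow> path_at u (path_splice T a b (w, w')) = w a + (w' b - w' a) + (path_at u w - w b)"
proof -
  have c: "max 0 (min T u) \<in> {0..T}" using T_pos by auto
  note s = splice_apply[OF assms c, of w w']
  show "u \<le> a \<Longrightarrow> path_at u (path_splice T a b (w, w')) = path_at u w"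
    "a \<le> u \<Longrightarrow> u \<le> b \<Longrightarrow> path_at u (path_splice T a b (w, w')) = w a + (path_at u w' - w' a)"
    "b \<le> u \<Longrightarrow> path_at u (path_splice T a b (w, w')) = w a + (w' b - w' a) + (path_at u w - w b)"
    using assms unfolding path_at_def s by (auto simp: min_def max_def) (metis order.antisym order.trans)+
qed

text \<open>Clipping the time at \<open>T\<close> makes the formula valid for every
  \<open>u \<ge> a\<close>, so that integrands over the whole line can be rewritten without an upper
  bound on \<open>u\<close>.\<close>

lemma path_at_splice_end:
  assumes "0 \<le> a" "a \<le> T" "a \<le> u"
  shows "path_at u (path_splice T a T (w, w')) = w a + (path_at u w' - w' a)"
proof (cases "u \<le> T")
  case True
  then show ?thesis using path_at_splice(2)[of a T u w w'] assms by simp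
next
  case False
  then have "path_at u v = path_at T v" for v using T_pos by (simp add: path_at_def)
  then show ?thesis using path_at_splice(2)[of a T T w w'] assms by simp
qed

lemma integral_increment:
  fixes G :: "real \<Rightarrow> real"
  assumes [measurable]: "G \<in> borel_measurable borel" and "0 \<le> s" "s < r" "r \<le> T"
  shows "(LINT w|\<mu>. G (x + w r - w s)) = (LINT y|lborel. heat (r - s) (y - x) * G y)"
proof -
  have "(\<lambda>w. w r - w s) \<in> borel_measurable \<mu>"
    using assms by (intro borel_measurable_diff measurable_eval) auto
  then have "(LINT w|\<mu>. G (x + (w r - w s))) = (LINT z|distr \<mu> borel (\<lambda>w. w r - w s). G (x + z))"
    by (subst integral_distr) auto
  also have "\<dots> = (LINT z|lborel. heat (r - s) z * G (x + z))"
    unfolding distr_increment[OF assms(2-4)] gaussian_def heat_def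
    by (subst integral_density) auto
  also have "\<dots> = (LINT y|lborel. heat (r - s) (y - x) * G y)"
    using lborel_integral_real_affine[of 1 "\<lambda>y. heat (r - s) (y - x) * G y" x] by simp
  finally show ?thesis by (simp add: algebra_simps)
qed

text \<open>Kac's moment formula. \<open>integral_Ioo_power\<close> along each path isolates the
  earliest visit time \<open>r\<close>; Fubini moves the expectation inside, and the Markov property
  at \<open>r\<close> replaces the remaining power by its expectation, a function of the position at
  \<open>r\<close>. That position has a Gaussian law around \<open>x\<close>, which yields the heat
  kernel.\<close>

lemma occ_moment_Suc:
  assumes g [measurable]: "g \<in> borel_measurable borel" and B: "\<And>y. \<bar>g y\<bar> \<le> B"
    and se: "0 \<le> s" "s \<le> e" "e \<le> T"
  shows "occ_moment g (Suc m) s e x =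
    real (Suc m) * heat_potential s e (\<lambda>r y. g y * occ_moment g m r e y) x"
proof -
  interpret L\<mu>: pair_sigma_finite lborel \<mu> ..
  have B0: "0 \<le> B" using B[of 0] by simp
  define Y where "Y r w = x + path_at r w - path_at s w" for r w
  define \<Psi> where "\<Psi> r w = g (Y r w) * occ g r e (Y r w) w ^ m" for r w
  define C where "C = B * (B * (e - s)) ^ m"
  have \<Psi>b: "\<bar>\<Psi> r w\<bar> \<le> C" if "s < r" "r < e" for r w
  proof -
    have "\<bar>occ g r e (Y r w) w\<bar> \<le> B * (e - s)"
      by (rule order_trans[OF abs_occ_le[of g B]]) (use B B0 that in \<open>auto intro!: mult_left_mono\<close>)
    then have "\<bar>occ g r e (Y r w) w\<bar> ^ m \<le> (B * (e - s)) ^ m" by (intro power_mono) auto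
    then show ?thesis using B[of "Y r w"] B0 by (auto simp: \<Psi>_def C_def abs_mult power_abs intro!: mult_mono)
  qed
  have pw: "occ g s e x w ^ Suc m = real (Suc m) * (LINT r|lborel. indicator {s<..<e} r * \<Psi> r w)"
    if w: "w \<in> space \<mu>" for w
  proof -
    have [measurable]: "(\<lambda>u. path_at u w) \<in> borel_measurable borel"
      using continuous_on_path_at[OF w] by (rule borel_measurable_continuous_onI)
    have i: "integrable lborel (\<lambda>r. indicator {s<..<e} r * g (Y r w))"
      unfolding Y_def by (rule integrable_indicator_Ioo_bounded) (use B in auto)
    have "Y r w + path_at u w - path_at r w = Y u w" for r u by (simp add: Y_def)
    then have o: "occ g r e (Y r w) w = (LINT u|lborel. indicator {r<..<e} u * g (Y u w))" for r
      by (simp add: occ_def)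
    have "occ g s e x w = (LINT u|lborel. indicator {s<..<e} u * g (Y u w))"
      by (simp add: occ_def Y_def)
    then show ?thesis
      using integral_Ioo_power[OF i, of m] unfolding \<Psi>_def o by (simp only: simp_thms)
  qed
  have int: "integrable (lborel \<Otimes>\<^sub>M \<mu>) (\<lambda>(r, w). indicator {s<..<e} r * \<Psi> r w)"
  proof (rule integrableI_bounded_set[where A="{s<..<e} \<times> space \<mu>" and B=C])
    show "{s<..<e} \<times> space \<mu> \<in> sets (lborel \<Otimes>\<^sub>M \<mu>)" by measurable
    show "(\<lambda>(r, w). indicator {s<..<e} r * \<Psi> r w) \<in> borel_measurable (lborel \<Otimes>\<^sub>M \<mu>)"
      unfolding \<Psi>_def Y_def by measurable
    have "emeasure (lborel \<Otimes>\<^sub>M \<mu>) ({s<..<e} \<times> space \<mu>) = ennreal (e - s)"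
      using se by (subst emeasure_pair_measure_Times) (auto simp: emeasure_space_1)
    then show "emeasure (lborel \<Otimes>\<^sub>M \<mu>) ({s<..<e} \<times> space \<mu>) < \<infinity>" by simp
  qed (use \<Psi>b in \<open>auto intro!: AE_I2 simp: space_pair_measure indicator_def split: if_splits\<close>)
  have "occ_moment g (Suc m) s e x = (LINT w|\<mu>. real (Suc m) * (LINT r|lborel. indicator {s<..<e} r * \<Psi> r w))"
    unfolding occ_moment_def by (intro Bochner_Integration.integral_cong refl pw)
  also have "\<dots> = real (Suc m) * (LINT r|lborel. LINT w|\<mu>. indicator {s<..<e} r * \<Psi> r w)"
    using L\<mu>.Fubini_integral[OF int] by simp
  also have "(LINT r|lborel. LINT w|\<mu>. indicator {s<..<e} r * \<Psi> r w) =
    (LINT r|lborel. LINT y|lborel. indicator {s<..<e} r * heat (r - s) (y - x) * (g y * occ_moment g m r e y))"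
  proof (intro Bochner_Integration.integral_cong refl)
    fix r
    show "(LINT w|\<mu>. indicator {s<..<e} r * \<Psi> r w) =
      (LINT y|lborel. indicator {s<..<e} r * heat (r - s) (y - x) * (g y * occ_moment g m r e y))"
    proof (cases "r \<in> {s<..<e}")
      case True
      then have r: "0 \<le> r" "r \<le> T" "s < r" "r < e" using se by auto
      have [measurable]: "\<Psi> r \<in> borel_measurable \<mu>" unfolding \<Psi>_def Y_def by measurable
      have mspl: "path_splice T r T \<in> measurable (\<mu> \<Otimes>\<^sub>M \<mu>) \<mu>"
        using measurable_splice[OF r(1,2) order_refl] by measurable
      \<comment> \<open>Splicing on \<open>(r,T]\<close> keeps the position at \<open>r\<close> from
        the first path and takes every later increment from the second, independent one; this is the
        form in which the Markov property is used.\<close>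
      have spl: "\<Psi> r (path_splice T r T (w, w')) = g (Y r w) * occ g r e (Y r w) w' ^ m" for w w'
      proof -
        have Ys: "Y r (path_splice T r T (w, w')) = Y r w"
          using r se path_at_splice(1)[OF r(1,2) order_refl, of s w w'] path_at_splice_end[OF r(1,2) order_refl, of w w']
          by (simp add: Y_def)
        have "occ g r e y (path_splice T r T (w, w')) = occ g r e y w'" for y
          unfolding occ_def
        proof (intro Bochner_Integration.integral_cong refl)
          fix u
          show "indicator {r<..<e} u * g (y + path_at u (path_splice T r T (w, w')) - path_at r (path_splice T r T (w, w'))) =
              indicator {r<..<e} u * g (y + path_at u w' - path_at r w')"
          proof (cases "r < u")
            case ru: True
            then have "y + path_at u (path_splice T r T (w, w')) - path_at r (path_splice T r T (w, w')) = y + path_at u w' - path_at r w'"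
              using path_at_splice_end[OF r(1,2), of u w w'] path_at_splice_end[OF r(1,2) order_refl, of w w'] r by simp
            then show ?thesis by (simp only:)
          qed simp
        qed
        then show ?thesis by (simp add: \<Psi>_def Ys)
      qed
      have intp: "integrable (\<mu> \<Otimes>\<^sub>M \<mu>) (\<lambda>(w, w'). g (Y r w) * occ g r e (Y r w) w' ^ m)"
      proof (rule pair.P.integrable_const_bound[where B=C])
        show "AE p in \<mu> \<Otimes>\<^sub>M \<mu>. norm (case p of (w, w') \<Rightarrow> g (Y r w) * occ g r e (Y r w) w' ^ m) \<le> C"
          using \<Psi>b[OF r(3,4)] unfolding spl[symmetric] by (auto intro!: AE_I2)
        show "(\<lambda>(w, w'). g (Y r w) * occ g r e (Y r w) w' ^ m) \<in> borel_measurable (\<mu> \<Otimes>\<^sub>M \<mu>)"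
          unfolding Y_def by measurable
      qed
      have "(LINT w|\<mu>. \<Psi> r w) = (LINT p|(\<mu> \<Otimes>\<^sub>M \<mu>). \<Psi> r (path_splice T r T p))"
        using r by (intro integral_splice) auto
      also have "\<dots> = (LINT p|(\<mu> \<Otimes>\<^sub>M \<mu>). (case p of (w, w') \<Rightarrow> g (Y r w) * occ g r e (Y r w) w' ^ m))"
        by (intro Bochner_Integration.integral_cong refl) (auto simp: spl)
      also have "\<dots> = (LINT w|\<mu>. LINT w'|\<mu>. g (Y r w) * occ g r e (Y r w) w' ^ m)"
        using pair.integral_fst'[OF intp] by simp
      also have "\<dots> = (LINT w|\<mu>. g (Y r w) * occ_moment g m r e (Y r w))"
        by (simp add: occ_moment_def)
      also have "\<dots> = (LINT w|\<mu>. g (x + w r - w s) * occ_moment g m r e (x + w r - w s))"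
        using r se by (simp add: Y_def)
      also have "\<dots> = (LINT y|lborel. heat (r - s) (y - x) * (g y * occ_moment g m r e y))"
        using r se by (intro integral_increment[of "\<lambda>y. g y * occ_moment g m r e y"]) auto
      finally show ?thesis using True by simp
    qed simp
  qed
  also have "\<dots> = heat_potential s e (\<lambda>r y. g y * occ_moment g m r e y) x"
  proof -
    have "integrable lborel (\<lambda>(r, y). indicator {s<..<e} r * heat (r - s) (y - x) * (g y * occ_moment g m r e y))"
    proof (rule integrable_heat_potential)
      show "(\<lambda>(r, y). g y * occ_moment g m r e y) \<in> borel_measurable (borel \<Otimes>\<^sub>M borel)" by measurable
      fix r y assume r: "s < r" "r < e"
      have "\<bar>occ_moment g m r e y\<bar> \<le> (B * (e - r)) ^ m" using r B by (intro abs_occ_moment_le) auto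
      also have "\<dots> \<le> (B * (e - s)) ^ m" using r B0 by (intro power_mono mult_left_mono) auto
      finally show "\<bar>g y * occ_moment g m r e y\<bar> \<le> C" using B[of y] B0
        by (auto simp: C_def abs_mult intro!: mult_mono)
    qed
    then have "integrable (lborel \<Otimes>\<^sub>M lborel) (\<lambda>(r, y). indicator {s<..<e} r * heat (r - s) (y - x) * (g y * occ_moment g m r e y))"
      by (simp add: lborel_prod)
    from lborel_pair.integral_fst'[OF this] show ?thesis
      unfolding heat_potential_def by (simp add: lborel_prod)
  qed
  finally show ?thesis .
qed

lemma occ_moment_0 [simp]: "occ_moment g 0 s e x = 1"
  by (simp add: occ_moment_def prob_space)

text \<open>Each application of the recursion contributes \<open>Suc m\<close> and, by the time
  integral of the kernel, a factor \<open>sqrt (e - s)\<close>; the mass of \<open>f\<close> is at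
  most 1.\<close>

lemma abs_occ_moment_nonneg_le:
  assumes f [measurable]: "f \<in> borel_measurable borel" and f0: "\<And>y. 0 \<le> f y" and fB: "\<And>y. f y \<le> B"
    and F: "(\<integral>\<^sup>+y. ennreal (f y) \<partial>lborel) \<le> 1"
    and "0 \<le> s" "s \<le> e" "e \<le> T"
  shows "\<bar>occ_moment f m s e x\<bar> \<le> fact m * sqrt (e - s) ^ m"
  using assms(5-7)
proof (induction m arbitrary: s x)
  case (Suc m)
  have "\<bar>heat_potential s e (\<lambda>r y. f y * occ_moment f m r e y) x\<bar> \<le> sqrt (e - s) * ((fact m * sqrt (e - s) ^ m) * 1)"
  proof (rule abs_heat_potential_le[where f=f])
    fix r y assume r: "s < r" "r < e"
    then have "\<bar>occ_moment f m r e y\<bar> \<le> fact m * sqrt (e - r) ^ m" using Suc by auto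
    also have "\<dots> \<le> fact m * sqrt (e - s) ^ m" using r by (intro mult_left_mono power_mono) auto
    finally show "\<bar>f y * occ_moment f m r e y\<bar> \<le> f y * (fact m * sqrt (e - s) ^ m)"
      using f0 by (auto simp: abs_mult intro!: mult_left_mono)
  qed (use Suc.prems F f0 in auto)
  then have "real (Suc m) * \<bar>heat_potential s e (\<lambda>r y. f y * occ_moment f m r e y) x\<bar> \<le>
     real (Suc m) * (sqrt (e - s) * ((fact m * sqrt (e - s) ^ m) * 1))"
    by (intro mult_left_mono) auto
  then show ?case
    using Suc.prems f0 fB
    by (subst occ_moment_Suc[where B=B]) (auto simp: abs_mult mult_ac abs_of_nonneg simp del: of_nat_Suc)
qed simp

text \<open>The odd moment \<open>v\<close> between two even ones need not be small, but it is
  bounded by a multiple of \<open>D\<close> and Lipschitz with constant a multiple of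
  \<open>D\<close>, being a potential of the even moment.
  \<open>abs_heat_potential_dipole_le\<close> converts both facts into a factor
  \<open>\<bar>d\<bar>\<close> at the next step.\<close>

lemma abs_occ_moment_dipole_le:
  fixes f :: "real \<Rightarrow> real" and d :: real
  assumes f [measurable]: "f \<in> borel_measurable borel" and f0: "\<And>y. 0 \<le> f y" and fB: "\<And>y. f y \<le> B"
    and F: "(\<integral>\<^sup>+y. ennreal (f y) \<partial>lborel) \<le> 1"
    and "0 \<le> s" "s \<le> e" "e \<le> T"
  defines "g \<equiv> \<lambda>y. f y - f (y + d)"
  shows "\<bar>occ_moment g (2 * n) s e x\<bar> \<le> fact (2 * n) * (8 * sqrt T * \<bar>d\<bar>) ^ n"
  using assms(5-7)
proof (induction n arbitrary: s x)
  case (Suc n)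
  define D where "D = fact (2 * n) * (8 * sqrt T * \<bar>d\<bar>) ^ n"
  have D0: "0 \<le> D" using T_pos by (simp add: D_def)
  have gB: "\<bar>g y\<bar> \<le> B" for y
    using f0[of y] fB[of y] f0[of "y + d"] fB[of "y + d"] by (auto simp: g_def)
  have B0: "0 \<le> B" using f0[of 0] fB[of 0] by simp
  have [measurable]: "g \<in> borel_measurable borel" unfolding g_def by measurable
  \<comment> \<open>For the first of the two steps the dipole is replaced by this majorant of mass
    2; its cancellation is used in the second step only.\<close>
  let ?f = "\<lambda>y. f y + f (y + d)"
  have gf: "\<bar>g y\<bar> \<le> ?f y" for y using f0[of y] f0[of "y + d"] by (auto simp: g_def)
  have F2: "(\<integral>\<^sup>+y. ennreal (?f y) \<partial>lborel) \<le> ennreal 2"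
  proof -
    have "(\<integral>\<^sup>+y. ennreal (?f y) \<partial>lborel) = (\<integral>\<^sup>+y. ennreal (f y) \<partial>lborel) + (\<integral>\<^sup>+y. ennreal (f (y + d)) \<partial>lborel)"
      using f0 by (simp add: nn_integral_add)
    also have "(\<integral>\<^sup>+y. ennreal (f (y + d)) \<partial>lborel) = (\<integral>\<^sup>+y. ennreal (f y) \<partial>lborel)"
      using nn_integral_translate[of "\<lambda>y. ennreal (f y)" "- d"] by simp
    also have "(\<integral>\<^sup>+y. ennreal (f y) \<partial>lborel) + (\<integral>\<^sup>+y. ennreal (f y) \<partial>lborel) \<le> 1 + 1"
      by (intro add_mono F)
    finally show ?thesis by simp
  qed
  define v where "v r y = occ_moment g (Suc (2 * n)) r e y" for r y
  have mD: "\<bar>occ_moment g (2 * n) r e y\<bar> \<le> D" if "s < r" "r < e" for r y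
    using Suc.IH[of r y] Suc.prems that by (simp add: D_def)
  have v_eq: "v r y = real (Suc (2 * n)) * heat_potential r e (\<lambda>q z. g z * occ_moment g (2 * n) q e z) y"
    if "s < r" "r < e" for r y
    unfolding v_def using that Suc.prems gB by (intro occ_moment_Suc) auto
  have bnd: "\<bar>g z * occ_moment g (2 * n) q e z\<bar> \<le> ?f z * D" if "s < r" "r < q" "q < e" for r q z
    using mD[of q z] gf[of z] D0 that by (auto simp: abs_mult intro!: mult_mono)
  have V: "\<bar>v r y\<bar> \<le> real (Suc (2 * n)) * (sqrt T * (D * 2))" if r: "s < r" "r < e" for r y
  proof -
    have "\<bar>heat_potential r e (\<lambda>q z. g z * occ_moment g (2 * n) q e z) y\<bar> \<le> sqrt (e - r) * (D * 2)"
      by (rule abs_heat_potential_le[where f="?f"]) (use bnd[OF r(1)] r F2 D0 f0 in auto)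
    also have "\<dots> \<le> sqrt T * (D * 2)" using Suc.prems r D0 by (intro mult_right_mono) auto
    finally show ?thesis unfolding v_eq[OF r] abs_mult by (intro mult_mono) auto
  qed
  have \<Lambda>: "\<bar>v r y - v r y'\<bar> \<le> (real (Suc (2 * n)) * (4 * D)) * \<bar>y - y'\<bar>" if r: "s < r" "r < e" for r y y'
  proof -
    have "\<bar>heat_potential r e (\<lambda>q z. g z * occ_moment g (2 * n) q e z) y -
        heat_potential r e (\<lambda>q z. g z * occ_moment g (2 * n) q e z) y'\<bar> \<le> 2 * \<bar>y - y'\<bar> * (D * 2)"
    proof (rule abs_heat_potential_diff_le[where f="?f" and D="B * D"])
      show "(\<lambda>(q, z). g z * occ_moment g (2 * n) q e z) \<in> borel_measurable (borel \<Otimes>\<^sub>M borel)" by measurable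
      fix q z assume "r < q" "q < e"
      then show "\<bar>g z * occ_moment g (2 * n) q e z\<bar> \<le> B * D"
        using mD[of q z] gB[of z] r D0 B0 by (auto simp: abs_mult intro!: mult_mono)
    qed (use bnd[OF r(1)] r F2 D0 f0 in auto)
    then have "real (Suc (2 * n)) * \<bar>heat_potential r e (\<lambda>q z. g z * occ_moment g (2 * n) q e z) y -
        heat_potential r e (\<lambda>q z. g z * occ_moment g (2 * n) q e z) y'\<bar> \<le> real (Suc (2 * n)) * (2 * \<bar>y - y'\<bar> * (D * 2))"
      by (intro mult_left_mono) auto
    then show ?thesis unfolding v_eq[OF r] right_diff_distrib[symmetric] abs_mult
      by (simp add: mult_ac del: of_nat_Suc)
  qed
  have mv: "(\<lambda>(r, y). v r y) \<in> borel_measurable (borel \<Otimes>\<^sub>M borel)" unfolding v_def by measurable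
  have "\<bar>heat_potential s e (\<lambda>r y. g y * v r y) x\<bar> \<le>
     2 * \<bar>d\<bar> * (real (Suc (2 * n)) * (sqrt T * (D * 2))) + sqrt (e - s) * ((real (Suc (2 * n)) * (4 * D)) * \<bar>d\<bar>)"
    unfolding g_def
    by (rule abs_heat_potential_dipole_le[OF mv f f0 fB F V _ \<Lambda>]) (use Suc.prems D0 T_pos in auto)
  also have "\<dots> \<le> 2 * \<bar>d\<bar> * (real (Suc (2 * n)) * (sqrt T * (D * 2))) + sqrt T * ((real (Suc (2 * n)) * (4 * D)) * \<bar>d\<bar>)"
    using Suc.prems D0 by (intro add_left_mono mult_right_mono) auto
  \<comment> \<open>The factor 8 collects 4 from the supremum of \<open>v\<close> and 4 from its
    Lipschitz constant.\<close>
  also have "\<dots> = real (Suc (2 * n)) * D * (8 * sqrt T * \<bar>d\<bar>)" by (simp add: algebra_simps)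
  finally have *: "\<bar>heat_potential s e (\<lambda>r y. g y * v r y) x\<bar> \<le> real (Suc (2 * n)) * D * (8 * sqrt T * \<bar>d\<bar>)" .
  have "occ_moment g (2 * Suc n) s e x = real (Suc (Suc (2 * n))) * heat_potential s e (\<lambda>r y. g y * v r y) x"
    using occ_moment_Suc[of g B s e "Suc (2 * n)" x] Suc.prems gB by (simp add: v_def del: of_nat_Suc)
  then have "\<bar>occ_moment g (2 * Suc n) s e x\<bar> \<le> real (Suc (Suc (2 * n))) * (real (Suc (2 * n)) * D * (8 * sqrt T * \<bar>d\<bar>))"
    using mult_left_mono[OF *, of "real (Suc (Suc (2 * n)))"] by (simp only: abs_mult abs_of_nat of_nat_0_le_iff)
  also have "\<dots> = fact (2 * Suc n) * (8 * sqrt T * \<bar>d\<bar>) ^ Suc n"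
    by (simp add: D_def algebra_simps)
  finally show ?case .
qed simp

end

section \<open>Interval densities and the sign of their dipole potential\<close>

definition window :: "real \<Rightarrow> real \<Rightarrow> real \<Rightarrow> real" where
  "window \<alpha> \<epsilon> y = indicator {\<alpha> - \<epsilon><..<\<alpha> + \<epsilon>} y / (2 * \<epsilon>)"

lemma measurable_window [measurable]: "window \<alpha> \<epsilon> \<in> borel_measurable borel"
  unfolding window_def by measurable

lemma window_nonneg: "0 < \<epsilon> \<Longrightarrow> 0 \<le> window \<alpha> \<epsilon> y"
  and window_le: "0 < \<epsilon> \<Longrightarrow> window \<alpha> \<epsilon> y \<le> 1 / (2 * \<epsilon>)"
  by (auto simp: window_def indicator_def)

lemma nn_integral_window: "0 < \<epsilon> \<Longrightarrow> (\<integral>\<^sup>+y. ennreal (window \<alpha> \<epsilon> y) \<partial>lborel) = 1"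
proof -
  assume "0 < \<epsilon>"
  then have "(\<integral>\<^sup>+y. ennreal (window \<alpha> \<epsilon> y) \<partial>lborel) = (\<integral>\<^sup>+y. ennreal (1 / (2 * \<epsilon>)) * indicator {\<alpha> - \<epsilon><..<\<alpha> + \<epsilon>} y \<partial>lborel)"
    by (intro nn_integral_cong) (auto simp: window_def indicator_def)
  also have "\<dots> = ennreal (1 / (2 * \<epsilon>)) * ennreal (2 * \<epsilon>)" using \<open>0 < \<epsilon>\<close> by (simp add: nn_integral_cmult)
  also have "\<dots> = 1" using \<open>0 < \<epsilon>\<close> by (simp add: ennreal_mult[symmetric] del: ennreal_mult'')
  finally show ?thesis .
qed

lemma nn_integral_strip_window:
  assumes "0 < \<epsilon>" "a \<le> b" "0 \<le> c"
  shows "(\<integral>\<^sup>+(r, y). ennreal (indicator {a<..<b} r * window \<alpha> \<epsilon> y * c) \<partial>lborel) = ennreal ((b - a) * c)"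
proof -
  have "(\<lambda>(r, y). ennreal (indicator {a<..<b} r * window \<alpha> \<epsilon> y * c)) \<in> borel_measurable (borel \<Otimes>\<^sub>M borel)"
    by measurable
  then have "(\<integral>\<^sup>+(r, y). ennreal (indicator {a<..<b} r * window \<alpha> \<epsilon> y * c) \<partial>lborel) =
     (\<integral>\<^sup>+r. \<integral>\<^sup>+y. ennreal (indicator {a<..<b} r * window \<alpha> \<epsilon> y * c) \<partial>lborel \<partial>lborel)"
    by (intro nn_integral_lborel_pair(1)) (simp add: measurable_borel_pair_iff)
  also have "\<dots> = (\<integral>\<^sup>+r. ennreal c * indicator {a<..<b} r \<partial>lborel)"
  proof (rule nn_integral_cong)
    fix r
    have "(\<integral>\<^sup>+y. ennreal (indicator {a<..<b} r * window \<alpha> \<epsilon> y * c) \<partial>lborel) =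
      (\<integral>\<^sup>+y. (ennreal c * indicator {a<..<b} r) * ennreal (window \<alpha> \<epsilon> y) \<partial>lborel)"
      using assms by (intro nn_integral_cong) (auto simp: indicator_def ennreal_mult[symmetric] window_nonneg mult.commute)
    also have "\<dots> = (ennreal c * indicator {a<..<b} r) * 1"
      by (subst nn_integral_cmult) (auto simp: nn_integral_window assms)
    finally show "(\<integral>\<^sup>+y. ennreal (indicator {a<..<b} r * window \<alpha> \<epsilon> y * c) \<partial>lborel) = ennreal c * indicator {a<..<b} r"
      by simp
  qed
  also have "\<dots> = ennreal ((b - a) * c)"
    using assms by (simp add: nn_integral_cmult ennreal_mult mult.commute)
  finally show ?thesis .
qed

text \<open>A nonnegative integrand is cut down to a strip in time and an interval in space. The
  density of the interval has mass 1, so the resulting bound is free of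
  \<open>\<epsilon>\<close>.\<close>

lemma integral_ge_strip_window:
  fixes F :: "real \<times> real \<Rightarrow> real"
  assumes F: "integrable lborel F" and "0 < \<epsilon>" "a \<le> b" "0 \<le> c"
    and le: "\<And>r y. indicator {a<..<b} r * window \<alpha> \<epsilon> y * c \<le> F (r, y)" and F0: "\<And>r y. 0 \<le> F (r, y)"
  shows "(b - a) * c \<le> (LINT p|lborel. F p)"
proof -
  have "ennreal ((b - a) * c) = (\<integral>\<^sup>+(r, y). ennreal (indicator {a<..<b} r * window \<alpha> \<epsilon> y * c) \<partial>lborel)"
    by (rule nn_integral_strip_window[OF assms(2-4), symmetric])
  also have "\<dots> \<le> (\<integral>\<^sup>+p. ennreal (F p) \<partial>lborel)"
    by (intro nn_integral_mono) (auto intro!: ennreal_leI le)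
  also have "\<dots> = ennreal (LINT p|lborel. F p)"
    using F0 by (intro nn_integral_eq_integral F) (auto intro!: AE_I2)
  finally show ?thesis
    using F0 by (subst (asm) ennreal_le_iff) (auto intro!: Bochner_Integration.integral_nonneg)
qed

text \<open>Translating the second half of the dipole puts a single density in front of the
  difference of two heat kernels, whose sign can be read off from the distances to the two
  poles.\<close>

lemma heat_potential_dipole_eq:
  assumes e: "0 < \<epsilon>"
  shows "heat_potential r t (\<lambda>q z. window \<alpha> \<epsilon> z - window \<alpha> \<epsilon> (z + d)) y =
      (LINT (q, z)|lborel. indicator {r<..<t} q * window \<alpha> \<epsilon> z * (heat (q - r) (z - y) - heat (q - r) (z - d - y)))"
    and "integrable lborel (\<lambda>(q, z). indicator {r<..<t} q * window \<alpha> \<epsilon> z * (heat (q - r) (z - y) - heat (q - r) (z - d - y)))"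
proof -
  let ?f = "window \<alpha> \<epsilon>"
  have b: "\<bar>?f z\<bar> \<le> 1 / (2 * \<epsilon>)" for z using window_nonneg[OF e] window_le[OF e] by (simp add: abs_of_nonneg)
  have m1: "(\<lambda>(q, z). ?f z) \<in> borel_measurable (borel \<Otimes>\<^sub>M borel)" by measurable
  have m2: "(\<lambda>(q, z). ?f (z + d)) \<in> borel_measurable (borel \<Otimes>\<^sub>M borel)" by measurable
  note i1 = integrable_heat_potential[OF m1 b] and i2 = integrable_heat_potential[OF m2 b]
  have "heat_potential r t (\<lambda>q z. ?f z - ?f (z + d)) y =
     heat_potential r t (\<lambda>q z. ?f z) y - heat_potential r t (\<lambda>q z. ?f (z + d)) y"
    unfolding heat_potential_def
    by (subst Bochner_Integration.integral_diff[symmetric, OF i1 i2])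
      (auto intro!: Bochner_Integration.integral_cong simp: algebra_simps)
  also have "heat_potential r t (\<lambda>q z. ?f (z + d)) y = heat_potential r t (\<lambda>q z. ?f z) (y + d)"
  proof -
    have "(\<lambda>(q, z). indicator {r<..<t} q * heat (q - r) (z - y) * ?f (z + d)) \<in> borel_measurable (borel \<Otimes>\<^sub>M borel)"
      by measurable
    then show ?thesis unfolding heat_potential_def
      by (subst integral_lborel_shift_snd[where d=d])
        (auto simp: measurable_borel_pair_iff split_beta' algebra_simps)
  qed
  also have "heat_potential r t (\<lambda>q z. ?f z) y - heat_potential r t (\<lambda>q z. ?f z) (y + d) =
     (LINT (q, z)|lborel. indicator {r<..<t} q * ?f z * (heat (q - r) (z - y) - heat (q - r) (z - d - y)))"
    unfolding heat_potential_def
    by (subst Bochner_Integration.integral_diff[symmetric, OF i1 i1])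
      (auto intro!: Bochner_Integration.integral_cong simp: algebra_simps)
  finally show "heat_potential r t (\<lambda>q z. ?f z - ?f (z + d)) y =
     (LINT (q, z)|lborel. indicator {r<..<t} q * ?f z * (heat (q - r) (z - y) - heat (q - r) (z - d - y)))" .
  have "(\<lambda>(q, z). indicator {r<..<t} q * ?f z * (heat (q - r) (z - y) - heat (q - r) (z - d - y))) =
    (\<lambda>p. (case p of (q, z) \<Rightarrow> indicator {r<..<t} q * heat (q - r) (z - y) * ?f z) -
       (case p of (q, z) \<Rightarrow> indicator {r<..<t} q * heat (q - r) (z - (y + d)) * ?f z))"
    by (auto simp: fun_eq_iff algebra_simps)
  then show "integrable lborel (\<lambda>(q, z). indicator {r<..<t} q * ?f z * (heat (q - r) (z - y) - heat (q - r) (z - d - y)))"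
    using i1 by (simp only:) (intro Bochner_Integration.integrable_diff)
qed

text \<open>For \<open>y\<close> and \<open>z\<close> within \<open>\<epsilon>\<close> of
  \<open>\<alpha>\<close>, the condition \<open>8 * \<epsilon> \<le> d\<close> gives distances at
  most \<open>d / 4\<close> and at least \<open>3 * d / 4\<close>. The difference of kernels is then
  nonnegative, and at least \<open>1 / (128 * d)\<close> during the times from
  \<open>d\<^sup>2\<close> to \<open>2 * d\<^sup>2\<close> after \<open>r\<close>; the strip has
  length \<open>d\<^sup>2\<close>.\<close>

lemma heat_potential_dipole_ge:
  assumes e: "0 < \<epsilon>" "8 * \<epsilon> \<le> d" and t: "r < t"
    and y: "\<bar>y - \<alpha>\<bar> \<le> \<epsilon>"
  shows "0 \<le> heat_potential r t (\<lambda>q z. window \<alpha> \<epsilon> z - window \<alpha> \<epsilon> (z + d)) y"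
    and "2 * d\<^sup>2 \<le> t - r \<Longrightarrow> d / 128 \<le> heat_potential r t (\<lambda>q z. window \<alpha> \<epsilon> z - window \<alpha> \<epsilon> (z + d)) y"
proof -
  let ?F = "\<lambda>q z. indicator {r<..<t} q * window \<alpha> \<epsilon> z * (heat (q - r) (z - y) - heat (q - r) (z - d - y))"
  have d: "0 < d" using e by simp
  have ge: "heat (q - r) (d / 4) - heat (q - r) (3 * d / 4) \<le> heat (q - r) (z - y) - heat (q - r) (z - d - y)"
    if "r < q" "z \<in> {\<alpha> - \<epsilon><..<\<alpha> + \<epsilon>}" for q z
  proof -
    have "\<bar>z - y\<bar> \<le> \<bar>d / 4\<bar>" "\<bar>3 * d / 4\<bar> \<le> \<bar>z - d - y\<bar>"
      using that y e d unfolding greaterThanLessThan_iff by linarith+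
    then show ?thesis using that by (intro diff_mono heat_antimono) auto
  qed
  have le0: "heat (q - r) (3 * d / 4) \<le> heat (q - r) (d / 4)" if "r < q" for q
    using that d by (intro heat_antimono) auto
  have F0: "0 \<le> ?F q z" for q z
  proof (cases "q \<in> {r<..<t} \<and> z \<in> {\<alpha> - \<epsilon><..<\<alpha> + \<epsilon>}")
    case True
    then show ?thesis using ge[of q z] le0[of q] window_nonneg[OF e(1), of \<alpha> z] by (auto intro!: mult_nonneg_nonneg)
  qed (auto simp: window_def)
  show "0 \<le> heat_potential r t (\<lambda>q z. window \<alpha> \<epsilon> z - window \<alpha> \<epsilon> (z + d)) y"
    unfolding heat_potential_dipole_eq(1)[OF e(1)]
    by (rule Bochner_Integration.integral_nonneg) (use F0 in auto)
  assume dt: "2 * d\<^sup>2 \<le> t - r"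
  have "((r + 2 * d\<^sup>2) - (r + d\<^sup>2)) * (1 / (128 * d)) \<le> (LINT p|lborel. (case p of (q, z) \<Rightarrow> ?F q z))"
  proof (rule integral_ge_strip_window[OF heat_potential_dipole_eq(2)[OF e(1)] e(1)])
    fix q z
    show "indicator {r + d\<^sup>2<..<r + 2 * d\<^sup>2} q * window \<alpha> \<epsilon> z * (1 / (128 * d)) \<le> (case (q, z) of (q, z) \<Rightarrow> ?F q z)"
    proof (cases "q \<in> {r + d\<^sup>2<..<r + 2 * d\<^sup>2} \<and> z \<in> {\<alpha> - \<epsilon><..<\<alpha> + \<epsilon>}")
      case True
      have "r < q" using True d by (auto intro: less_trans[of r "r + d\<^sup>2"])
      moreover have "1 / (128 * d) \<le> heat (q - r) (d / 4) - heat (q - r) (3 * d / 4)"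
        using True d by (intro heat_diff_ge) auto
      ultimately have "1 / (128 * d) \<le> heat (q - r) (z - y) - heat (q - r) (z - d - y)"
        using ge[of q z] True by linarith
      then have "window \<alpha> \<epsilon> z * (1 / (128 * d)) \<le> window \<alpha> \<epsilon> z * (heat (q - r) (z - y) - heat (q - r) (z - d - y))"
        by (intro mult_left_mono window_nonneg e)
      moreover have "q \<in> {r<..<t}" using True dt \<open>r < q\<close> by auto
      ultimately show ?thesis using True by simp
    next
      case False
      then show ?thesis using F0[of q z] by (auto simp: window_def)
    qed
    show "0 \<le> (case (q, z) of (q, z) \<Rightarrow> ?F q z)" using F0 by simp
  qed (use d in auto)
  also have "((r + 2 * d\<^sup>2) - (r + d\<^sup>2)) * (1 / (128 * d)) = d / 128"
    using d by (simp add: power2_eq_square)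
  finally show "d / 128 \<le> heat_potential r t (\<lambda>q z. window \<alpha> \<epsilon> z - window \<alpha> \<epsilon> (z + d)) y"
    unfolding heat_potential_dipole_eq(1)[OF e(1)] .
qed

text \<open>The counterpart at the negative pole \<open>\<alpha> - d\<close>. There only the sign
  matters, because the product with the dipole is going to be minorised by 0.\<close>

lemma heat_potential_dipole_le:
  assumes e: "0 < \<epsilon>" "8 * \<epsilon> \<le> d" and y: "\<bar>y + d - \<alpha>\<bar> \<le> \<epsilon>"
  shows "heat_potential r t (\<lambda>q z. window \<alpha> \<epsilon> z - window \<alpha> \<epsilon> (z + d)) y \<le> 0"
proof -
  have "indicator {r<..<t} q * window \<alpha> \<epsilon> z * (heat (q - r) (z - y) - heat (q - r) (z - d - y)) \<le> 0" for q z
  proof (cases "q \<in> {r<..<t} \<and> z \<in> {\<alpha> - \<epsilon><..<\<alpha> + \<epsilon>}")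
    case True
    then have "heat (q - r) (z - y) \<le> heat (q - r) (z - d - y)"
      using y e by (intro heat_antimono) auto
    then show ?thesis using True window_nonneg[OF e(1), of \<alpha> z] by (auto intro!: mult_nonneg_nonpos)
  qed (auto simp: window_def)
  then have "0 \<le> (LINT p|lborel. - (case p of (q, z) \<Rightarrow>
      indicator {r<..<t} q * window \<alpha> \<epsilon> z * (heat (q - r) (z - y) - heat (q - r) (z - d - y))))"
    by (intro Bochner_Integration.integral_nonneg) (auto simp: split_beta')
  then show ?thesis
    unfolding heat_potential_dipole_eq(1)[OF e(1)] by simp
qed

context wiener_measure
begin

text \<open>The second moment is twice the potential of \<open>g * v\<close> with \<open>v\<close>
  the first moment, and \<open>g * v\<close> is nonnegative as \<open>v\<close> has the sign of
  \<open>g\<close> at both poles. So the integrand may be discarded except near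
  \<open>\<alpha>\<close> and for times in the middle of the interval. The factor
  \<open>T / 256\<close> is \<open>2 * (T / 4) / 128\<close>.\<close>

lemma occ_moment_dipole_ge:
  assumes e: "0 < \<epsilon>" "8 * \<epsilon> \<le> d" and s: "0 \<le> s" "s \<le> T / 4" and d: "d\<^sup>2 \<le> T / 8"
    and K: "\<bar>\<alpha>\<bar> + \<bar>x\<bar> + \<epsilon> \<le> K"
  shows "T / 256 * (exp (- 2 * K\<^sup>2 / T) / sqrt (2 * pi * T)) * d \<le>
    occ_moment (\<lambda>y. window \<alpha> \<epsilon> y - window \<alpha> \<epsilon> (y + d)) 2 s T x"
proof -
  define g where "g = (\<lambda>y. window \<alpha> \<epsilon> y - window \<alpha> \<epsilon> (y + d))"
  \<comment> \<open>A lower bound for the heat kernel at times between \<open>T / 4\<close> and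
    \<open>T\<close> and distances up to \<open>K\<close>: the exponential is taken at
    \<open>T / 4\<close>, the normalisation at \<open>T\<close>.\<close>
  define \<kappa> where "\<kappa> = exp (- 2 * K\<^sup>2 / T) / sqrt (2 * pi * T)"
  have \<kappa>: "0 \<le> \<kappa>" using T_pos by (simp add: \<kappa>_def)
  have d0: "0 < d" using e by simp
  let ?B = "1 / (2 * \<epsilon>)"
  have gB: "\<bar>g y\<bar> \<le> ?B" for y
    using window_nonneg[OF e(1), of \<alpha> y] window_le[OF e(1), of \<alpha> y]
      window_nonneg[OF e(1), of \<alpha> "y + d"] window_le[OF e(1), of \<alpha> "y + d"]
    unfolding g_def by linarith
  have [measurable]: "g \<in> borel_measurable borel" unfolding g_def by measurable
  define v where "v r y = occ_moment g 1 r T y" for r y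
  have v: "v r y = heat_potential r T (\<lambda>q z. window \<alpha> \<epsilon> z - window \<alpha> \<epsilon> (z + d)) y" if "0 \<le> r" "r \<le> T" for r y
    using occ_moment_Suc[of g ?B r T 0 y] gB that by (simp add: v_def g_def)
  let ?F = "\<lambda>r y. indicator {s<..<T} r * heat (r - s) (y - x) * (g y * v r y)"
  have i: "integrable lborel (\<lambda>(r, y). ?F r y)"
  proof (rule integrable_heat_potential)
    show "(\<lambda>(r, y). g y * v r y) \<in> borel_measurable (borel \<Otimes>\<^sub>M borel)" unfolding v_def by measurable
    fix r y assume r: "s < r" "r < T"
    have "\<bar>v r y\<bar> \<le> (?B * (T - r)) ^ 1" unfolding v_def using gB r by (intro abs_occ_moment_le) auto
    also have "\<dots> \<le> ?B * T" using e r s by (simp add: divide_right_mono)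
    finally show "\<bar>g y * v r y\<bar> \<le> ?B * (?B * T)"
      unfolding abs_mult using gB[of y] e by (intro mult_mono) auto
  qed
  have gv: "0 \<le> g y * v r y" if r: "s < r" "r < T" for r y
  proof -
    \<comment> \<open>As \<open>8 * \<epsilon> \<le> d\<close>, the two intervals are disjoint, so
      at each point at most one half of the dipole is present.\<close>
    consider "\<bar>y - \<alpha>\<bar> < \<epsilon>" | "\<bar>y + d - \<alpha>\<bar> < \<epsilon>" | "\<not> \<bar>y - \<alpha>\<bar> < \<epsilon>" "\<not> \<bar>y + d - \<alpha>\<bar> < \<epsilon>" by blast
    then show ?thesis
    proof cases
      case 1
      then have "g y = window \<alpha> \<epsilon> y" using e by (auto simp: g_def window_def indicator_def)
      moreover have "0 \<le> v r y" using heat_potential_dipole_ge(1)[OF e r(2)] 1 v r s by simp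
      ultimately show ?thesis using window_nonneg[OF e(1)] by simp
    next
      case 2
      then have "g y = - window \<alpha> \<epsilon> (y + d)" using e by (auto simp: g_def window_def indicator_def)
      moreover have "v r y \<le> 0" using heat_potential_dipole_le[OF e] 2 v r s by simp
      ultimately show ?thesis using window_nonneg[OF e(1), of \<alpha> "y + d"] by (simp add: mult_nonneg_nonpos)
    next
      case 3
      then have "y \<notin> {\<alpha> - \<epsilon><..<\<alpha> + \<epsilon>}" "y + d \<notin> {\<alpha> - \<epsilon><..<\<alpha> + \<epsilon>}" by auto
      then show ?thesis by (simp add: g_def window_def)
    qed
  qed
  have F0: "0 \<le> ?F r y" for r y
    using gv[of r y] by (cases "r \<in> {s<..<T}") auto
  \<comment> \<open>Times between \<open>T / 2\<close> and \<open>3 * T / 4\<close> are at least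
    \<open>T / 4\<close> away from \<open>s\<close> and from \<open>T\<close>: the kernel is then
    bounded below, and \<open>2 * d\<^sup>2 \<le> T / 4\<close> leaves room for the lower bound on
    \<open>v\<close>.\<close>
  have "(3 * T / 4 - T / 2) * (\<kappa> * (d / 128)) \<le> (LINT p|lborel. (case p of (r, y) \<Rightarrow> ?F r y))"
  proof (rule integral_ge_strip_window[OF i e(1)])
    fix r y
    show "indicator {T / 2<..<3 * T / 4} r * window \<alpha> \<epsilon> y * (\<kappa> * (d / 128)) \<le> (case (r, y) of (r, y) \<Rightarrow> ?F r y)"
    proof (cases "r \<in> {T / 2<..<3 * T / 4} \<and> y \<in> {\<alpha> - \<epsilon><..<\<alpha> + \<epsilon>}")
      case True
      then have r: "s < r" "r < T" using s T_pos by auto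
      have u: "T / 4 \<le> r - s" "r - s \<le> T" "0 < r - s" using True s T_pos by auto
      have y: "\<bar>y - \<alpha>\<bar> < \<epsilon>" using True by auto
      then have "g y = window \<alpha> \<epsilon> y" using e by (auto simp: g_def window_def indicator_def)
      moreover have "d / 128 \<le> v r y"
        using heat_potential_dipole_ge(2)[OF e r(2), of y \<alpha>] y v r s d True by (simp add: field_simps)
      moreover have "\<kappa> \<le> heat (r - s) (y - x)"
      proof -
        have "\<bar>y - x\<bar> \<le> K" using y K by linarith
        then have sq: "(y - x)\<^sup>2 \<le> K\<^sup>2" using abs_le_square_iff[of "y - x" K] by simp
        have "(y - x)\<^sup>2 / (2 * (r - s)) \<le> K\<^sup>2 / (2 * (T / 4))"
          using sq u T_pos by (intro frac_le) auto
        then have "exp (- 2 * K\<^sup>2 / T) \<le> exp (- (y - x)\<^sup>2 / (2 * (r - s)))"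
          by (simp add: mult.commute)
        moreover have "sqrt (2 * pi * (r - s)) \<le> sqrt (2 * pi * T)" using u by simp
        ultimately show ?thesis
          unfolding \<kappa>_def using u by (subst heat_eq) (auto intro!: frac_le)
      qed
      ultimately have "\<kappa> * (window \<alpha> \<epsilon> y * (d / 128)) \<le> heat (r - s) (y - x) * (g y * v r y)"
        using window_nonneg[OF e(1), of \<alpha> y] d0 \<kappa> by (intro mult_mono) auto
      then show ?thesis using True r by (simp add: mult_ac)
    next
      case False
      then show ?thesis using F0[of r y] by (auto simp: window_def)
    qed
    show "0 \<le> (case (r, y) of (r, y) \<Rightarrow> ?F r y)" using F0 by simp
  qed (use T_pos d0 \<kappa> in auto)
  also have "(LINT p|lborel. (case p of (r, y) \<Rightarrow> ?F r y)) = heat_potential s T (\<lambda>r y. g y * v r y) x"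
    by (simp add: heat_potential_def)
  finally have "2 * ((3 * T / 4 - T / 2) * (\<kappa> * (d / 128))) \<le> 2 * heat_potential s T (\<lambda>r y. g y * v r y) x"
    by simp
  also have "2 * heat_potential s T (\<lambda>r y. g y * v r y) x = occ_moment g 2 s T x"
    using occ_moment_Suc[of g ?B s T 1 x] gB s T_pos by (simp add: v_def numeral_2_eq_2)
  finally show ?thesis by (simp add: g_def \<kappa>_def mult.commute mult.left_commute)
qed

end

subsection \<open>Decoupling on an interval\<close>

definition abs_normal_moment :: "nat \<Rightarrow> real" where
  "abs_normal_moment n = (LINT x|lborel. std_normal_density x * \<bar>x\<bar> ^ n)"

lemma abs_normal_moment_nonneg: "0 \<le> abs_normal_moment n"
  unfolding abs_normal_moment_def by (rule Bochner_Integration.integral_nonneg) auto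

lemma nn_integral_gaussian_power:
  assumes "0 < v"
  shows "(\<integral>\<^sup>+x. ennreal (\<bar>x\<bar> ^ n) \<partial>gaussian v) = ennreal (abs_normal_moment n * sqrt v ^ n)"
proof -
  have v: "0 < sqrt v" using assms by simp
  have "(\<integral>\<^sup>+x. ennreal (\<bar>x\<bar> ^ n) \<partial>gaussian v) = (\<integral>\<^sup>+x. ennreal (normal_density 0 (sqrt v) x * \<bar>x\<bar> ^ n) \<partial>lborel)"
    unfolding gaussian_def by (subst nn_integral_density) (auto simp: ennreal_mult)
  also have "\<dots> = ennreal (sqrt v) * (\<integral>\<^sup>+x. ennreal (normal_density 0 (sqrt v) (0 + sqrt v * x) * \<bar>0 + sqrt v * x\<bar> ^ n) \<partial>lborel)"
    using v by (subst nn_integral_real_affine[where c="sqrt v" and t=0]) auto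
  also have "\<dots> = (\<integral>\<^sup>+x. ennreal (sqrt v * (normal_density 0 (sqrt v) (0 + sqrt v * x) * \<bar>0 + sqrt v * x\<bar> ^ n)) \<partial>lborel)"
    using v by (subst nn_integral_cmult[symmetric]) (auto simp: ennreal_mult)
  also have "\<dots> = (\<integral>\<^sup>+x. ennreal (sqrt v ^ n) * ennreal (std_normal_density x * \<bar>x\<bar> ^ n) \<partial>lborel)"
  proof (rule nn_integral_cong)
    fix x
    have "sqrt v * (normal_density 0 (sqrt v) (0 + sqrt v * x) * \<bar>0 + sqrt v * x\<bar> ^ n) = sqrt v ^ n * (std_normal_density x * \<bar>x\<bar> ^ n)"
      using v assms by (simp add: normal_density_def power_mult_distrib abs_mult real_sqrt_mult field_simps)
    then show "ennreal (sqrt v * (normal_density 0 (sqrt v) (0 + sqrt v * x) * \<bar>0 + sqrt v * x\<bar> ^ n)) =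
        ennreal (sqrt v ^ n) * ennreal (std_normal_density x * \<bar>x\<bar> ^ n)"
      using v by (simp add: ennreal_mult[symmetric])
  qed
  also have "\<dots> = ennreal (sqrt v ^ n) * (\<integral>\<^sup>+x. ennreal (std_normal_density x * \<bar>x\<bar> ^ n) \<partial>lborel)"
    by (rule nn_integral_cmult) auto
  also have "(\<integral>\<^sup>+x. ennreal (std_normal_density x * \<bar>x\<bar> ^ n) \<partial>lborel) = ennreal (abs_normal_moment n)"
    unfolding abs_normal_moment_def
    using integrable_normal_moment_abs[of 1 0 n] by (intro nn_integral_eq_integral) auto
  finally show ?thesis using v abs_normal_moment_nonneg by (simp add: ennreal_mult[symmetric] mult.commute)
qed

text \<open>The bound does not depend on \<open>v\<close>: within two standard deviations the
  density is at least \<open>exp (- 2) / sqrt (2 * pi * v)\<close>, and the interval is one standard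
  deviation long.\<close>

lemma emeasure_gaussian_ge:
  assumes v: "0 < v" and a: "\<And>x. x \<in> {a..a + sqrt v} \<Longrightarrow> \<bar>x\<bar> \<le> 2 * sqrt v"
  shows "ennreal (exp (- 2) / sqrt (2 * pi)) \<le> emeasure (gaussian v) {a..a + sqrt v}"
proof -
  have d: "exp (- 2) / sqrt (2 * pi * v) \<le> normal_density 0 (sqrt v) x" if "x \<in> {a..a + sqrt v}" for x
  proof -
    have "x\<^sup>2 \<le> (2 * sqrt v)\<^sup>2" using a[OF that] abs_le_square_iff[of x "2 * sqrt v"] v by simp
    then have "x\<^sup>2 / (2 * v) \<le> 2" using v by (simp add: power_mult_distrib field_simps)
    then show ?thesis using v by (auto simp: normal_density_def intro!: divide_right_mono)
  qed
  have "ennreal (exp (- 2) / sqrt (2 * pi)) = ennreal (exp (- 2) / sqrt (2 * pi * v)) * ennreal (sqrt v)"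
    using v by (simp add: ennreal_mult[symmetric] real_sqrt_mult)
  also have "\<dots> = (\<integral>\<^sup>+x. ennreal (exp (- 2) / sqrt (2 * pi * v)) * indicator {a..a + sqrt v} x \<partial>lborel)"
    using v by (simp add: nn_integral_cmult)
  also have "\<dots> \<le> (\<integral>\<^sup>+x. ennreal (normal_density 0 (sqrt v) x) * indicator {a..a + sqrt v} x \<partial>lborel)"
    using d by (intro nn_integral_mono) (auto simp: indicator_def intro!: ennreal_leI)
  also have "\<dots> = emeasure (gaussian v) {a..a + sqrt v}"
    unfolding gaussian_def by (subst emeasure_density) auto
  finally show ?thesis .
qed

context wiener_measure
begin

text \<open>The Markov property at time \<open>r\<close> for a family \<open>G\<close> with a random
  parameter. That \<open>D\<close> is fixed by splicing on \<open>(r,T]\<close> expresses that it is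
  determined by the path up to \<open>r\<close>, so it may be frozen while the later increments are
  averaged.\<close>

lemma nn_integral_occ_markov:
  assumes G: "(\<lambda>(d, y). G d y) \<in> borel_measurable (borel \<Otimes>\<^sub>M borel)" and B: "\<And>d y. \<bar>G d y\<bar> \<le> B"
    and D: "D \<in> borel_measurable \<mu>" "\<And>w w'. D (path_splice T r T (w, w')) = D w"
    and r: "0 \<le> r" "r \<le> e" "e \<le> T"
  shows "(\<integral>\<^sup>+w. ennreal (occ (G (D w)) r e (w r) w ^ (2 * n)) \<partial>\<mu>) =
    (\<integral>\<^sup>+w. ennreal (occ_moment (G (D w)) (2 * n) r e (w r)) \<partial>\<mu>)"
proof -
  have [measurable]: "(\<lambda>(d, y). G d y) \<in> borel_measurable (borel \<Otimes>\<^sub>M borel)" "D \<in> borel_measurable \<mu>" by fact+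
  have rT: "r \<le> T" using r by simp
  have er [measurable]: "(\<lambda>w. w r) \<in> borel_measurable \<mu>" using r by (intro measurable_eval) auto
  have eq: "occ (G d) r e (path_splice T r T (w, w') r) (path_splice T r T (w, w')) = occ (G d) r e (w r) w'" for d w w'
    unfolding occ_def
  proof (intro Bochner_Integration.integral_cong refl)
    fix u
    show "indicator {r<..<e} u * G d (path_splice T r T (w, w') r + path_at u (path_splice T r T (w, w')) - path_at r (path_splice T r T (w, w'))) =
      indicator {r<..<e} u * G d (w r + path_at u w' - path_at r w')"
      using path_at_splice_end[of r u w w'] path_at_splice_end[of r r w w'] r
      by (cases "r < u") (auto simp: add_diff_eq)
  qed
  have "(\<integral>\<^sup>+w. ennreal (occ (G (D w)) r e (w r) w ^ (2 * n)) \<partial>\<mu>) =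
     (\<integral>\<^sup>+p. ennreal (occ (G (D (path_splice T r T p))) r e (path_splice T r T p r) (path_splice T r T p) ^ (2 * n)) \<partial>(\<mu> \<Otimes>\<^sub>M \<mu>))"
  proof (rule nn_integral_splice)
    show "(\<lambda>w. ennreal (occ (G (D w)) r e (w r) w ^ (2 * n))) \<in> borel_measurable \<mu>"
      unfolding occ_def by measurable
  qed (use r in auto)
  also have "\<dots> = (\<integral>\<^sup>+p. ennreal (occ (G (D (fst p))) r e (fst p r) (snd p) ^ (2 * n)) \<partial>(\<mu> \<Otimes>\<^sub>M \<mu>))"
    by (intro nn_integral_cong) (auto simp: eq D split_paired_all)
  also have "\<dots> = (\<integral>\<^sup>+w. \<integral>\<^sup>+w'. ennreal (occ (G (D w)) r e (w r) w' ^ (2 * n)) \<partial>\<mu> \<partial>\<mu>)"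
  proof -
    have "(\<lambda>p. ennreal (occ (G (D (fst p))) r e (fst p r) (snd p) ^ (2 * n))) \<in> borel_measurable (\<mu> \<Otimes>\<^sub>M \<mu>)"
      unfolding occ_def by measurable
    from nn_integral_fst[OF this] show ?thesis by simp
  qed
  also have "\<dots> = (\<integral>\<^sup>+w. ennreal (occ_moment (G (D w)) (2 * n) r e (w r)) \<partial>\<mu>)"
  proof (rule nn_integral_cong)
    fix w
    have m: "G (D w) \<in> borel_measurable borel" by measurable
    have "integrable \<mu> (\<lambda>w'. occ (G (D w)) r e (w r) w' ^ (2 * n))"
    proof (rule integrable_const_bound[where B="(B * (e - r)) ^ (2 * n)"])
      show "AE w' in \<mu>. norm (occ (G (D w)) r e (w r) w' ^ (2 * n)) \<le> (B * (e - r)) ^ (2 * n)"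
        unfolding real_norm_def power_abs using B r by (intro AE_I2 power_mono abs_occ_le) auto
      show "(\<lambda>w'. occ (G (D w)) r e (w r) w' ^ (2 * n)) \<in> borel_measurable \<mu>" using m by measurable
    qed
    then show "(\<integral>\<^sup>+w'. ennreal (occ (G (D w)) r e (w r) w' ^ (2 * n)) \<partial>\<mu>) = ennreal (occ_moment (G (D w)) (2 * n) r e (w r))"
      unfolding occ_moment_def by (intro nn_integral_eq_integral) auto
  qed
  finally show ?thesis .
qed

section \<open>The difference of occupation times before and after decoupling\<close>

definition occ_time :: "(real \<Rightarrow> real) \<Rightarrow> real \<Rightarrow> real \<Rightarrow> (real \<Rightarrow> real) \<Rightarrow> real" where
  "occ_time f s e w = (LINT u|lborel. indicator {s<..<e} u * f (path_at u w))"

lemma measurable_occ_time [measurable (raw)]: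
  assumes [measurable]: "f \<in> borel_measurable borel" "c \<in> measurable N \<mu>"
  shows "(\<lambda>z. occ_time f s e (c z)) \<in> borel_measurable N"
  unfolding occ_time_def by measurable

lemma occ_time_eq_occ: "0 \<le> s \<Longrightarrow> s \<le> T \<Longrightarrow> occ_time f s e w = occ f s e (w s) w"
  by (simp add: occ_time_def occ_def)

lemma nn_integral_occ_time_le:
  assumes f [measurable]: "f \<in> borel_measurable borel" and f0: "\<And>y. 0 \<le> f y" and fB: "\<And>y. f y \<le> B"
    and F: "(\<integral>\<^sup>+y. ennreal (f y) \<partial>lborel) \<le> 1" and s: "0 \<le> s" "s \<le> e" "e \<le> T"
  shows "(\<integral>\<^sup>+w. ennreal (occ_time f s e w ^ (2 * n)) \<partial>\<mu>) \<le> ennreal (fact (2 * n) * sqrt (e - s) ^ (2 * n))"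
proof -
  have "(\<integral>\<^sup>+w. ennreal (occ_time f s e w ^ (2 * n)) \<partial>\<mu>) = (\<integral>\<^sup>+w. ennreal (occ f s e (w s) w ^ (2 * n)) \<partial>\<mu>)"
    using s by (simp add: occ_time_eq_occ)
  also have "\<dots> = (\<integral>\<^sup>+w. ennreal (occ_moment f (2 * n) s e (w s)) \<partial>\<mu>)"
    using nn_integral_occ_markov[of "\<lambda>_. f" B "\<lambda>_. 0" s e n] f0 fB s by (simp add: abs_of_nonneg)
  also have "\<dots> \<le> (\<integral>\<^sup>+w. ennreal (fact (2 * n) * sqrt (e - s) ^ (2 * n)) \<partial>\<mu>)"
    using abs_occ_moment_nonneg_le[OF f f0 fB F s, of "2 * n"]
    by (intro nn_integral_mono ennreal_leI) (meson abs_le_D1)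
  also have "\<dots> = ennreal (fact (2 * n) * sqrt (e - s) ^ (2 * n))"
    by (simp add: emeasure_space_1)
  finally show ?thesis .
qed

lemma integrable_occ_time:
  fixes f :: "real \<Rightarrow> real"
  assumes [measurable]: "f \<in> borel_measurable borel" and B: "\<And>y. \<bar>f y\<bar> \<le> B" and w: "w \<in> space \<mu>"
  shows "integrable lborel (\<lambda>u. indicator {s<..<e} u * f (path_at u w + c))"
proof (rule integrable_indicator_Ioo_bounded)
  have [measurable]: "(\<lambda>u. path_at u w) \<in> borel_measurable borel"
    using continuous_on_path_at[OF w] by (rule borel_measurable_continuous_onI)
  show "(\<lambda>u. f (path_at u w + c)) \<in> borel_measurable borel" by measurable
qed (rule B)

lemma occ_time_split:
  assumes [measurable]: "f \<in> borel_measurable borel" and B: "\<And>y. \<bar>f y\<bar> \<le> B" and w: "w \<in> space \<mu>"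
    and "s \<le> c" "c \<le> e"
  shows "occ_time f s e w = occ_time f s c w + occ_time f c e w"
proof -
  note i = integrable_occ_time[OF assms(1) B w, where c=0, simplified]
  have "occ_time f s c w + occ_time f c e w =
     (LINT u|lborel. indicator {s<..<c} u * f (path_at u w) + indicator {c<..<e} u * f (path_at u w))"
    unfolding occ_time_def by (intro Bochner_Integration.integral_add[symmetric] i)
  also have "\<dots> = occ_time f s e w"
    unfolding occ_time_def
  proof (rule integral_cong_AE)
    show "AE u in lborel. indicator {s<..<c} u * f (path_at u w) + indicator {c<..<e} u * f (path_at u w) =
        indicator {s<..<e} u * f (path_at u w)"
      using AE_lborel_singleton[of c] by eventually_elim (use assms in \<open>auto simp: indicator_def\<close>)
  qed (use i in \<open>auto intro!: borel_measurable_add dest: borel_measurable_integrable\<close>)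
  finally show ?thesis by simp
qed

text \<open>The constant by which the spliced path exceeds the first path after time
  \<open>b\<close>; it becomes the length \<open>d\<close> of the dipole.\<close>

definition shift_diff :: "real \<Rightarrow> real \<Rightarrow> (real \<Rightarrow> real) \<times> (real \<Rightarrow> real) \<Rightarrow> real" where
  "shift_diff a b p = (snd p b - snd p a) - (fst p b - fst p a)"

lemma measurable_shift_diff [measurable]:
  assumes "0 \<le> a" "a \<le> b" "b \<le> T"
  shows "shift_diff a b \<in> borel_measurable (\<mu> \<Otimes>\<^sub>M \<mu>)"
  unfolding shift_diff_def
  using assms by (intro borel_measurable_diff measurable_compose[OF measurable_fst measurable_eval]
      measurable_compose[OF measurable_snd measurable_eval]) auto

text \<open>The contributions before \<open>a\<close> cancel. What remains after \<open>b\<close> is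
  written as an \<open>occ\<close> restarted at time \<open>b\<close> from \<open>fst p b\<close>,
  the form to which the Markov property applies.\<close>

lemma occ_time_diff_splice:
  assumes f [measurable]: "f \<in> borel_measurable borel" and B: "\<And>y. \<bar>f y\<bar> \<le> B"
    and ab: "0 \<le> a" "a \<le> b" "b \<le> T" and p: "p \<in> space (\<mu> \<Otimes>\<^sub>M \<mu>)"
  shows "occ_time f 0 T (fst p) - occ_time f 0 T (path_splice T a b p) =
     occ_time f a b (fst p) - occ_time f a b (path_splice T a b p) +
     occ (\<lambda>y. f y - f (y + shift_diff a b p)) b T (fst p b) (fst p)"
proof -
  obtain w w' where pw: "p = (w, w')" by (cases p)
  have w: "w \<in> space \<mu>" using p by (auto simp: pw space_pair_measure)
  have "path_splice T a b \<in> measurable (\<mu> \<Otimes>\<^sub>M \<mu>) \<mu>" using measurable_splice[OF ab] by measurable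
  from measurable_space[OF this p] have w2: "path_splice T a b (w, w') \<in> space \<mu>" by (simp add: pw)
  have 0: "occ_time f 0 a (path_splice T a b (w, w')) = occ_time f 0 a w"
    unfolding occ_time_def
    by (intro Bochner_Integration.integral_cong refl) (auto simp: indicator_def path_at_splice(1)[OF ab])
  have i: "integrable lborel (\<lambda>u. indicator {b<..<T} u * f (path_at u w + c))" for c
    by (rule integrable_occ_time[OF f B w])
  have "occ (\<lambda>y. f y - f (y + shift_diff a b p)) b T (w b) w =
     (LINT u|lborel. indicator {b<..<T} u * f (path_at u w + 0) - indicator {b<..<T} u * f (path_at u w + shift_diff a b p))"
    using ab unfolding occ_def by (intro Bochner_Integration.integral_cong refl) (auto simp: algebra_simps)
  also have "\<dots> = occ_time f b T w - (LINT u|lborel. indicator {b<..<T} u * f (path_at u w + shift_diff a b p))"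
    by (subst Bochner_Integration.integral_diff[OF i i]) (simp add: occ_time_def)
  also have "(LINT u|lborel. indicator {b<..<T} u * f (path_at u w + shift_diff a b p)) = occ_time f b T (path_splice T a b (w, w'))"
    unfolding occ_time_def
  proof (intro Bochner_Integration.integral_cong refl)
    fix u
    have "path_at u w + shift_diff a b p = path_at u (path_splice T a b (w, w'))" if "b < u"
      using path_at_splice(3)[OF ab, of u w w'] that by (simp add: shift_diff_def pw)
    then show "indicator {b<..<T} u * f (path_at u w + shift_diff a b p) = indicator {b<..<T} u * f (path_at u (path_splice T a b (w, w')))"
      by (auto simp: indicator_def)
  qed
  finally have Q: "occ (\<lambda>y. f y - f (y + shift_diff a b p)) b T (w b) w = occ_time f b T w - occ_time f b T (path_splice T a b (w, w'))" .
  have "occ_time f 0 T v = occ_time f 0 a v + (occ_time f a b v + occ_time f b T v)" if "v \<in> space \<mu>" for v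
    using occ_time_split[OF f B that, of 0 a T] occ_time_split[OF f B that, of a b T] ab by simp
  from this[OF w] this[OF w2] show ?thesis using 0 Q by (simp add: pw)
qed

lemma measurable_occ_shift [measurable]:
  assumes [measurable]: "f \<in> borel_measurable borel" and ab: "0 \<le> a" "a \<le> b" "b \<le> T"
  shows "(\<lambda>p. occ (\<lambda>y. f y - f (y + shift_diff a b p)) b T (fst p b) (fst p)) \<in> borel_measurable (\<mu> \<Otimes>\<^sub>M \<mu>)"
proof -
  have [measurable]: "shift_diff a b \<in> borel_measurable (\<mu> \<Otimes>\<^sub>M \<mu>)" by (rule measurable_shift_diff[OF ab])
  have [measurable]: "(\<lambda>p. fst p b) \<in> borel_measurable (\<mu> \<Otimes>\<^sub>M \<mu>)"
    using ab by (intro measurable_compose[OF measurable_fst measurable_eval]) auto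
  show ?thesis unfolding occ_def by measurable
qed

text \<open>The second path is kept fixed in the outer integral. The shift then depends on the first
  path only through its values up to \<open>b\<close>, which makes it an admissible random parameter
  for the Markov property at \<open>b\<close>.\<close>

lemma nn_integral_occ_shift:
  assumes f [measurable]: "f \<in> borel_measurable borel" and f0: "\<And>y. 0 \<le> f y" and fB: "\<And>y. f y \<le> B"
    and ab: "0 \<le> a" "a \<le> b" "b \<le> T"
  shows "(\<integral>\<^sup>+p. ennreal (occ (\<lambda>y. f y - f (y + shift_diff a b p)) b T (fst p b) (fst p) ^ (2 * n)) \<partial>(\<mu> \<Otimes>\<^sub>M \<mu>)) =
     (\<integral>\<^sup>+w'. \<integral>\<^sup>+w. ennreal (occ_moment (\<lambda>y. f y - f (y + shift_diff a b (w, w'))) (2 * n) b T (w b)) \<partial>\<mu> \<partial>\<mu>)"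
proof -
  have "(\<integral>\<^sup>+p. ennreal (occ (\<lambda>y. f y - f (y + shift_diff a b p)) b T (fst p b) (fst p) ^ (2 * n)) \<partial>(\<mu> \<Otimes>\<^sub>M \<mu>)) =
    (\<integral>\<^sup>+w'. \<integral>\<^sup>+w. ennreal (occ (\<lambda>y. f y - f (y + shift_diff a b (w, w'))) b T (w b) w ^ (2 * n)) \<partial>\<mu> \<partial>\<mu>)"
  proof -
    have "(\<lambda>p. ennreal (occ (\<lambda>y. f y - f (y + shift_diff a b p)) b T (fst p b) (fst p) ^ (2 * n))) \<in> borel_measurable (\<mu> \<Otimes>\<^sub>M \<mu>)"
      using measurable_occ_shift[OF f ab] by measurable
    from pair.nn_integral_snd[OF this] show ?thesis by simp
  qed
  also have "\<dots> = (\<integral>\<^sup>+w'. \<integral>\<^sup>+w. ennreal (occ_moment (\<lambda>y. f y - f (y + shift_diff a b (w, w'))) (2 * n) b T (w b)) \<partial>\<mu> \<partial>\<mu>)"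
  proof (rule nn_integral_cong)
    fix w'
    have Dm: "(\<lambda>w. shift_diff a b (w, w')) \<in> borel_measurable \<mu>"
      unfolding shift_diff_def using ab by (auto intro!: borel_measurable_diff measurable_eval)
    have Ds: "shift_diff a b (path_splice T b T (w, v), w') = shift_diff a b (w, w')" for w v
      using splice_increment(1)[of b T T a b w v] ab by (simp add: shift_diff_def)
    show "(\<integral>\<^sup>+w. ennreal (occ (\<lambda>y. f y - f (y + shift_diff a b (w, w'))) b T (w b) w ^ (2 * n)) \<partial>\<mu>) =
       (\<integral>\<^sup>+w. ennreal (occ_moment (\<lambda>y. f y - f (y + shift_diff a b (w, w'))) (2 * n) b T (w b)) \<partial>\<mu>)"
    proof (rule nn_integral_occ_markov[where G="\<lambda>d y. f y - f (y + d)" and D="\<lambda>w. shift_diff a b (w, w')" and B=B])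
      show "(\<lambda>(d, y). f y - f (y + d)) \<in> borel_measurable (borel \<Otimes>\<^sub>M borel)" by measurable
      show "\<bar>f y - f (y + d)\<bar> \<le> B" for d y
        using f0[of y] fB[of y] f0[of "y + d"] fB[of "y + d"] by auto
    qed (use Dm Ds ab in auto)
  qed
  finally show ?thesis .
qed

lemma nn_integral_increment_power:
  assumes "0 \<le> a" "a < b" "b \<le> T"
  shows "(\<integral>\<^sup>+w. ennreal (\<bar>w b - w a\<bar> ^ n) \<partial>\<mu>) = ennreal (abs_normal_moment n * sqrt (b - a) ^ n)"
proof -
  have m: "(\<lambda>w. w b - w a) \<in> borel_measurable \<mu>"
    using assms by (intro borel_measurable_diff measurable_eval) auto
  have "(\<integral>\<^sup>+w. ennreal (\<bar>w b - w a\<bar> ^ n) \<partial>\<mu>) = (\<integral>\<^sup>+x. ennreal (\<bar>x\<bar> ^ n) \<partial>distr \<mu> borel (\<lambda>w. w b - w a))"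
    by (subst nn_integral_distr[OF m]) auto
  then show ?thesis using distr_increment[OF assms] nn_integral_gaussian_power[of "b - a" n] assms by simp
qed

lemma abs_diff_power_le: "(\<bar>x - y\<bar> :: real) ^ n \<le> 2 ^ n * (\<bar>x\<bar> ^ n + \<bar>y\<bar> ^ n)"
proof -
  have "\<bar>x - y\<bar> ^ n \<le> (2 * max \<bar>x\<bar> \<bar>y\<bar>) ^ n" by (intro power_mono) auto
  also have "\<dots> = 2 ^ n * (max \<bar>x\<bar> \<bar>y\<bar>) ^ n" by (simp add: power_mult_distrib)
  also have "(max \<bar>x\<bar> \<bar>y\<bar>) ^ n \<le> \<bar>x\<bar> ^ n + \<bar>y\<bar> ^ n" by (cases "\<bar>x\<bar> \<le> \<bar>y\<bar>") (auto simp: max_def)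
  finally show ?thesis by simp
qed

lemma even_power_add3_le: "(x - y + z :: real) ^ (2 * n) \<le> 3 ^ (2 * n) * (x ^ (2 * n) + y ^ (2 * n) + z ^ (2 * n))"
proof -
  define m where "m = max \<bar>x\<bar> (max \<bar>y\<bar> \<bar>z\<bar>)"
  have "(x - y + z) ^ (2 * n) = \<bar>x - y + z\<bar> ^ (2 * n)" by (simp add: power_even_abs)
  also have "\<dots> \<le> (3 * m) ^ (2 * n)" by (intro power_mono) (auto simp: m_def)
  also have "\<dots> = 3 ^ (2 * n) * m ^ (2 * n)" by (simp add: power_mult_distrib)
  also have "m ^ (2 * n) \<le> x ^ (2 * n) + y ^ (2 * n) + z ^ (2 * n)"
  proof -
    have e: "\<bar>u\<bar> ^ (2 * n) = u ^ (2 * n)" for u :: real by (simp add: power_even_abs)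
    have p: "0 \<le> u ^ (2 * n)" for u :: real by (simp add: power_mult)
    have "m = \<bar>x\<bar> \<or> m = \<bar>y\<bar> \<or> m = \<bar>z\<bar>" by (auto simp: m_def max_def)
    then have "m ^ (2 * n) = x ^ (2 * n) \<or> m ^ (2 * n) = y ^ (2 * n) \<or> m ^ (2 * n) = z ^ (2 * n)"
      using e by metis
    then show ?thesis using p[of x] p[of y] p[of z] by linarith
  qed
  finally show ?thesis by simp
qed

lemma ennreal_even_power_add3_le:
  "ennreal ((x - y + z :: real) ^ (2 * n)) \<le>
     ennreal (3 ^ (2 * n)) * (ennreal (x ^ (2 * n)) + ennreal (y ^ (2 * n)) + ennreal (z ^ (2 * n)))"
proof -
  have pos: "0 \<le> (u :: real) ^ (2 * n)" for u by (simp add: power_mult)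
  have "ennreal (3 ^ (2 * n)) * (ennreal (x ^ (2 * n)) + ennreal (y ^ (2 * n)) + ennreal (z ^ (2 * n))) =
    ennreal (3 ^ (2 * n) * (x ^ (2 * n) + y ^ (2 * n) + z ^ (2 * n)))"
    using pos by (simp only: ennreal_plus ennreal_mult add_nonneg_nonneg)
  then show ?thesis by (simp only:) (intro ennreal_leI even_power_add3_le)
qed

lemma nn_integral_occ_shift_le:
  assumes f [measurable]: "f \<in> borel_measurable borel" and f0: "\<And>y. 0 \<le> f y" and fB: "\<And>y. f y \<le> B"
    and F: "(\<integral>\<^sup>+y. ennreal (f y) \<partial>lborel) \<le> 1" and ab: "0 \<le> a" "a < b" "b \<le> T"
  shows "(\<integral>\<^sup>+p. ennreal (occ (\<lambda>y. f y - f (y + shift_diff a b p)) b T (fst p b) (fst p) ^ (2 * n)) \<partial>(\<mu> \<Otimes>\<^sub>M \<mu>))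
     \<le> ennreal ((fact (2 * n) * (8 * sqrt T) ^ n * 2 ^ n * 2 * abs_normal_moment n) * sqrt (b - a) ^ n)"
proof -
  have ab': "a \<le> b" using ab by simp
  define c where "c = fact (2 * n) * (8 * sqrt T) ^ n * 2 ^ n"
  have c: "0 \<le> c" using T_pos by (simp add: c_def)
  have mm: "(\<lambda>w. w b - w a) \<in> borel_measurable \<mu>"
    using ab by (intro borel_measurable_diff measurable_eval) auto
  define q where "q w = ennreal (\<bar>w b - w a\<bar> ^ n)" for w :: "real \<Rightarrow> real"
  have mq [measurable]: "q \<in> borel_measurable \<mu>" unfolding q_def using mm by measurable
  have "(\<integral>\<^sup>+p. ennreal (occ (\<lambda>y. f y - f (y + shift_diff a b p)) b T (fst p b) (fst p) ^ (2 * n)) \<partial>(\<mu> \<Otimes>\<^sub>M \<mu>)) =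
     (\<integral>\<^sup>+w'. \<integral>\<^sup>+w. ennreal (occ_moment (\<lambda>y. f y - f (y + shift_diff a b (w, w'))) (2 * n) b T (w b)) \<partial>\<mu> \<partial>\<mu>)"
    by (rule nn_integral_occ_shift[OF f f0 fB ab(1) ab' ab(3)])
  also have "\<dots> \<le> (\<integral>\<^sup>+w'. \<integral>\<^sup>+w. ennreal c * (q w' + q w) \<partial>\<mu> \<partial>\<mu>)"
  proof (intro nn_integral_mono)
    fix w w'
    have "occ_moment (\<lambda>y. f y - f (y + shift_diff a b (w, w'))) (2 * n) b T (w b) \<le>
      fact (2 * n) * (8 * sqrt T * \<bar>shift_diff a b (w, w')\<bar>) ^ n"
      using abs_occ_moment_dipole_le[OF f f0 fB F, of b T "shift_diff a b (w, w')" n "w b"] ab by auto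
    also have "\<dots> = fact (2 * n) * (8 * sqrt T) ^ n * \<bar>shift_diff a b (w, w')\<bar> ^ n" by (simp add: power_mult_distrib)
    also have "\<dots> \<le> fact (2 * n) * (8 * sqrt T) ^ n * (2 ^ n * (\<bar>w' b - w' a\<bar> ^ n + \<bar>w b - w a\<bar> ^ n))"
      using T_pos unfolding shift_diff_def by (intro mult_left_mono) (auto intro: abs_diff_power_le)
    finally show "ennreal (occ_moment (\<lambda>y. f y - f (y + shift_diff a b (w, w'))) (2 * n) b T (w b)) \<le> ennreal c * (q w' + q w)"
      using c by (simp add: q_def c_def ennreal_plus[symmetric] ennreal_mult[symmetric] mult.assoc ennreal_leI del: ennreal_plus)
  qed
  also have "\<dots> = (\<integral>\<^sup>+w'. ennreal c * (q w' + (\<integral>\<^sup>+w. q w \<partial>\<mu>)) \<partial>\<mu>)"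
    by (intro nn_integral_cong) (simp add: nn_integral_cmult nn_integral_add emeasure_space_1)
  also have "\<dots> = ennreal c * ((\<integral>\<^sup>+w. q w \<partial>\<mu>) + (\<integral>\<^sup>+w. q w \<partial>\<mu>))"
    by (simp add: nn_integral_cmult nn_integral_add emeasure_space_1)
  also have "\<dots> = ennreal (c * 2 * abs_normal_moment n * sqrt (b - a) ^ n)"
    unfolding q_def nn_integral_increment_power[OF ab] using c ab abs_normal_moment_nonneg[of n]
    by (simp add: ennreal_plus[symmetric] ennreal_mult[symmetric] mult_ac del: ennreal_plus)
  finally show ?thesis by (simp add: c_def)
qed

lemma nn_integral_fst_pair:
  assumes [measurable]: "f \<in> borel_measurable \<mu>"
  shows "(\<integral>\<^sup>+p. f (fst p) \<partial>(\<mu> \<Otimes>\<^sub>M \<mu>)) = (\<integral>\<^sup>+w. f w \<partial>\<mu>)"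
  using nn_integral_fst[of "\<lambda>p. f (fst p)" \<mu>] by (simp add: emeasure_space_1)

text \<open>The quantifiers matter: \<open>C\<close> is chosen before \<open>f\<close>,
  \<open>B\<close>, \<open>a\<close> and \<open>b\<close>, so it serves all interval densities at
  once and survives the limit.\<close>

lemma nn_integral_occ_time_diff_splice_le:
  "\<exists>C\<ge>0. \<forall>f B a b. f \<in> borel_measurable borel \<longrightarrow> (\<forall>y. 0 \<le> f y \<and> f y \<le> B) \<longrightarrow>
     (\<integral>\<^sup>+y. ennreal (f y) \<partial>lborel) \<le> 1 \<longrightarrow> 0 \<le> a \<longrightarrow> a < b \<longrightarrow> b \<le> T \<longrightarrow>
     (\<integral>\<^sup>+p. ennreal ((occ_time f 0 T (fst p) - occ_time f 0 T (path_splice T a b p)) ^ (2 * n)) \<partial>(\<mu> \<Otimes>\<^sub>M \<mu>))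
       \<le> ennreal (C * sqrt (b - a) ^ n)"
proof -
  define C1 where "C1 = fact (2 * n) * sqrt T ^ n"
  define C2 where "C2 = fact (2 * n) * (8 * sqrt T) ^ n * 2 ^ n * 2 * abs_normal_moment n"
  define C where "C = 3 ^ (2 * n) * (C1 + C1 + C2)"
  have C12: "0 \<le> C1" "0 \<le> C2" using T_pos abs_normal_moment_nonneg[of n] by (auto simp: C1_def C2_def)
  show ?thesis
  proof (intro exI[of _ C] conjI allI impI)
    show "0 \<le> C" using C12 by (simp add: C_def)
    fix f :: "real \<Rightarrow> real" and B a b
    assume f [measurable]: "f \<in> borel_measurable borel" and fB': "\<forall>y. 0 \<le> f y \<and> f y \<le> B"
      and F: "(\<integral>\<^sup>+y. ennreal (f y) \<partial>lborel) \<le> 1" and ab: "0 \<le> a" "a < b" "b \<le> T"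
    have ab': "a \<le> b" using ab by simp
    have f0: "0 \<le> f y" and fB: "f y \<le> B" and fa: "\<bar>f y\<bar> \<le> B" for y using fB' by auto
    have [measurable]: "path_splice T a b \<in> measurable (\<mu> \<Otimes>\<^sub>M \<mu>) \<mu>"
      using measurable_splice[OF ab(1) ab' ab(3)] by measurable
    let ?Q = "\<lambda>p. occ (\<lambda>y. f y - f (y + shift_diff a b p)) b T (fst p b) (fst p)"
    have [measurable]: "?Q \<in> borel_measurable (\<mu> \<Otimes>\<^sub>M \<mu>)" by (rule measurable_occ_shift[OF f ab(1) ab' ab(3)])
    let ?e = "\<lambda>x. ennreal (x ^ (2 * n))"
    have "(\<integral>\<^sup>+p. ?e (occ_time f 0 T (fst p) - occ_time f 0 T (path_splice T a b p)) \<partial>(\<mu> \<Otimes>\<^sub>M \<mu>)) \<le>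
      (\<integral>\<^sup>+p. ennreal (3 ^ (2 * n)) * (?e (occ_time f a b (fst p)) + ?e (occ_time f a b (path_splice T a b p)) + ?e (?Q p)) \<partial>(\<mu> \<Otimes>\<^sub>M \<mu>))"
    proof (rule nn_integral_mono)
      fix p assume p: "p \<in> space (\<mu> \<Otimes>\<^sub>M \<mu>)"
      show "?e (occ_time f 0 T (fst p) - occ_time f 0 T (path_splice T a b p)) \<le>
         ennreal (3 ^ (2 * n)) * (?e (occ_time f a b (fst p)) + ?e (occ_time f a b (path_splice T a b p)) + ?e (?Q p))"
        unfolding occ_time_diff_splice[OF f fa ab(1) ab' ab(3) p] by (rule ennreal_even_power_add3_le)
    qed
    also have "\<dots> = ennreal (3 ^ (2 * n)) * ((\<integral>\<^sup>+p. ?e (occ_time f a b (fst p)) \<partial>(\<mu> \<Otimes>\<^sub>M \<mu>)) +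
        (\<integral>\<^sup>+p. ?e (occ_time f a b (path_splice T a b p)) \<partial>(\<mu> \<Otimes>\<^sub>M \<mu>)) + (\<integral>\<^sup>+p. ?e (?Q p) \<partial>(\<mu> \<Otimes>\<^sub>M \<mu>)))"
      by (subst nn_integral_cmult, measurable) (simp add: nn_integral_add)
    also have "\<dots> \<le> ennreal (3 ^ (2 * n)) * (ennreal (C1 * sqrt (b - a) ^ n) + ennreal (C1 * sqrt (b - a) ^ n) + ennreal (C2 * sqrt (b - a) ^ n))"
    proof (intro mult_left_mono add_mono)
      \<comment> \<open>The occupation of \<open>(a,b]\<close> has twice the required power of
        \<open>sqrt (b - a)\<close>; the surplus is absorbed into \<open>sqrt T ^ n\<close>.\<close>
      have "fact (2 * n) * sqrt (b - a) ^ (2 * n) \<le> C1 * sqrt (b - a) ^ n"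
      proof -
        have "sqrt (b - a) ^ (2 * n) = sqrt (b - a) ^ n * sqrt (b - a) ^ n" by (simp add: mult_2 power_add)
        also have "\<dots> \<le> sqrt T ^ n * sqrt (b - a) ^ n" using ab by (intro mult_right_mono power_mono) auto
        finally show ?thesis by (simp add: C1_def mult.assoc)
      qed
      then have *: "(\<integral>\<^sup>+w. ?e (occ_time f a b w) \<partial>\<mu>) \<le> ennreal (C1 * sqrt (b - a) ^ n)"
        by (intro order_trans[OF nn_integral_occ_time_le[OF f f0 fB F ab(1) ab' ab(3), of n]] ennreal_leI)
      then show "(\<integral>\<^sup>+p. ?e (occ_time f a b (fst p)) \<partial>(\<mu> \<Otimes>\<^sub>M \<mu>)) \<le> ennreal (C1 * sqrt (b - a) ^ n)"
        using nn_integral_fst_pair[of "\<lambda>w. ?e (occ_time f a b w)"] by simp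
      show "(\<integral>\<^sup>+p. ?e (occ_time f a b (path_splice T a b p)) \<partial>(\<mu> \<Otimes>\<^sub>M \<mu>)) \<le> ennreal (C1 * sqrt (b - a) ^ n)"
        using * nn_integral_splice[of "\<lambda>w. ?e (occ_time f a b w)" a b] ab by simp
      show "(\<integral>\<^sup>+p. ?e (?Q p) \<partial>(\<mu> \<Otimes>\<^sub>M \<mu>)) \<le> ennreal (C2 * sqrt (b - a) ^ n)"
        unfolding C2_def by (rule nn_integral_occ_shift_le[OF f f0 fB F ab])
    qed auto
    also have "\<dots> = ennreal (C * sqrt (b - a) ^ n)"
      using C12 ab by (simp add: C_def ennreal_plus[symmetric] ennreal_mult[symmetric] algebra_simps del: ennreal_plus)
    finally show "(\<integral>\<^sup>+p. ?e (occ_time f 0 T (fst p) - occ_time f 0 T (path_splice T a b p)) \<partial>(\<mu> \<Otimes>\<^sub>M \<mu>)) \<le> ennreal (C * sqrt (b - a) ^ n)" .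
  qed
qed

lemma emeasure_increment_ge:
  assumes b: "0 < b" "b \<le> T" and a: "\<And>x. x \<in> {a..a + sqrt b} \<Longrightarrow> \<bar>x\<bar> \<le> 2 * sqrt b"
  shows "ennreal (exp (- 2) / sqrt (2 * pi)) \<le> (\<integral>\<^sup>+w. indicator {a..a + sqrt b} (w b - w 0) \<partial>\<mu>)"
proof -
  have m: "(\<lambda>w. w b - w 0) \<in> borel_measurable \<mu>"
    using b by (intro borel_measurable_diff measurable_eval) auto
  have "ennreal (exp (- 2) / sqrt (2 * pi)) \<le> emeasure (gaussian b) {a..a + sqrt b}"
    using b a by (intro emeasure_gaussian_ge) auto
  also have "\<dots> = (\<integral>\<^sup>+x. indicator {a..a + sqrt b} x \<partial>gaussian b)" by simp
  also have "gaussian b = distr \<mu> borel (\<lambda>w. w b - w 0)" using distr_increment[of 0 b] b by simp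
  also have "(\<integral>\<^sup>+x. indicator {a..a + sqrt b} x \<partial>distr \<mu> borel (\<lambda>w. w b - w 0)) = (\<integral>\<^sup>+w. indicator {a..a + sqrt b} (w b - w 0) \<partial>\<mu>)"
    by (rule nn_integral_distr[OF m]) auto
  finally show ?thesis .
qed

text \<open>The integral is restricted to the event that the increment of the first path over
  \<open>[0,b]\<close> lies in \<open>[- sqrt b, 0]\<close> and that of the second in
  \<open>[sqrt b, 2 * sqrt b]\<close>. Independence gives probability at least
  \<open>q\<^sup>2\<close>, and there the dipole length is comparable to \<open>sqrt b\<close> and
  positive.\<close>

lemma nn_integral_occ_shift_ge:
  fixes \<alpha> \<epsilon> b :: real
  assumes e: "0 < \<epsilon>" "8 * \<epsilon> \<le> sqrt b" and b: "0 < b" "b \<le> T / 72"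
  defines "c \<equiv> T / 256 * (exp (- 2 * (\<bar>\<alpha>\<bar> + 2 * sqrt T)\<^sup>2 / T) / sqrt (2 * pi * T))"
    and "q \<equiv> exp (- 2) / sqrt (2 * pi)"
  shows "ennreal (c * q\<^sup>2 * sqrt b) \<le>
    (\<integral>\<^sup>+p. ennreal (occ (\<lambda>y. window \<alpha> \<epsilon> y - window \<alpha> \<epsilon> (y + shift_diff 0 b p)) b T (fst p b) (fst p) ^ 2) \<partial>(\<mu> \<Otimes>\<^sub>M \<mu>))"
proof -
  have c: "0 \<le> c" using T_pos by (simp add: c_def)
  have q: "0 \<le> q" by (simp add: q_def)
  have bT: "b \<le> T" using b T_pos by simp
  have sb: "sqrt b \<le> sqrt T" using bT by simp
  define I where "I a w = (indicator {a..a + sqrt b} (w b - w 0) :: ennreal)" for a and w :: "real \<Rightarrow> real"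
  have mI [measurable]: "I a \<in> borel_measurable \<mu>" for a
  proof -
    have m: "(\<lambda>w. w b - w 0) \<in> borel_measurable \<mu>"
      using b bT by (intro borel_measurable_diff measurable_eval) auto
    show ?thesis unfolding I_def by (rule measurable_compose[OF m]) simp
  qed
  have I1: "ennreal q \<le> (\<integral>\<^sup>+w. I (- sqrt b) w \<partial>\<mu>)" and I2: "ennreal q \<le> (\<integral>\<^sup>+w. I (sqrt b) w \<partial>\<mu>)"
    unfolding q_def I_def using b bT by (intro emeasure_increment_ge; auto)+
  have "ennreal (c * q\<^sup>2 * sqrt b) = ennreal (c * sqrt b) * (ennreal q * ennreal q)"
    using c q b by (simp add: ennreal_mult[symmetric] power2_eq_square mult_ac)
  also have "\<dots> \<le> ennreal (c * sqrt b) * ((\<integral>\<^sup>+w. I (- sqrt b) w \<partial>\<mu>) * (\<integral>\<^sup>+w. I (sqrt b) w \<partial>\<mu>))"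
    by (intro mult_left_mono mult_mono I1 I2) auto
  also have "\<dots> = (\<integral>\<^sup>+w'. \<integral>\<^sup>+w. ennreal (c * sqrt b) * (I (- sqrt b) w * I (sqrt b) w') \<partial>\<mu> \<partial>\<mu>)"
    by (simp add: nn_integral_cmult nn_integral_multc)
  also have "\<dots> \<le> (\<integral>\<^sup>+w'. \<integral>\<^sup>+w. ennreal (occ_moment (\<lambda>y. window \<alpha> \<epsilon> y - window \<alpha> \<epsilon> (y + shift_diff 0 b (w, w'))) (2 * 1) b T (w b)) \<partial>\<mu> \<partial>\<mu>)"
  proof (rule nn_integral_mono, rule nn_integral_mono_AE)
    fix w'
    show "AE w in \<mu>. ennreal (c * sqrt b) * (I (- sqrt b) w * I (sqrt b) w') \<le>
      ennreal (occ_moment (\<lambda>y. window \<alpha> \<epsilon> y - window \<alpha> \<epsilon> (y + shift_diff 0 b (w, w'))) (2 * 1) b T (w b))"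
      using AE_start
    proof eventually_elim
      case (elim w)
      show ?case
      proof (cases "w b - w 0 \<in> {- sqrt b..- sqrt b + sqrt b} \<and> w' b - w' 0 \<in> {sqrt b..sqrt b + sqrt b}")
        case True
        define d where "d = shift_diff 0 b (w, w')"
        have d: "sqrt b \<le> d" "d \<le> 3 * sqrt b" using True by (auto simp: d_def shift_diff_def)
        \<comment> \<open>This is where the bound \<open>T / 72\<close> comes from:
          \<open>9 * b \<le> T / 8\<close>.\<close>
        have "d\<^sup>2 \<le> (3 * sqrt b)\<^sup>2" using d b by (intro power_mono) auto
        also have "\<dots> \<le> T / 8" using b by (simp add: power_mult_distrib)
        finally have d2: "d\<^sup>2 \<le> T / 8" .
        have "- sqrt b \<le> w b" "w b \<le> 0" using True elim by auto
        then have w: "\<bar>w b\<bar> \<le> sqrt T" using sb by linarith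
        have "c * d \<le> occ_moment (\<lambda>y. window \<alpha> \<epsilon> y - window \<alpha> \<epsilon> (y + d)) 2 b T (w b)"
          unfolding c_def
        proof (rule occ_moment_dipole_ge[OF e(1)])
          have "\<epsilon> \<le> sqrt T" using e sb by linarith
          then show "\<bar>\<alpha>\<bar> + \<bar>w b\<bar> + \<epsilon> \<le> \<bar>\<alpha>\<bar> + 2 * sqrt T" using w by linarith
        qed (use b d d2 e T_pos in auto)
        moreover have "c * sqrt b \<le> c * d" using d c by (intro mult_left_mono) auto
        ultimately show ?thesis using True by (simp add: I_def d_def ennreal_leI)
      next
        case False
        then show ?thesis by (auto simp: I_def indicator_def)
      qed
    qed
  qed
  also have "\<dots> = (\<integral>\<^sup>+p. ennreal (occ (\<lambda>y. window \<alpha> \<epsilon> y - window \<alpha> \<epsilon> (y + shift_diff 0 b p)) b T (fst p b) (fst p) ^ (2 * 1)) \<partial>(\<mu> \<Otimes>\<^sub>M \<mu>))"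
    using b bT e
    by (intro nn_integral_occ_shift[symmetric, where B="1 / (2 * \<epsilon>)"] window_nonneg window_le) auto
  finally show ?thesis by simp
qed

text \<open>The decomposition is solved for the part after \<open>b\<close>, whose second moment is
  at least \<open>c0 * sqrt b\<close>. The two occupations of \<open>(0,b]\<close> have second
  moments at most \<open>2 * b\<close> each, of lower order as \<open>b\<close> tends to 0.\<close>

lemma nn_integral_occ_time_diff_splice_ge:
  "\<exists>c>0. \<exists>b0>0. b0 \<le> T \<and> (\<forall>b \<epsilon>. 0 < b \<longrightarrow> b \<le> b0 \<longrightarrow> 0 < \<epsilon> \<longrightarrow> 8 * \<epsilon> \<le> sqrt b \<longrightarrow>
     ennreal (c * sqrt b) \<le> (\<integral>\<^sup>+p. ennreal ((occ_time (window \<alpha> \<epsilon>) 0 T (fst p) -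
        occ_time (window \<alpha> \<epsilon>) 0 T (path_splice T 0 b p))\<^sup>2) \<partial>(\<mu> \<Otimes>\<^sub>M \<mu>)))"
proof -
  define c0 where "c0 = T / 256 * (exp (- 2 * (\<bar>\<alpha>\<bar> + 2 * sqrt T)\<^sup>2 / T) / sqrt (2 * pi * T)) * (exp (- 2) / sqrt (2 * pi))\<^sup>2"
  have c0: "0 < c0" using T_pos by (simp add: c0_def)
  \<comment> \<open>With the factor 9 for three summands, the loss is \<open>36 * b\<close>; it is
    at most half of \<open>c0 * sqrt b\<close> once \<open>sqrt b \<le> c0 / 72\<close>. Dividing
    what is left by 9 gives the constant \<open>c0 / 18\<close>.\<close>
  define b0 where "b0 = min (T / 72) ((c0 / 72)\<^sup>2)"
  have b0: "0 < b0" "b0 \<le> T" using T_pos c0 by (auto simp: b0_def)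
  have "ennreal (c0 / 18 * sqrt b) \<le> (\<integral>\<^sup>+p. ennreal ((occ_time (window \<alpha> \<epsilon>) 0 T (fst p) -
        occ_time (window \<alpha> \<epsilon>) 0 T (path_splice T 0 b p))\<^sup>2) \<partial>(\<mu> \<Otimes>\<^sub>M \<mu>))" (is "_ \<le> ?X")
    if b: "0 < b" "b \<le> b0" and e: "0 < \<epsilon>" "8 * \<epsilon> \<le> sqrt b" for b \<epsilon>
  proof -
    let ?f = "window \<alpha> \<epsilon>"
    have ab: "0 \<le> (0::real)" "0 \<le> b" "b \<le> T" using b b0 by auto
    have b72: "b \<le> T / 72" using b by (simp add: b0_def)
    have fa: "\<bar>?f y\<bar> \<le> 1 / (2 * \<epsilon>)" for y using window_nonneg[OF e(1)] window_le[OF e(1)] by (simp add: abs_of_nonneg)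
    let ?Q = "\<lambda>p. occ (\<lambda>y. ?f y - ?f (y + shift_diff 0 b p)) b T (fst p b) (fst p)"
    let ?D = "\<lambda>p. occ_time ?f 0 T (fst p) - occ_time ?f 0 T (path_splice T 0 b p)"
    have [measurable]: "?Q \<in> borel_measurable (\<mu> \<Otimes>\<^sub>M \<mu>)" by (rule measurable_occ_shift[OF measurable_window ab])
    have [measurable]: "path_splice T 0 b \<in> measurable (\<mu> \<Otimes>\<^sub>M \<mu>) \<mu>"
      using measurable_splice[OF ab] by measurable
    let ?e = "\<lambda>x :: real. ennreal (x ^ (2 * 1))"
    have "ennreal (c0 * sqrt b) \<le> (\<integral>\<^sup>+p. ?e (?Q p) \<partial>(\<mu> \<Otimes>\<^sub>M \<mu>))"
      using nn_integral_occ_shift_ge[OF e b(1) b72, of \<alpha>] by (simp add: c0_def)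
    also have "\<dots> \<le> (\<integral>\<^sup>+p. ennreal (3 ^ (2 * 1)) * (?e (?D p) + ?e (occ_time ?f 0 b (fst p)) + ?e (occ_time ?f 0 b (path_splice T 0 b p))) \<partial>(\<mu> \<Otimes>\<^sub>M \<mu>))"
    proof (rule nn_integral_mono)
      fix p assume "p \<in> space (\<mu> \<Otimes>\<^sub>M \<mu>)"
      then have "?Q p = ?D p - occ_time ?f 0 b (fst p) + occ_time ?f 0 b (path_splice T 0 b p)"
        using occ_time_diff_splice[OF measurable_window fa ab, of p] by simp
      then show "?e (?Q p) \<le> ennreal (3 ^ (2 * 1)) * (?e (?D p) + ?e (occ_time ?f 0 b (fst p)) + ?e (occ_time ?f 0 b (path_splice T 0 b p)))"
        by (simp only: ennreal_even_power_add3_le)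
    qed
    also have "\<dots> = ennreal (3 ^ (2 * 1)) * ((\<integral>\<^sup>+p. ?e (?D p) \<partial>(\<mu> \<Otimes>\<^sub>M \<mu>)) + (\<integral>\<^sup>+p. ?e (occ_time ?f 0 b (fst p)) \<partial>(\<mu> \<Otimes>\<^sub>M \<mu>)) +
        (\<integral>\<^sup>+p. ?e (occ_time ?f 0 b (path_splice T 0 b p)) \<partial>(\<mu> \<Otimes>\<^sub>M \<mu>)))"
      by (subst nn_integral_cmult, measurable) (simp add: nn_integral_add)
    also have "\<dots> \<le> ennreal (3 ^ (2 * 1)) * (?X + ennreal (2 * b) + ennreal (2 * b))"
    proof (intro mult_left_mono add_mono)
      have *: "(\<integral>\<^sup>+w. ?e (occ_time ?f 0 b w) \<partial>\<mu>) \<le> ennreal (2 * b)"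
        using nn_integral_occ_time_le[OF measurable_window window_nonneg[OF e(1)] window_le[OF e(1)] _ ab, of \<alpha> 1]
          nn_integral_window[OF e(1), of \<alpha>] b by (simp add: fact_2)
      then show "(\<integral>\<^sup>+p. ?e (occ_time ?f 0 b (fst p)) \<partial>(\<mu> \<Otimes>\<^sub>M \<mu>)) \<le> ennreal (2 * b)"
        using nn_integral_fst_pair[of "\<lambda>w. ?e (occ_time ?f 0 b w)"] by simp
      show "(\<integral>\<^sup>+p. ?e (occ_time ?f 0 b (path_splice T 0 b p)) \<partial>(\<mu> \<Otimes>\<^sub>M \<mu>)) \<le> ennreal (2 * b)"
        using * nn_integral_splice[of "\<lambda>w. ?e (occ_time ?f 0 b w)" 0 b] ab by simp
    qed auto
    finally have main: "ennreal (c0 * sqrt b) \<le> ennreal (3 ^ (2 * 1)) * (?X + ennreal (2 * b) + ennreal (2 * b))" .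
    show ?thesis
    proof (cases ?X)
      case (real x)
      have "c0 * sqrt b \<le> 9 * (x + 2 * b + 2 * b)"
      proof -
        have "ennreal (3 ^ (2 * 1)) * (ennreal x + ennreal (2 * b) + ennreal (2 * b)) = ennreal (3 ^ (2 * 1) * (x + 2 * b + 2 * b))"
        proof -
          have "0 \<le> x" "0 \<le> b" "0 \<le> x + 2 * b" "0 \<le> x + 2 * b + 2 * b" "0 \<le> 2 * b" using real b by auto
          then show ?thesis by (simp only: ennreal_plus ennreal_mult zero_le_power zero_le_numeral)
        qed
        then have "ennreal (c0 * sqrt b) \<le> ennreal (3 ^ (2 * 1) * (x + 2 * b + 2 * b))"
          using main real by simp
        then show ?thesis using real b by (subst (asm) ennreal_le_iff) auto
      qed
      moreover have "72 * b \<le> c0 * sqrt b"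
      proof -
        have "b \<le> (c0 / 72)\<^sup>2" using b by (simp add: b0_def)
        then have "sqrt b \<le> sqrt ((c0 / 72)\<^sup>2)" by (rule real_sqrt_le_mono)
        also have "\<dots> = c0 / 72" using c0 by simp
        finally have "sqrt b * sqrt b \<le> c0 / 72 * sqrt b" using b by (intro mult_right_mono) auto
        then show ?thesis using b by simp
      qed
      ultimately have "c0 / 18 * sqrt b \<le> x" by simp
      then show ?thesis using real by (simp add: ennreal_leI)
    qed simp
  qed
  then show ?thesis using c0 b0 by (intro exI[of _ "c0 / 18"] conjI exI[of _ b0]) auto
qed

end

subsection \<open>Passage to the local time\<close>

text \<open>Fatou's lemma in the form used for both bounds. The integrals need to be controlled only
  eventually, since the lower estimate holds once the interval is narrow compared with
  \<open>sqrt b\<close>.\<close>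

lemma nn_integral_limit_le:
  fixes u :: "nat \<Rightarrow> 'a \<Rightarrow> ennreal"
  assumes "\<And>n. u n \<in> borel_measurable N" and lim: "AE x in N. (\<lambda>n. u n x) \<longlonglongrightarrow> v x"
    and le: "eventually (\<lambda>n. (\<integral>\<^sup>+x. u n x \<partial>N) \<le> K) sequentially"
  shows "(\<integral>\<^sup>+x. v x \<partial>N) \<le> K"
proof -
  have "(\<integral>\<^sup>+x. v x \<partial>N) = (\<integral>\<^sup>+x. liminf (\<lambda>n. u n x) \<partial>N)"
    proof (rule nn_integral_cong_AE)
    show "AE x in N. v x = liminf (\<lambda>n. u n x)"
      using lim by eventually_elim (simp add: lim_imp_Liminf)
  qed
  also have "\<dots> \<le> liminf (\<lambda>n. \<integral>\<^sup>+x. u n x \<partial>N)"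
    by (rule nn_integral_liminf) fact
  also have "\<dots> \<le> liminf (\<lambda>n. K)" by (rule Liminf_mono[OF le])
  also have "\<dots> = K" by (simp add: Liminf_const)
  finally show ?thesis .
qed

text \<open>A pointwise replacement for comparing norms of different exponents: below the level
  \<open>l\<close> the first term dominates, above it the second. With \<open>l\<close> of the
  typical size of the random variable, both terms have the same order.\<close>

lemma powr_le_interpolate:
  assumes "0 \<le> x" "0 < l" "0 < q" "q \<le> real (2 * n)"
  shows "x powr q \<le> l powr q + l powr (q - real (2 * n)) * x ^ (2 * n)"
proof (cases "x \<le> l")
  case True
  then have "x powr q \<le> l powr q" using assms by (intro powr_mono2) auto
  also have "\<dots> \<le> l powr q + l powr (q - real (2 * n)) * x ^ (2 * n)" using assms by simp
  finally show ?thesis .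
next
  case False
  then have x: "0 < x" using assms by simp
  have "x powr q = x powr (q - real (2 * n)) * x ^ (2 * n)"
    using x by (simp add: powr_diff powr_realpow[symmetric] del: of_nat_mult)
  also have "\<dots> \<le> l powr (q - real (2 * n)) * x ^ (2 * n)"
    using False assms by (intro mult_right_mono powr_mono2') auto
  also have "\<dots> \<le> l powr q + l powr (q - real (2 * n)) * x ^ (2 * n)" by simp
  finally show ?thesis .
qed

text \<open>Bounds a small moment from below by the second and the fourth one, in terms of the
  nonnegative function \<open>1 - y\<^sup>2 + y\<^sup>4\<close>, so that Fatou's lemma applies.\<close>

lemma powr_ge_quartic:
  fixes y q \<tau> :: real
  assumes "0 < q" "0 < \<tau>"
  shows "\<tau> powr q \<le> \<bar>y\<bar> powr q + \<tau> powr q * (1 - y\<^sup>2 + y ^ 4) + \<tau> powr q * \<tau>\<^sup>2"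
proof -
  have p: "0 \<le> \<tau> powr q" by simp
  show ?thesis
  proof (cases "\<bar>y\<bar> \<le> \<tau>")
    case True
    then have "y\<^sup>2 \<le> \<tau>\<^sup>2" using abs_le_square_iff[of y \<tau>] assms by simp
    then have "1 \<le> (1 - y\<^sup>2 + y ^ 4) + \<tau>\<^sup>2" by (smt (verit) zero_le_even_power even_numeral)
    then have "\<tau> powr q * 1 \<le> \<tau> powr q * ((1 - y\<^sup>2 + y ^ 4) + \<tau>\<^sup>2)" by (intro mult_left_mono p)
    moreover have "0 \<le> \<bar>y\<bar> powr q" by simp
    ultimately show ?thesis unfolding distrib_left by linarith
  next
    case False
    have "0 \<le> (1 / 2 - y\<^sup>2)\<^sup>2" by simp
    then have "0 \<le> 1 - y\<^sup>2 + y ^ 4" by (simp add: power2_eq_square power4_eq_xxxx algebra_simps)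
    then have "0 \<le> \<tau> powr q * (1 - y\<^sup>2 + y ^ 4) + \<tau> powr q * \<tau>\<^sup>2" by simp
    moreover have "\<tau> powr q \<le> \<bar>y\<bar> powr q" using False assms by (intro powr_mono2) auto
    ultimately show ?thesis by linarith
  qed
qed

lemma Lp_norm_le:
  assumes "0 < p" "0 \<le> x" "(\<integral>\<^sup>+z. ennreal (\<bar>f z\<bar> powr p) \<partial>N) \<le> ennreal (x powr p)"
  shows "Lp_norm N p f \<le> ennreal x"
proof (cases "\<integral>\<^sup>+z. ennreal (\<bar>f z\<bar> powr p) \<partial>N")
  case (real i)
  then have "i \<le> x powr p" using assms by simp
  then have "i powr (1 / p) \<le> (x powr p) powr (1 / p)" using real assms by (intro powr_mono2) auto
  also have "\<dots> = x" using assms by (simp add: powr_powr)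
  finally show ?thesis using real by (simp add: Lp_norm_def ennreal_leI)
next
  case top
  then show ?thesis using assms by (simp add: top_unique)
qed

lemma Lp_norm_ge:
  assumes "0 < p" "0 \<le> x" "ennreal (x powr p) \<le> (\<integral>\<^sup>+z. ennreal (\<bar>f z\<bar> powr p) \<partial>N)"
  shows "ennreal x \<le> Lp_norm N p f"
proof (cases "\<integral>\<^sup>+z. ennreal (\<bar>f z\<bar> powr p) \<partial>N")
  case (real i)
  then have "x powr p \<le> i" using assms by simp
  then have "(x powr p) powr (1 / p) \<le> i powr (1 / p)" using assms by (intro powr_mono2) auto
  moreover have "(x powr p) powr (1 / p) = x" using assms by (simp add: powr_powr)
  ultimately show ?thesis using real by (simp add: Lp_norm_def ennreal_leI)
next
  case top
  then show ?thesis by (simp add: Lp_norm_def)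
qed

context wiener_measure
begin

section \<open>The local time as a functional on path space\<close>

definition approx_lt :: "real \<Rightarrow> nat \<Rightarrow> (real \<Rightarrow> real) \<Rightarrow> real" where
  "approx_lt \<alpha> n = occ_time (window \<alpha> (1 / real (Suc n))) 0 T"

text \<open>The functional \<open>F\<close> representing the local time. Where the sequence
  diverges, \<open>lim\<close> has an unspecified value; under the convergence assumption below this
  concerns a null set only.\<close>

definition path_lt :: "real \<Rightarrow> (real \<Rightarrow> real) \<Rightarrow> real" where
  "path_lt \<alpha> w = lim (\<lambda>n. approx_lt \<alpha> n w)"

lemma measurable_approx_lt [measurable]: "approx_lt \<alpha> n \<in> borel_measurable \<mu>"
  unfolding approx_lt_def by measurable

lemma measurable_path_lt [measurable]: "path_lt \<alpha> \<in> borel_measurable \<mu>"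
  unfolding path_lt_def by measurable

lemma AE_pair_fst: "AE w in \<mu>. P w \<Longrightarrow> AE p in \<mu> \<Otimes>\<^sub>M \<mu>. P (fst p)"
  by (intro AE_distrD[OF measurable_fst, of P \<mu> \<mu>]) (simp only: distr_pair_fst)

lemma AE_pair_splice:
  assumes "AE w in \<mu>. P w" "0 \<le> a" "a \<le> b" "b \<le> T"
  shows "AE p in \<mu> \<Otimes>\<^sub>M \<mu>. P (path_splice T a b p)"
proof -
  have m: "path_splice T a b \<in> measurable (\<mu> \<Otimes>\<^sub>M \<mu>) (path_space T)"
    using measurable_splice[OF assms(2-4)] by measurable
  show ?thesis using assms(1) by (intro AE_distrD[OF m]) (simp only: distr_splice[OF assms(2-4)])
qed

context
  fixes \<alpha> :: real
  assumes conv: "AE w in \<mu>. convergent (\<lambda>n. approx_lt \<alpha> n w)"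
begin

text \<open>Existence of the limit is an assumption of the surrounding context; it is discharged
  later from the given local time.\<close>

lemma AE_path_lt: "AE w in \<mu>. (\<lambda>n. approx_lt \<alpha> n w) \<longlonglongrightarrow> path_lt \<alpha> w"
  using conv unfolding path_lt_def by eventually_elim (simp add: convergent_LIMSEQ_iff)

lemma AE_path_lt_diff:
  assumes "0 \<le> a" "a \<le> b" "b \<le> T"
  shows "AE p in \<mu> \<Otimes>\<^sub>M \<mu>. (\<lambda>n. approx_lt \<alpha> n (fst p) - approx_lt \<alpha> n (path_splice T a b p))
     \<longlonglongrightarrow> path_lt \<alpha> (fst p) - path_lt \<alpha> (path_splice T a b p)"
  using AE_pair_fst[OF AE_path_lt] AE_pair_splice[OF AE_path_lt assms]
  by eventually_elim (rule tendsto_diff)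

lemma measurable_approx_diff:
  assumes "0 \<le> a" "a \<le> b" "b \<le> T"
  shows "(\<lambda>p. approx_lt \<alpha> n (fst p) - approx_lt \<alpha> n (path_splice T a b p)) \<in> borel_measurable (\<mu> \<Otimes>\<^sub>M \<mu>)"
    and "(\<lambda>p. path_lt \<alpha> (fst p) - path_lt \<alpha> (path_splice T a b p)) \<in> borel_measurable (\<mu> \<Otimes>\<^sub>M \<mu>)"
proof -
  have [measurable]: "path_splice T a b \<in> measurable (\<mu> \<Otimes>\<^sub>M \<mu>) \<mu>"
    using measurable_splice[OF assms] by measurable
  show "(\<lambda>p. approx_lt \<alpha> n (fst p) - approx_lt \<alpha> n (path_splice T a b p)) \<in> borel_measurable (\<mu> \<Otimes>\<^sub>M \<mu>)"
    "(\<lambda>p. path_lt \<alpha> (fst p) - path_lt \<alpha> (path_splice T a b p)) \<in> borel_measurable (\<mu> \<Otimes>\<^sub>M \<mu>)"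
    by measurable
qed

lemma nn_integral_path_lt_finite:
  assumes q: "0 < q"
  shows "(\<integral>\<^sup>+w. ennreal (\<bar>path_lt \<alpha> w\<bar> powr q) \<partial>\<mu>) < \<infinity>"
proof -
  obtain n :: nat where n: "q \<le> real n" using real_arch_simple by blast
  have qn: "q \<le> real (2 * n)" using n by simp
  have "(\<integral>\<^sup>+w. ennreal (path_lt \<alpha> w ^ (2 * n)) \<partial>\<mu>) \<le> ennreal (fact (2 * n) * sqrt (T - 0) ^ (2 * n))"
  proof (rule nn_integral_limit_le[where u="\<lambda>k w. ennreal (approx_lt \<alpha> k w ^ (2 * n))"])
    show "AE w in \<mu>. (\<lambda>k. ennreal (approx_lt \<alpha> k w ^ (2 * n))) \<longlonglongrightarrow> ennreal (path_lt \<alpha> w ^ (2 * n))"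
      using AE_path_lt by eventually_elim (intro tendsto_ennrealI tendsto_power)
    show "\<forall>\<^sub>F k in sequentially. (\<integral>\<^sup>+w. ennreal (approx_lt \<alpha> k w ^ (2 * n)) \<partial>\<mu>) \<le> ennreal (fact (2 * n) * sqrt (T - 0) ^ (2 * n))"
    proof (intro always_eventually allI)
      fix k
      have e: "0 < 1 / real (Suc k)" by simp
      show "(\<integral>\<^sup>+w. ennreal (approx_lt \<alpha> k w ^ (2 * n)) \<partial>\<mu>) \<le> ennreal (fact (2 * n) * sqrt (T - 0) ^ (2 * n))"
        unfolding approx_lt_def
        by (rule nn_integral_occ_time_le[OF measurable_window window_nonneg[OF e] window_le[OF e]])
          (use T_pos in \<open>simp_all add: nn_integral_window[OF e] del: of_nat_Suc\<close>)
    qed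
  qed measurable
  then have fin: "(\<integral>\<^sup>+w. ennreal (path_lt \<alpha> w ^ (2 * n)) \<partial>\<mu>) < \<infinity>"
    by (rule order_le_less_trans) simp
  have "(\<integral>\<^sup>+w. ennreal (\<bar>path_lt \<alpha> w\<bar> powr q) \<partial>\<mu>) \<le> (\<integral>\<^sup>+w. 1 + ennreal (path_lt \<alpha> w ^ (2 * n)) \<partial>\<mu>)"
  proof (rule nn_integral_mono)
    fix w
    have "\<bar>path_lt \<alpha> w\<bar> powr q \<le> 1 + path_lt \<alpha> w ^ (2 * n)"
      using powr_le_interpolate[OF _ zero_less_one q qn, of "\<bar>path_lt \<alpha> w\<bar>"] by (simp add: power_even_abs)
    then have "ennreal (\<bar>path_lt \<alpha> w\<bar> powr q) \<le> ennreal (1 + path_lt \<alpha> w ^ (2 * n))" by (rule ennreal_leI)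
    also have "\<dots> = 1 + ennreal (path_lt \<alpha> w ^ (2 * n))" by (subst ennreal_plus) (auto simp: power_mult)
    finally show "ennreal (\<bar>path_lt \<alpha> w\<bar> powr q) \<le> 1 + ennreal (path_lt \<alpha> w ^ (2 * n))" .
  qed
  also have "\<dots> = 1 + (\<integral>\<^sup>+w. ennreal (path_lt \<alpha> w ^ (2 * n)) \<partial>\<mu>)"
    by (simp add: nn_integral_add emeasure_space_1)
  also have "\<dots> < \<infinity>" using fin by simp
  finally show ?thesis .
qed

lemma nn_integral_approx_diff_le:
  "\<exists>C\<ge>0. \<forall>k a b. 0 \<le> a \<longrightarrow> a < b \<longrightarrow> b \<le> T \<longrightarrow>
    (\<integral>\<^sup>+p. ennreal ((approx_lt \<alpha> k (fst p) - approx_lt \<alpha> k (path_splice T a b p)) ^ (2 * n)) \<partial>(\<mu> \<Otimes>\<^sub>M \<mu>))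
      \<le> ennreal (C * sqrt (b - a) ^ n)"
proof -
  obtain C where C: "0 \<le> C" and le: "\<And>f B a b. f \<in> borel_measurable borel \<Longrightarrow> (\<forall>y. 0 \<le> f y \<and> f y \<le> B) \<Longrightarrow>
     (\<integral>\<^sup>+y. ennreal (f y) \<partial>lborel) \<le> 1 \<Longrightarrow> 0 \<le> a \<Longrightarrow> a < b \<Longrightarrow> b \<le> T \<Longrightarrow>
     (\<integral>\<^sup>+p. ennreal ((occ_time f 0 T (fst p) - occ_time f 0 T (path_splice T a b p)) ^ (2 * n)) \<partial>(\<mu> \<Otimes>\<^sub>M \<mu>))
       \<le> ennreal (C * sqrt (b - a) ^ n)"
    using nn_integral_occ_time_diff_splice_le[of n] by blast
  show ?thesis
  proof (intro exI[of _ C] conjI allI impI C)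
    fix k a b assume ab: "0 \<le> a" "a < b" "b \<le> T"
    let ?\<epsilon> = "1 / real (Suc k)"
    have e: "0 < ?\<epsilon>" by simp
    show "(\<integral>\<^sup>+p. ennreal ((approx_lt \<alpha> k (fst p) - approx_lt \<alpha> k (path_splice T a b p)) ^ (2 * n)) \<partial>(\<mu> \<Otimes>\<^sub>M \<mu>))
      \<le> ennreal (C * sqrt (b - a) ^ n)"
      unfolding approx_lt_def
    proof (rule le[OF measurable_window _ _ ab])
      show "\<forall>y. 0 \<le> window \<alpha> ?\<epsilon> y \<and> window \<alpha> ?\<epsilon> y \<le> 1 / (2 * ?\<epsilon>)"
        using window_nonneg[OF e] window_le[OF e] by blast
      show "(\<integral>\<^sup>+y. ennreal (window \<alpha> ?\<epsilon> y) \<partial>lborel) \<le> 1" unfolding nn_integral_window[OF e] ..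
    qed
  qed
qed

lemma nn_integral_path_lt_diff_le:
  assumes q: "0 < q"
  shows "\<exists>C\<ge>0. \<forall>a b. 0 \<le> a \<longrightarrow> a < b \<longrightarrow> b \<le> T \<longrightarrow>
    (\<integral>\<^sup>+p. ennreal (\<bar>path_lt \<alpha> (fst p) - path_lt \<alpha> (path_splice T a b p)\<bar> powr q) \<partial>(\<mu> \<Otimes>\<^sub>M \<mu>))
      \<le> ennreal (C * (b - a) powr (q / 4))"
proof -
  obtain n :: nat where n: "q \<le> real n" using real_arch_simple by blast
  have qn: "q \<le> real (2 * n)" using n by simp
  obtain C where C: "0 \<le> C" and le: "\<And>k a b. 0 \<le> a \<Longrightarrow> a < b \<Longrightarrow> b \<le> T \<Longrightarrow>
    (\<integral>\<^sup>+p. ennreal ((approx_lt \<alpha> k (fst p) - approx_lt \<alpha> k (path_splice T a b p)) ^ (2 * n)) \<partial>(\<mu> \<Otimes>\<^sub>M \<mu>))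
      \<le> ennreal (C * sqrt (b - a) ^ n)"
    using nn_integral_approx_diff_le[of n] by blast
  show ?thesis
  proof (intro exI[of _ "1 + C"] conjI allI impI)
    show "0 \<le> 1 + C" using C by simp
    fix a b assume ab: "0 \<le> a" "a < b" "b \<le> T"
    have ab': "a \<le> b" using ab by simp
    let ?D = "\<lambda>p. path_lt \<alpha> (fst p) - path_lt \<alpha> (path_splice T a b p)"
    note m = measurable_approx_diff[OF ab(1) ab' ab(3)]
    have [measurable]: "?D \<in> borel_measurable (\<mu> \<Otimes>\<^sub>M \<mu>)" by (rule m(2))
    have D: "(\<integral>\<^sup>+p. ennreal (?D p ^ (2 * n)) \<partial>(\<mu> \<Otimes>\<^sub>M \<mu>)) \<le> ennreal (C * sqrt (b - a) ^ n)"
    proof (rule nn_integral_limit_le[where u="\<lambda>k p. ennreal ((approx_lt \<alpha> k (fst p) - approx_lt \<alpha> k (path_splice T a b p)) ^ (2 * n))"])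
      show "AE p in \<mu> \<Otimes>\<^sub>M \<mu>. (\<lambda>k. ennreal ((approx_lt \<alpha> k (fst p) - approx_lt \<alpha> k (path_splice T a b p)) ^ (2 * n)))
          \<longlonglongrightarrow> ennreal (?D p ^ (2 * n))"
        using AE_path_lt_diff[OF ab(1) ab' ab(3)] by eventually_elim (intro tendsto_ennrealI tendsto_power)
    qed (use m(1) le[OF ab] in auto)
    \<comment> \<open>The typical size of the difference, for which both interpolation terms equal a
      constant times \<open>(b - a) powr (q / 4)\<close>.\<close>
    define l where "l = (b - a) powr (1 / 4)"
    have l: "0 < l" using ab by (simp add: l_def)
    have lq: "l powr q = (b - a) powr (q / 4)" by (simp add: l_def powr_powr)
    have ln: "l powr (q - real (2 * n)) * sqrt (b - a) ^ n = (b - a) powr (q / 4)"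
    proof -
      have "sqrt (b - a) ^ n = (b - a) powr (real n / 2)"
        using ab by (simp add: powr_half_sqrt[symmetric] powr_realpow[symmetric] powr_powr)
      moreover have "l powr (q - real (2 * n)) = (b - a) powr ((q - real (2 * n)) / 4)" by (simp add: l_def powr_powr)
      ultimately have "l powr (q - real (2 * n)) * sqrt (b - a) ^ n = (b - a) powr ((q - real (2 * n)) / 4 + real n / 2)"
        by (simp only: powr_add)
      also have "(q - real (2 * n)) / 4 + real n / 2 = q / 4" by (simp add: field_simps)
      finally show ?thesis .
    qed
    have "(\<integral>\<^sup>+p. ennreal (\<bar>?D p\<bar> powr q) \<partial>(\<mu> \<Otimes>\<^sub>M \<mu>)) \<le>
       (\<integral>\<^sup>+p. ennreal (l powr q) + ennreal (l powr (q - real (2 * n))) * ennreal (?D p ^ (2 * n)) \<partial>(\<mu> \<Otimes>\<^sub>M \<mu>))"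
    proof (rule nn_integral_mono)
      fix p
      have "\<bar>?D p\<bar> powr q \<le> l powr q + l powr (q - real (2 * n)) * ?D p ^ (2 * n)"
        using powr_le_interpolate[OF _ l q qn, of "\<bar>?D p\<bar>"] by (simp add: power_even_abs)
      moreover have "0 \<le> ?D p ^ (2 * n)" by (simp add: power_mult)
      ultimately show "ennreal (\<bar>?D p\<bar> powr q) \<le> ennreal (l powr q) + ennreal (l powr (q - real (2 * n))) * ennreal (?D p ^ (2 * n))"
        by (simp add: ennreal_mult[symmetric] ennreal_plus[symmetric] ennreal_leI del: ennreal_plus)
    qed
    also have "\<dots> = ennreal (l powr q) + ennreal (l powr (q - real (2 * n))) * (\<integral>\<^sup>+p. ennreal (?D p ^ (2 * n)) \<partial>(\<mu> \<Otimes>\<^sub>M \<mu>))"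
      by (simp add: nn_integral_add nn_integral_cmult pair.emeasure_space_1)
    also have "\<dots> \<le> ennreal (l powr q) + ennreal (l powr (q - real (2 * n))) * ennreal (C * sqrt (b - a) ^ n)"
      by (intro add_left_mono mult_left_mono D) auto
    also have "\<dots> = ennreal ((b - a) powr (q / 4) + C * (b - a) powr (q / 4))"
    proof -
      have "l powr (q - real (2 * n)) * (C * sqrt (b - a) ^ n) = C * (b - a) powr (q / 4)" by (simp add: ln[symmetric])
      then show ?thesis using C ab unfolding lq
        by (simp add: ennreal_mult[symmetric] ennreal_plus[symmetric] del: ennreal_plus)
    qed
    finally show "(\<integral>\<^sup>+p. ennreal (\<bar>?D p\<bar> powr q) \<partial>(\<mu> \<Otimes>\<^sub>M \<mu>)) \<le> ennreal ((1 + C) * (b - a) powr (q / 4))"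
      by (simp add: algebra_simps)
  qed
qed

text \<open>A Paley-Zygmund type argument after dividing by
  \<open>K = \<kappa> * b powr (1 / 4)\<close>. The second moment is at least of order
  \<open>sqrt b\<close> and the fourth at most of order \<open>b\<close>, so the mean of
  \<open>1 - y\<^sup>2 + y ^ 4\<close> is at most \<open>1 - \<eta>\<close> with
  \<open>\<eta>\<close> independent of \<open>b\<close>. The inequality
  \<open>powr_ge_quartic\<close> turns this gap into a lower bound for the moment of order
  \<open>q\<close>.\<close>

lemma nn_integral_path_lt_diff_ge:
  assumes q: "0 < q"
  shows "\<exists>c>0. \<exists>b0>0. b0 \<le> T \<and> (\<forall>b. 0 < b \<longrightarrow> b \<le> b0 \<longrightarrow> ennreal (c * b powr (q / 4)) \<le>
    (\<integral>\<^sup>+p. ennreal (\<bar>path_lt \<alpha> (fst p) - path_lt \<alpha> (path_splice T 0 b p)\<bar> powr q) \<partial>(\<mu> \<Otimes>\<^sub>M \<mu>)))"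
proof -
  obtain C where C: "0 \<le> C" and le: "\<And>k a b. 0 \<le> a \<Longrightarrow> a < b \<Longrightarrow> b \<le> T \<Longrightarrow>
    (\<integral>\<^sup>+p. ennreal ((approx_lt \<alpha> k (fst p) - approx_lt \<alpha> k (path_splice T a b p)) ^ (2 * 2)) \<partial>(\<mu> \<Otimes>\<^sub>M \<mu>))
      \<le> ennreal (C * sqrt (b - a) ^ 2)"
    using nn_integral_approx_diff_le[of 2] by blast
  obtain c b0 where c: "0 < c" and b0: "0 < b0" "b0 \<le> T" and ge: "\<And>b \<epsilon>. 0 < b \<Longrightarrow> b \<le> b0 \<Longrightarrow> 0 < \<epsilon> \<Longrightarrow> 8 * \<epsilon> \<le> sqrt b \<Longrightarrow>
     ennreal (c * sqrt b) \<le> (\<integral>\<^sup>+p. ennreal ((occ_time (window \<alpha> \<epsilon>) 0 T (fst p) -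
        occ_time (window \<alpha> \<epsilon>) 0 T (path_splice T 0 b p))\<^sup>2) \<partial>(\<mu> \<Otimes>\<^sub>M \<mu>))"
    using nn_integral_occ_time_diff_splice_ge[of \<alpha>] by blast
  \<comment> \<open>The first summand makes the fourth-moment term \<open>C / \<kappa> ^ 4\<close>
    at most half of the gain \<open>c / \<kappa>\<^sup>2\<close>. The second ensures
    \<open>c \<le> \<kappa>\<^sup>2\<close>, hence \<open>\<eta> \<le> 1\<close>, so that
    \<open>ennreal (1 - \<eta>)\<close> is not truncated.\<close>
  define \<kappa> where "\<kappa> = sqrt (2 * (C + 1) / c + c)"
  have \<kappa>2: "\<kappa>\<^sup>2 = 2 * (C + 1) / c + c" using c C by (simp add: \<kappa>_def add_nonneg_nonneg)
  have \<kappa>: "0 < \<kappa>" using c C by (simp add: \<kappa>_def add_nonneg_pos)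
  define \<eta> where "\<eta> = c / (2 * \<kappa>\<^sup>2)"
  have \<eta>: "0 < \<eta>" using c \<kappa> by (simp add: \<eta>_def)
  have \<eta>_le: "1 + C / \<kappa> ^ 4 - c / \<kappa>\<^sup>2 \<le> 1 - \<eta>"
  proof -
    have "C / \<kappa> ^ 4 = C / \<kappa>\<^sup>2 / \<kappa>\<^sup>2" by (simp add: power2_eq_square power4_eq_xxxx)
    also have "C / \<kappa>\<^sup>2 \<le> c / 2" 
    proof -
      have "2 * (C + 1) / c \<le> \<kappa>\<^sup>2" unfolding \<kappa>2 using c by simp
      then have "2 * (C + 1) \<le> c * \<kappa>\<^sup>2" using c by (simp add: pos_divide_le_eq mult.commute)
      then show ?thesis using \<kappa> by (simp add: pos_divide_le_eq)
    qed
    then have "C / \<kappa>\<^sup>2 / \<kappa>\<^sup>2 \<le> c / 2 / \<kappa>\<^sup>2" by (intro divide_right_mono) auto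
    finally show ?thesis by (simp add: \<eta>_def)
  qed
  \<comment> \<open>With \<open>\<tau>\<^sup>2 = \<eta> / 2\<close> the last error term of
    \<open>powr_ge_quartic\<close> uses half of the gap \<open>\<eta>\<close>.\<close>
  define \<tau> where "\<tau> = sqrt (\<eta> / 2)"
  have \<tau>: "0 < \<tau>" "\<tau>\<^sup>2 = \<eta> / 2" using \<eta> by (auto simp: \<tau>_def)
  define c' where "c' = \<kappa> powr q * (\<tau> powr q * (\<eta> / 2))"
  have c': "0 < c'" using \<kappa> \<tau>(1) \<eta> by (simp add: c'_def)
  have main: "ennreal (c' * b powr (q / 4)) \<le> (\<integral>\<^sup>+p. ennreal (\<bar>path_lt \<alpha> (fst p) - path_lt \<alpha> (path_splice T 0 b p)\<bar> powr q) \<partial>(\<mu> \<Otimes>\<^sub>M \<mu>))"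
    if b: "0 < b" "b \<le> b0" for b
  proof -
    have ab: "0 \<le> (0::real)" "0 \<le> b" "b \<le> T" using b b0 by auto
    define K where "K = \<kappa> * b powr (1 / 4)"
    have K: "0 < K" using \<kappa> b by (simp add: K_def)
    have K2: "K\<^sup>2 = \<kappa>\<^sup>2 * sqrt b" and K4: "K ^ 4 = \<kappa> ^ 4 * b"
      using b by (auto simp: K_def power_mult_distrib powr_realpow[symmetric] powr_powr powr_half_sqrt)
    let ?D = "\<lambda>p. path_lt \<alpha> (fst p) - path_lt \<alpha> (path_splice T 0 b p)"
    let ?A = "\<lambda>k p. approx_lt \<alpha> k (fst p) - approx_lt \<alpha> k (path_splice T 0 b p)"
    define \<psi> where "\<psi> y = 1 - y\<^sup>2 + y ^ 4" for y :: real
    have \<psi>0: "0 \<le> \<psi> y" for y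
    proof -
      have "0 \<le> (1 / 2 - y\<^sup>2)\<^sup>2" by simp
      then show ?thesis by (simp add: \<psi>_def power2_eq_square power4_eq_xxxx algebra_simps)
    qed
    note m = measurable_approx_diff[OF ab]
    have [measurable]: "\<And>k. ?A k \<in> borel_measurable (\<mu> \<Otimes>\<^sub>M \<mu>)" "?D \<in> borel_measurable (\<mu> \<Otimes>\<^sub>M \<mu>)"
      using m by auto
    have [measurable]: "\<psi> \<in> borel_measurable borel" unfolding \<psi>_def by measurable
    have fin: "(\<integral>\<^sup>+p. ennreal (\<psi> (?D p / K)) \<partial>(\<mu> \<Otimes>\<^sub>M \<mu>)) \<le> ennreal (1 - \<eta>)"
    proof (rule nn_integral_limit_le[where u="\<lambda>k p. ennreal (\<psi> (?A k p / K))"])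
      show "AE p in \<mu> \<Otimes>\<^sub>M \<mu>. (\<lambda>k. ennreal (\<psi> (?A k p / K))) \<longlonglongrightarrow> ennreal (\<psi> (?D p / K))"
        using AE_path_lt_diff[OF ab]
      proof eventually_elim
        case (elim p)
        have c: "isCont \<psi> (?D p / K)" unfolding \<psi>_def by (intro continuous_intros)
        have "(\<lambda>k. ?A k p / K) \<longlonglongrightarrow> ?D p / K"
          using K by (intro tendsto_divide[OF elim tendsto_const]) auto
        from tendsto_ennrealI[OF isCont_tendsto_compose[OF c this]] show ?case .
      qed
      \<comment> \<open>For fixed \<open>b\<close>, the intervals eventually satisfy the smallness
        condition of the second-moment bound.\<close>
      have "\<forall>\<^sub>F k in sequentially. 8 * (1 / real (Suc k)) \<le> sqrt b"
      proof -
        have "(\<lambda>k. 8 * (1 / real (Suc k))) \<longlonglongrightarrow> 8 * 0" by (intro tendsto_intros LIMSEQ_Suc lim_1_over_n)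
        then have "\<forall>\<^sub>F k in sequentially. 8 * (1 / real (Suc k)) < sqrt b"
          using b by (intro order_tendstoD(2)) auto
        then show ?thesis by eventually_elim simp
      qed
      then show "\<forall>\<^sub>F k in sequentially. (\<integral>\<^sup>+p. ennreal (\<psi> (?A k p / K)) \<partial>(\<mu> \<Otimes>\<^sub>M \<mu>)) \<le> ennreal (1 - \<eta>)"
      proof eventually_elim
        case (elim k)
        let ?X = "\<integral>\<^sup>+p. ennreal (\<psi> (?A k p / K)) \<partial>(\<mu> \<Otimes>\<^sub>M \<mu>)"
        let ?I2 = "\<integral>\<^sup>+p. ennreal ((?A k p)\<^sup>2) \<partial>(\<mu> \<Otimes>\<^sub>M \<mu>)"
        let ?I4 = "\<integral>\<^sup>+p. ennreal ((?A k p) ^ (2 * 2)) \<partial>(\<mu> \<Otimes>\<^sub>M \<mu>)"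
        have I2: "ennreal (c * sqrt b) \<le> ?I2"
          using ge[OF b _ elim] by (simp add: approx_lt_def)
        have I4: "?I4 \<le> ennreal (C * b)" using le[of 0 b k] b b0 by simp
        have "?X + ennreal (1 / K\<^sup>2) * ?I2 = (\<integral>\<^sup>+p. ennreal (\<psi> (?A k p / K)) + ennreal (1 / K\<^sup>2) * ennreal ((?A k p)\<^sup>2) \<partial>(\<mu> \<Otimes>\<^sub>M \<mu>))"
          by (simp add: nn_integral_add nn_integral_cmult)
        also have "\<dots> = (\<integral>\<^sup>+p. ennreal 1 + ennreal (1 / K ^ 4) * ennreal ((?A k p) ^ (2 * 2)) \<partial>(\<mu> \<Otimes>\<^sub>M \<mu>))"
        proof (rule nn_integral_cong)
          fix p
          have e: "ennreal x + ennreal u * ennreal v = ennreal (x + u * v)" if "0 \<le> x" "0 \<le> u" "0 \<le> v" for x u v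
            using that by (simp only: ennreal_plus ennreal_mult mult_nonneg_nonneg)
          have "\<psi> (?A k p / K) + 1 / K\<^sup>2 * (?A k p)\<^sup>2 = 1 + 1 / K ^ 4 * (?A k p) ^ (2 * 2)"
            by (simp add: \<psi>_def power_divide)
          then show "ennreal (\<psi> (?A k p / K)) + ennreal (1 / K\<^sup>2) * ennreal ((?A k p)\<^sup>2) =
             ennreal 1 + ennreal (1 / K ^ 4) * ennreal ((?A k p) ^ (2 * 2))"
            using K by (subst e, (auto simp: \<psi>0)[3], subst e) (auto simp: zero_le_even_power)
        qed
        also have "\<dots> = ennreal 1 + ennreal (1 / K ^ 4) * ?I4"
          by (subst nn_integral_add, measurable) (simp add: nn_integral_cmult pair.emeasure_space_1)
        also have "\<dots> \<le> ennreal 1 + ennreal (1 / K ^ 4) * ennreal (C * b)"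
          by (intro add_left_mono mult_left_mono I4) auto
        also have "\<dots> = ennreal (1 + C / \<kappa> ^ 4)"
        proof -
          have "1 / K ^ 4 * (C * b) = C / \<kappa> ^ 4" using b by (simp add: K4)
          then show ?thesis using K C b
            by (subst ennreal_mult[symmetric], simp, simp, subst ennreal_plus[symmetric], auto)
        qed
        finally have "?X + ennreal (1 / K\<^sup>2) * ?I2 \<le> ennreal (1 + C / \<kappa> ^ 4)" .
        moreover have "ennreal (c / \<kappa>\<^sup>2) \<le> ennreal (1 / K\<^sup>2) * ?I2"
        proof -
          have "ennreal (c / \<kappa>\<^sup>2) = ennreal (1 / K\<^sup>2) * ennreal (c * sqrt b)"
            using b c by (subst ennreal_mult[symmetric]) (auto simp: K2)
          also have "\<dots> \<le> ennreal (1 / K\<^sup>2) * ?I2" by (intro mult_left_mono I2) auto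
          finally show ?thesis .
        qed
        ultimately have X: "?X + ennreal (c / \<kappa>\<^sup>2) \<le> ennreal (1 + C / \<kappa> ^ 4)"
          by (meson add_left_mono order_trans)
        show "?X \<le> ennreal (1 - \<eta>)"
        proof (cases ?X)
          case (real x)
          have "ennreal (x + c / \<kappa>\<^sup>2) \<le> ennreal (1 + C / \<kappa> ^ 4)"
            using X real c by (subst ennreal_plus) auto
          then have "x + c / \<kappa>\<^sup>2 \<le> 1 + C / \<kappa> ^ 4" using C by (subst (asm) ennreal_le_iff) auto
          then have "x \<le> 1 - \<eta>" using \<eta>_le by linarith
          then show ?thesis using real by (simp add: ennreal_leI)
        next
          case top
          then show ?thesis using X by (simp add: top_unique)
        qed
      qed
    qed measurable
    let ?Y = "\<integral>\<^sup>+p. ennreal (\<bar>?D p / K\<bar> powr q) \<partial>(\<mu> \<Otimes>\<^sub>M \<mu>)"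
    have "ennreal (\<tau> powr q) = (\<integral>\<^sup>+p. ennreal (\<tau> powr q) \<partial>(\<mu> \<Otimes>\<^sub>M \<mu>))"
      by (simp add: pair.emeasure_space_1)
    also have "\<dots> \<le> (\<integral>\<^sup>+p. ennreal (\<bar>?D p / K\<bar> powr q) + ennreal (\<tau> powr q) * ennreal (\<psi> (?D p / K)) + ennreal (\<tau> powr q * \<tau>\<^sup>2) \<partial>(\<mu> \<Otimes>\<^sub>M \<mu>))"
    proof (rule nn_integral_mono)
      fix p
      have "ennreal (\<bar>?D p / K\<bar> powr q) + ennreal (\<tau> powr q) * ennreal (\<psi> (?D p / K)) + ennreal (\<tau> powr q * \<tau>\<^sup>2) =
        ennreal (\<bar>?D p / K\<bar> powr q + \<tau> powr q * \<psi> (?D p / K) + \<tau> powr q * \<tau>\<^sup>2)"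
        by (simp only: ennreal_plus ennreal_mult mult_nonneg_nonneg add_nonneg_nonneg powr_ge_zero \<psi>0 zero_le_power2)
      then show "ennreal (\<tau> powr q) \<le> ennreal (\<bar>?D p / K\<bar> powr q) + ennreal (\<tau> powr q) * ennreal (\<psi> (?D p / K)) + ennreal (\<tau> powr q * \<tau>\<^sup>2)"
        using powr_ge_quartic[OF q \<tau>(1), of "?D p / K"] by (simp only: \<psi>_def ennreal_leI)
    qed
    also have "\<dots> = ?Y + ennreal (\<tau> powr q) * (\<integral>\<^sup>+p. ennreal (\<psi> (?D p / K)) \<partial>(\<mu> \<Otimes>\<^sub>M \<mu>)) + ennreal (\<tau> powr q * \<tau>\<^sup>2)"
      by (simp add: nn_integral_add nn_integral_cmult pair.emeasure_space_1)
    also have "\<dots> \<le> ?Y + ennreal (\<tau> powr q) * ennreal (1 - \<eta>) + ennreal (\<tau> powr q * \<tau>\<^sup>2)"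
      by (intro add_mono mult_left_mono fin) auto
    finally have Y: "ennreal (\<tau> powr q) \<le> ?Y + ennreal (\<tau> powr q) * ennreal (1 - \<eta>) + ennreal (\<tau> powr q * \<tau>\<^sup>2)" .
    have \<eta>1: "\<eta> \<le> 1"
    proof -
      have "c \<le> \<kappa>\<^sup>2" unfolding \<kappa>2 using c C by simp
      then have "c \<le> 1 * (2 * \<kappa>\<^sup>2)" by simp (smt (verit) zero_le_power2)
      then show ?thesis unfolding \<eta>_def using \<kappa> by (subst pos_divide_le_eq) auto
    qed
    have Y2: "ennreal (\<tau> powr q * (\<eta> / 2)) \<le> ?Y"
    proof (cases ?Y)
      case (real y)
      have "?Y + ennreal (\<tau> powr q) * ennreal (1 - \<eta>) + ennreal (\<tau> powr q * \<tau>\<^sup>2) = ennreal (y + \<tau> powr q * (1 - \<eta>) + \<tau> powr q * \<tau>\<^sup>2)"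
        using real \<eta>1
        by (simp only: ennreal_plus ennreal_mult mult_nonneg_nonneg add_nonneg_nonneg powr_ge_zero zero_le_power2 diff_ge_0_iff_ge)
      from Y[unfolded this] have "\<tau> powr q \<le> y + \<tau> powr q * (1 - \<eta>) + \<tau> powr q * \<tau>\<^sup>2"
        using real \<eta>1 by (subst (asm) ennreal_le_iff) auto
      then have "\<tau> powr q * (\<eta> / 2) \<le> y" unfolding \<tau>(2) by (simp add: algebra_simps)
      then show ?thesis using real by (simp add: ennreal_leI)
    qed simp
    have "c' * b powr (q / 4) = K powr q * (\<tau> powr q * (\<eta> / 2))"
      using \<kappa> b by (simp add: c'_def K_def powr_mult powr_powr)
    then have "ennreal (c' * b powr (q / 4)) = ennreal (K powr q * (\<tau> powr q * (\<eta> / 2)))"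
      by (rule arg_cong)
    also have "\<dots> = ennreal (K powr q) * ennreal (\<tau> powr q * (\<eta> / 2))"
      using \<eta> by (intro ennreal_mult) auto
    also have "\<dots> \<le> ennreal (K powr q) * ?Y" by (intro mult_left_mono Y2) auto
    also have "\<dots> = (\<integral>\<^sup>+p. ennreal (K powr q) * ennreal (\<bar>?D p / K\<bar> powr q) \<partial>(\<mu> \<Otimes>\<^sub>M \<mu>))"
      by (simp add: nn_integral_cmult)
    also have "\<dots> = (\<integral>\<^sup>+p. ennreal (\<bar>?D p\<bar> powr q) \<partial>(\<mu> \<Otimes>\<^sub>M \<mu>))"
      using K by (intro nn_integral_cong) (simp add: ennreal_mult[symmetric] powr_divide abs_divide)
    finally show ?thesis .
  qed
  show ?thesis using c' b0 main by blast
qed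

end

end

section \<open>Transfer from path space to the given probability spaces\<close>

lemma (in complete_measure) borel_measurable_AE_eq:
  fixes f g :: "'a \<Rightarrow> real"
  assumes g: "g \<in> borel_measurable M" and eq: "AE x in M. f x = g x"
  shows "f \<in> borel_measurable M"
proof (rule measurableI)
  fix A :: "real set"
  assume "A \<in> sets borel"
  then have A: "g -` A \<inter> space M \<in> sets M" by (rule measurable_sets[OF g])
  have "AE x in M. x \<in> g -` A \<inter> space M \<longleftrightarrow> x \<in> f -` A \<inter> space M"
    using eq by eventually_elim auto
  from in_sets_AE[OF this A] show "f -` A \<inter> space M \<in> sets M" by simp
qed simp

lemma (in wiener_measure) approx_lt_sample_path:
  assumes W: "brownian_motion T M W" and \<omega>: "\<omega> \<in> space M"
  defines "\<epsilon> \<equiv> \<lambda>n. 1 / real (Suc n)"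
  shows "approx_lt \<alpha> n (sample_path T W \<omega>) =
    1 / (2 * \<epsilon> n) * (LBINT s:{0..T}. indicator {\<alpha> - \<epsilon> n<..<\<alpha> + \<epsilon> n} (W s \<omega>))"
proof -
  let ?w = "sample_path T W \<omega>"
  have w: "?w \<in> space \<mu>"
    using measurable_space[OF measurable_sample_path[OF W] \<omega>] by (simp add: space_wiener)
  have [measurable]: "(\<lambda>u. path_at u ?w) \<in> borel_measurable borel"
    using continuous_on_path_at[OF w] by (rule borel_measurable_continuous_onI)
  have "(LBINT s:{0..T}. indicator {\<alpha> - \<epsilon> n<..<\<alpha> + \<epsilon> n} (W s \<omega>)) =
    (LINT s|lborel. indicator {0..T} s * indicator {\<alpha> - \<epsilon> n<..<\<alpha> + \<epsilon> n} (path_at s ?w) :: real)"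
    unfolding set_lebesgue_integral_def
    by (intro Bochner_Integration.integral_cong refl) (auto simp: indicator_def sample_path_def)
  also have "\<dots> = (LINT s|lborel. indicator {0<..<T} s * indicator {\<alpha> - \<epsilon> n<..<\<alpha> + \<epsilon> n} (path_at s ?w))"
  proof (rule integral_cong_AE)
    show "AE s in lborel. indicator {0..T} s * indicator {\<alpha> - \<epsilon> n<..<\<alpha> + \<epsilon> n} (path_at s ?w) =
      (indicator {0<..<T} s * indicator {\<alpha> - \<epsilon> n<..<\<alpha> + \<epsilon> n} (path_at s ?w) :: real)"
      using AE_lborel_singleton[of 0] AE_lborel_singleton[of T] by eventually_elim (auto simp: indicator_def)
  qed measurable
  also have "1 / (2 * \<epsilon> n) * \<dots> = approx_lt \<alpha> n ?w"
    unfolding approx_lt_def occ_time_def window_def \<epsilon>_def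
    by (subst integral_mult_right_zero[symmetric]) (intro Bochner_Integration.integral_cong refl, simp)
  finally show ?thesis by simp
qed

text \<open>Passing to the countable family \<open>\<epsilon> = 1 / (n + 1)\<close> makes measurable
  limits and Fatou's lemma applicable.\<close>

lemma local_time_tendsto:
  assumes "is_local_time M W \<alpha> T L"
  shows "AE \<omega> in M. (\<lambda>n. 1 / (2 * (1 / real (Suc n))) *
    (LBINT s:{0..T}. indicator {\<alpha> - 1 / real (Suc n)<..<\<alpha> + 1 / real (Suc n)} (W s \<omega>))) \<longlonglongrightarrow> L \<omega>"
  using assms unfolding is_local_time_def
proof eventually_elim
  case (elim \<omega>)
  have "(\<lambda>n. 1 / real (Suc n)) \<longlonglongrightarrow> 0" by (rule LIMSEQ_Suc[OF lim_1_over_n])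
  then have "filterlim (\<lambda>n. 1 / real (Suc n)) (at_right 0) sequentially"
    unfolding filterlim_at by (simp del: of_nat_Suc)
  from filterlim_compose[OF elim this] show ?case .
qed

text \<open>For membership the witness is \<open>F = path_lt \<alpha>\<close>. For the exclusion
  \<open>F\<close> is arbitrary, but it agrees with \<open>path_lt \<alpha>\<close> almost
  everywhere for \<open>\<mu>\<close>, and the spliced path has law \<open>\<mu>\<close> as well; so
  the quantities to be estimated are the same for every representation.\<close>

lemma local_time_besov_space:
  fixes T \<alpha> p r :: real
  assumes T: "T > 0"
    and W: "wiener_setting T M W" and W': "wiener_setting T M' W'"
    and L: "is_local_time M W \<alpha> T L"
    and p: "p > 1"
  shows "L \<in> besov_space T M W M' W' 4 p" and "r \<in> {2..<4} \<Longrightarrow> L \<notin> besov_space T M W M' W' r p"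
proof -
  have B: "brownian_motion T M W" and B': "brownian_motion T M' W'"
    and comp: "M = completion (restr_to_subalg M (generated_sigma T M W))"
    using W W' by (auto simp: wiener_setting_def)
  define \<mu> where "\<mu> = distr M (path_space T) (sample_path T W)"
  have \<mu>': "\<mu> = distr M' (path_space T) (sample_path T W')"
    unfolding \<mu>_def using T by (intro brownian_motion_law_unique[OF B B']) simp
  interpret wiener_measure \<mu> T
    unfolding \<mu>_def by (rule wiener_measure_brownian_motion[OF B T])
  interpret M: prob_space M using B by (simp add: brownian_motion_def)
  interpret M': prob_space M' using B' by (simp add: brownian_motion_def)
  interpret MM': pair_prob_space M M' ..
  interpret complete_measure M
    using completion.complete_measure_axioms[of "restr_to_subalg M (generated_sigma T M W)"]
    unfolding comp[symmetric] .
  have p0: "0 < p" using p by simp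
  let ?s = "sample_path T W" and ?s' = "sample_path T W'"
  have ms: "?s \<in> measurable M (path_space T)" and ms': "?s' \<in> measurable M' (path_space T)"
    by (rule measurable_sample_path[OF B], rule measurable_sample_path[OF B'])
  have ms2: "?s \<in> measurable M \<mu>" using ms by measurable
  have approx: "AE \<omega> in M. (\<lambda>n. approx_lt \<alpha> n (?s \<omega>)) \<longlonglongrightarrow> L \<omega>"
    using local_time_tendsto[OF L] AE_space
    by eventually_elim (simp only: approx_lt_sample_path[OF B])
  \<comment> \<open>Passing from \<open>M\<close> to the law requires the set of convergence to be
    measurable, which the Cauchy criterion shows.\<close>
  have conv: "AE w in \<mu>. convergent (\<lambda>n. approx_lt \<alpha> n w)"
  proof -
    have S: "{w \<in> space (path_space T). convergent (\<lambda>n. approx_lt \<alpha> n w)} \<in> sets (path_space T)"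
    proof -
      have "{w \<in> space \<mu>. convergent (\<lambda>n. approx_lt \<alpha> n w)} \<in> sets \<mu>"
        unfolding Cauchy_convergent_iff[symmetric] by (rule sets_Collect_Cauchy) (rule measurable_approx_lt)
      then show ?thesis unfolding space_wiener sets_wiener .
    qed
    have "AE \<omega> in M. convergent (\<lambda>n. approx_lt \<alpha> n (?s \<omega>))"
      using approx by eventually_elim (rule convergentI)
    then show ?thesis unfolding \<mu>_def AE_distr_iff[OF ms S] .
  qed
  have Leq: "AE \<omega> in M. L \<omega> = path_lt \<alpha> (?s \<omega>)"
    using approx by eventually_elim (simp add: path_lt_def limI)
  \<comment> \<open>\<open>L\<close> is determined only up to a null set, so its measurability rests
    on the completeness of \<open>M\<close>.\<close>
  have Lm: "L \<in> borel_measurable M"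
    by (rule borel_measurable_AE_eq[OF measurable_compose[OF ms2 measurable_path_lt] Leq])
  have push: "(\<integral>\<^sup>+w. f w \<partial>\<mu>) = (\<integral>\<^sup>+\<omega>. f (?s \<omega>) \<partial>M)" if "f \<in> borel_measurable \<mu>" for f :: "_ \<Rightarrow> ennreal"
  proof -
    have "f \<in> borel_measurable (path_space T)" using that measurable_cong_sets[OF sets_wiener refl] by blast
    from nn_integral_distr[OF ms, of f] this show ?thesis unfolding \<mu>_def[symmetric] by simp
  qed
  have Lp: "L \<in> Lp_space M p"
  proof -
    have "(\<integral>\<^sup>+\<omega>. ennreal (\<bar>L \<omega>\<bar> powr p) \<partial>M) = (\<integral>\<^sup>+\<omega>. ennreal (\<bar>path_lt \<alpha> (?s \<omega>)\<bar> powr p) \<partial>M)"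
    proof (rule nn_integral_cong_AE)
      show "AE \<omega> in M. ennreal (\<bar>L \<omega>\<bar> powr p) = ennreal (\<bar>path_lt \<alpha> (?s \<omega>)\<bar> powr p)"
        using Leq by eventually_elim simp
    qed
    also have "\<dots> = (\<integral>\<^sup>+w. ennreal (\<bar>path_lt \<alpha> w\<bar> powr p) \<partial>\<mu>)"
      by (rule push[symmetric]) (intro measurable_compose[OF measurable_path_lt], measurable)
    also have "\<dots> < \<infinity>" by (rule nn_integral_path_lt_finite[OF conv p0])
    finally show ?thesis using Lm by (auto simp: Lp_space_def Lp_norm_def Let_def)
  qed
  have ppm: "\<mu> \<Otimes>\<^sub>M \<mu> = distr (M \<Otimes>\<^sub>M M') (path_space T \<Otimes>\<^sub>M path_space T) (\<lambda>(x, y). (?s x, ?s' y))"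
  proof -
    have "sigma_finite_measure (distr M' (path_space T) ?s')"
      using sigma_finite_measure_axioms unfolding \<mu>'[symmetric] .
    from pair_measure_distr[OF ms ms' this] show ?thesis unfolding \<mu>_def[symmetric] \<mu>'[symmetric] .
  qed
  \<comment> \<open>The completion of the product measure leaves the nonnegative integral unchanged,
    and the pair of sample paths maps the product of \<open>M\<close> and \<open>M'\<close> to
    \<open>\<mu> \<Otimes>\<^sub>M \<mu>\<close>. Replacing \<open>F\<close> by
    \<open>path_lt \<alpha>\<close> uses the invariance of \<open>\<mu>\<close> under
    splicing.\<close>
  have transfer: "(\<integral>\<^sup>+z. ennreal (\<bar>case z of (\<omega>, \<omega>') \<Rightarrow> L \<omega> - F (sample_path T (decoupled_process W W' a b) (\<omega>, \<omega>'))\<bar> powr p) \<partial>completion (M \<Otimes>\<^sub>M M')) =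
     (\<integral>\<^sup>+z. ennreal (\<bar>path_lt \<alpha> (fst z) - path_lt \<alpha> (path_splice T a b z)\<bar> powr p) \<partial>(\<mu> \<Otimes>\<^sub>M \<mu>))"
    if F: "F \<in> borel_measurable (path_space T)" and FL: "AE \<omega> in M. L \<omega> = F (?s \<omega>)"
      and ab: "0 \<le> a" "a < b" "b \<le> T" for F a b
  proof -
    have ab': "a \<le> b" using ab by simp
    have F\<mu>: "F \<in> borel_measurable \<mu>" using F measurable_cong_sets[OF sets_wiener refl] by blast
    have "AE \<omega> in M. F (?s \<omega>) = path_lt \<alpha> (?s \<omega>)"
      using FL Leq by eventually_elim simp
    then have Feq: "AE w in \<mu>. F w = path_lt \<alpha> w"
    proof -
      have "{w \<in> space \<mu>. F w = path_lt \<alpha> w} \<in> sets \<mu>" using F\<mu> by measurable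
      then have S: "{w \<in> space (path_space T). F w = path_lt \<alpha> w} \<in> sets (path_space T)"
        unfolding space_wiener sets_wiener .
      assume "AE \<omega> in M. F (?s \<omega>) = path_lt \<alpha> (?s \<omega>)"
      then show ?thesis unfolding \<mu>_def AE_distr_iff[OF ms S] .
    qed
    have msp: "path_splice T a b \<in> measurable (\<mu> \<Otimes>\<^sub>M \<mu>) \<mu>"
      using measurable_splice[OF ab(1) ab' ab(3)] by measurable
    have "(\<integral>\<^sup>+z. ennreal (\<bar>case z of (\<omega>, \<omega>') \<Rightarrow> L \<omega> - F (sample_path T (decoupled_process W W' a b) (\<omega>, \<omega>'))\<bar> powr p) \<partial>completion (M \<Otimes>\<^sub>M M'))
      = (\<integral>\<^sup>+z. ennreal (\<bar>case z of (\<omega>, \<omega>') \<Rightarrow> L \<omega> - F (sample_path T (decoupled_process W W' a b) (\<omega>, \<omega>'))\<bar> powr p) \<partial>(M \<Otimes>\<^sub>M M'))"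
      by (rule nn_integral_completion)
    also have "\<dots> = (\<integral>\<^sup>+z. ennreal (\<bar>path_lt \<alpha> (?s (fst z)) - F (path_splice T a b (?s (fst z), ?s' (snd z)))\<bar> powr p) \<partial>(M \<Otimes>\<^sub>M M'))"
    proof (rule nn_integral_cong_AE)
      have "AE z in M \<Otimes>\<^sub>M M'. L (fst z) = path_lt \<alpha> (?s (fst z))"
        using Leq by (intro AE_distrD[OF measurable_fst, of "\<lambda>\<omega>. L \<omega> = path_lt \<alpha> (?s \<omega>)" M M']) (simp only: M'.distr_pair_fst)
      then show "AE z in M \<Otimes>\<^sub>M M'. ennreal (\<bar>case z of (\<omega>, \<omega>') \<Rightarrow> L \<omega> - F (sample_path T (decoupled_process W W' a b) (\<omega>, \<omega>'))\<bar> powr p) =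
        ennreal (\<bar>path_lt \<alpha> (?s (fst z)) - F (path_splice T a b (?s (fst z), ?s' (snd z)))\<bar> powr p)"
        by eventually_elim (simp add: split_beta' sample_path_decoupled_process[OF ab(1) ab' ab(3)])
    qed
    also have "\<dots> = (\<integral>\<^sup>+z. ennreal (\<bar>path_lt \<alpha> (fst z) - F (path_splice T a b z)\<bar> powr p) \<partial>(\<mu> \<Otimes>\<^sub>M \<mu>))"
    proof -
      have "(\<lambda>z. ennreal (\<bar>path_lt \<alpha> (fst z) - F (path_splice T a b z)\<bar> powr p)) \<in> borel_measurable (\<mu> \<Otimes>\<^sub>M \<mu>)"
        using F\<mu> msp by measurable
      then have "(\<lambda>z. ennreal (\<bar>path_lt \<alpha> (fst z) - F (path_splice T a b z)\<bar> powr p)) \<in>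
          borel_measurable (path_space T \<Otimes>\<^sub>M path_space T)"
        using measurable_cong_sets[OF sets_pair_measure_cong[OF sets_wiener sets_wiener] refl] by blast
      moreover have "(\<lambda>(x, y). (?s x, ?s' y)) \<in> measurable (M \<Otimes>\<^sub>M M') (path_space T \<Otimes>\<^sub>M path_space T)"
        using ms ms' by measurable
      ultimately have "(\<integral>\<^sup>+z. ennreal (\<bar>path_lt \<alpha> (fst z) - F (path_splice T a b z)\<bar> powr p) \<partial>(\<mu> \<Otimes>\<^sub>M \<mu>)) =
        (\<integral>\<^sup>+z. ennreal (\<bar>path_lt \<alpha> (fst (case z of (x, y) \<Rightarrow> (?s x, ?s' y))) -
            F (path_splice T a b (case z of (x, y) \<Rightarrow> (?s x, ?s' y)))\<bar> powr p) \<partial>(M \<Otimes>\<^sub>M M'))"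
        by (subst ppm) (rule nn_integral_distr; simp only: measurable_distr_eq1)
      then show ?thesis by (simp only: split_beta' fst_conv)
    qed
    also have "\<dots> = (\<integral>\<^sup>+z. ennreal (\<bar>path_lt \<alpha> (fst z) - path_lt \<alpha> (path_splice T a b z)\<bar> powr p) \<partial>(\<mu> \<Otimes>\<^sub>M \<mu>))"
    proof (rule nn_integral_cong_AE)
      show "AE z in \<mu> \<Otimes>\<^sub>M \<mu>. ennreal (\<bar>path_lt \<alpha> (fst z) - F (path_splice T a b z)\<bar> powr p) =
        ennreal (\<bar>path_lt \<alpha> (fst z) - path_lt \<alpha> (path_splice T a b z)\<bar> powr p)"
        using AE_pair_splice[OF Feq ab(1) ab' ab(3)] by eventually_elim simp
    qed
    finally show ?thesis .
  qed
  define N where "N F a b = Lp_norm (completion (M \<Otimes>\<^sub>M M')) p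
    (\<lambda>(\<omega>, \<omega>'). L \<omega> - F (sample_path T (decoupled_process W W' a b) (\<omega>, \<omega>')))" for F a b
  show "L \<in> besov_space T M W M' W' 4 p"
  proof -
    obtain C where C: "0 \<le> C" and le: "\<And>a b. 0 \<le> a \<Longrightarrow> a < b \<Longrightarrow> b \<le> T \<Longrightarrow>
      (\<integral>\<^sup>+z. ennreal (\<bar>path_lt \<alpha> (fst z) - path_lt \<alpha> (path_splice T a b z)\<bar> powr p) \<partial>(\<mu> \<Otimes>\<^sub>M \<mu>))
        \<le> ennreal (C * (b - a) powr (p / 4))"
      using nn_integral_path_lt_diff_le[OF conv p0] by blast
    have F: "path_lt \<alpha> \<in> borel_measurable (path_space T)"
      using measurable_path_lt[of \<alpha>] measurable_cong_sets[OF sets_wiener refl] by blast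
    have bd: "N (path_lt \<alpha>) a b / ennreal ((b - a) powr (1 / 4)) \<le> ennreal (C powr (1 / p))"
      if ab: "0 \<le> a" "a < b" "b \<le> T" for a b
    proof -
      have "N (path_lt \<alpha>) a b \<le> ennreal (C powr (1 / p) * (b - a) powr (1 / 4))"
        unfolding N_def
      proof (rule Lp_norm_le[OF p0])
        have "(C powr (1 / p) * (b - a) powr (1 / 4)) powr p = C * (b - a) powr (p / 4)"
          using C ab p0 by (simp add: powr_mult powr_powr)
        then show "(\<integral>\<^sup>+z. ennreal (\<bar>case z of (\<omega>, \<omega>') \<Rightarrow> L \<omega> - path_lt \<alpha> (sample_path T (decoupled_process W W' a b) (\<omega>, \<omega>'))\<bar> powr p) \<partial>completion (M \<Otimes>\<^sub>M M'))
          \<le> ennreal ((C powr (1 / p) * (b - a) powr (1 / 4)) powr p)"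
          unfolding transfer[OF F Leq ab] using le[OF ab] by simp
      qed simp
      then have "N (path_lt \<alpha>) a b / ennreal ((b - a) powr (1 / 4)) \<le>
         ennreal (C powr (1 / p) * (b - a) powr (1 / 4)) / ennreal ((b - a) powr (1 / 4))"
        by (rule divide_right_mono_ennreal)
      also have "\<dots> = ennreal (C powr (1 / p))"
        using ab by (subst divide_ennreal) auto
      finally show ?thesis .
    qed
    have "(SUP (a, b) \<in> {(a, b). 0 \<le> a \<and> a < b \<and> b \<le> T}. N (path_lt \<alpha>) a b / ennreal ((b - a) powr (1 / 4))) \<le> ennreal (C powr (1 / p))"
      using bd by (intro SUP_least) auto
    also have "\<dots> < \<infinity>" by simp
    finally have "(SUP (a, b) \<in> {(a, b). 0 \<le> a \<and> a < b \<and> b \<le> T}. N (path_lt \<alpha>) a b / ennreal ((b - a) powr (1 / 4))) < \<infinity>" .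
    then show ?thesis
      using Lp F Leq unfolding besov_space_def N_def by blast
  qed
  assume r: "r \<in> {2..<4}"
  show "L \<notin> besov_space T M W M' W' r p"
  proof
    assume "L \<in> besov_space T M W M' W' r p"
    then obtain F where F: "F \<in> borel_measurable (path_space T)" and FL: "AE \<omega> in M. L \<omega> = F (?s \<omega>)"
      and sup: "(SUP (a, b) \<in> {(a, b). 0 \<le> a \<and> a < b \<and> b \<le> T}. N F a b / ennreal ((b - a) powr (1 / r))) < \<infinity>"
      unfolding besov_space_def N_def by blast
    obtain c b0 where c: "0 < c" and b0: "0 < b0" "b0 \<le> T" and ge: "\<And>b. 0 < b \<Longrightarrow> b \<le> b0 \<Longrightarrow> ennreal (c * b powr (p / 4)) \<le>
      (\<integral>\<^sup>+z. ennreal (\<bar>path_lt \<alpha> (fst z) - path_lt \<alpha> (path_splice T 0 b z)\<bar> powr p) \<partial>(\<mu> \<Otimes>\<^sub>M \<mu>))"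
      using nn_integral_path_lt_diff_ge[OF conv p0] by blast
    define S where "S = (SUP (a, b) \<in> {(a, b). 0 \<le> a \<and> a < b \<and> b \<le> T}. N F a b / ennreal ((b - a) powr (1 / r)))"
    obtain s where s: "0 \<le> s" "S = ennreal s" using sup unfolding S_def[symmetric] by (cases S) auto
    have bound: "c powr (1 / p) * b powr (1 / 4 - 1 / r) \<le> s" if b: "0 < b" "b \<le> b0" for b
    proof -
      have ab: "0 \<le> (0::real)" "0 < b" "b \<le> T" using b b0 by auto
      have "ennreal (c powr (1 / p) * b powr (1 / 4)) \<le> N F 0 b"
        unfolding N_def
      proof (rule Lp_norm_ge[OF p0])
        have "(c powr (1 / p) * b powr (1 / 4)) powr p = c * b powr (p / 4)"
          using c ab p0 by (simp add: powr_mult powr_powr)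
        then show "ennreal ((c powr (1 / p) * b powr (1 / 4)) powr p) \<le>
          (\<integral>\<^sup>+z. ennreal (\<bar>case z of (\<omega>, \<omega>') \<Rightarrow> L \<omega> - F (sample_path T (decoupled_process W W' 0 b) (\<omega>, \<omega>'))\<bar> powr p) \<partial>completion (M \<Otimes>\<^sub>M M'))"
          unfolding transfer[OF F FL ab] using ge[OF b] by simp
      qed simp
      then have "ennreal (c powr (1 / p) * b powr (1 / 4)) / ennreal ((b - 0) powr (1 / r)) \<le> N F 0 b / ennreal ((b - 0) powr (1 / r))"
        by (rule divide_right_mono_ennreal)
      also have "\<dots> \<le> S"
        unfolding S_def by (rule SUP_upper2[where i="(0, b)"]) (use ab in auto)
      finally have "ennreal (c powr (1 / p) * b powr (1 / 4)) / ennreal ((b - 0) powr (1 / r)) \<le> ennreal s" using s by simp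
      moreover have "ennreal (c powr (1 / p) * b powr (1 / 4)) / ennreal ((b - 0) powr (1 / r)) = ennreal (c powr (1 / p) * b powr (1 / 4 - 1 / r))"
        using b by (subst divide_ennreal) (auto simp: powr_diff)
      ultimately show ?thesis using s by simp
    qed
    define e where "e = 1 / r - 1 / 4"
    have e: "0 < e" using r by (simp add: e_def field_simps)
    define k where "k = c powr (1 / p)"
    have k: "0 < k" using c by (simp add: k_def)
    \<comment> \<open>Chosen so that \<open>b powr e \<le> k / (s + 1)\<close>. Then
      \<open>k * b powr (- e)\<close> is at least \<open>s + 1\<close>, against the bound
      \<open>s\<close> from a finite supremum.\<close>
    define b where "b = min b0 ((k / (s + 1)) powr (1 / e))"
    have sk: "0 < k / (s + 1)" using s k by simp
    have b: "0 < b" "b \<le> b0" using b0 sk by (auto simp: b_def)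
    have "b powr e \<le> ((k / (s + 1)) powr (1 / e)) powr e"
      using b e by (intro powr_mono2) (auto simp: b_def)
    also have "\<dots> = k / (s + 1)" using e k s by (simp add: powr_powr)
    finally have be: "b powr e \<le> k / (s + 1)" .
    have "s + 1 \<le> k / b powr e"
    proof -
      have "b powr e * (s + 1) \<le> k" using be s by (simp add: pos_le_divide_eq)
      moreover have "0 < b powr e" using b by simp
      ultimately show ?thesis by (simp only: pos_le_divide_eq mult.commute)
    qed
    also have "\<dots> = k * b powr (1 / 4 - 1 / r)"
    proof -
      have "1 / 4 - 1 / r = - e" by (simp add: e_def)
      then show ?thesis using b by (simp add: powr_minus_divide)
    qed
    also have "\<dots> \<le> s" unfolding k_def by (rule bound[OF b])
    finally show False by simp
  qed
qed

theorem corollary4p30: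
  fixes T \<alpha> p :: real
    and M :: "'a measure" and W :: "real \<Rightarrow> 'a \<Rightarrow> real"
    and M' :: "'b measure" and W' :: "real \<Rightarrow> 'b \<Rightarrow> real"
    and L :: "'a \<Rightarrow> real"
  assumes "T > 0"
    and "wiener_setting T M W"
    and "wiener_setting T M' W'"
    and "is_local_time M W \<alpha> T L"
    and "p > 1"
  shows "L \<in> besov_space T M W M' W' 4 p - (\<Union>r\<in>{2..<4}. besov_space T M W M' W' r p)"
  using local_time_besov_space(1)[OF assms] local_time_besov_space(2)[OF assms] by (intro DiffI) auto

end
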